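(* Let $(M^m,g)$ be a Riemannian manifold of dimension $m\ge 1$ and let $\phi: M^m\to \mathbb{R}^{n+1}$ be an isometric immersion with $\phi(M)\subset S^n$, such that $\Delta^2\phi=\lambda\,\phi$ for some function $\lambda$ on $M$. Suppose that $\phi$, regarded as an isometric immersion $\phi: M^m\to S^n$, is a biharmonic map (i.e. $\phi: M\to S^n$ is a biharmonic submanifold). Then $\lambda= m^2$ (identically on $M$), and the submanifold $\phi: M\to S^n$ is minimal.
   Context: Everything is smooth. $S^n\subset\mathbb{R}^{n+1}$ is the unit sphere centered at the origin with its standard metric. $\Delta f=\mathrm{div}(\nabla f)$ is the Laplace operator of $(M,g)$ acting on functions; it is applied componentwise to $\mathbb{R}^{n+1}$-valued maps, and $\Delta^2\phi=\Delta(\Delta\phi)$. For a map $\varphi:(M,g)\to(N,h)$ between Riemannian manifolds, $\tau(\varphi)=\mathrm{Tr}_g\nabla d\varphi$ is its tension field; $\varphi$ is harmonic if $\tau(\varphi)=0$. The map $\varphi$ is biharmonic if it is a critical point of the bienergy $E_2(\varphi)=\frac12\int_M|\tau(\varphi)|^2\,dv_g$ (with respect to compactly supported variations); equivalently, $\mathrm{Tr}_g\big(\nabla^{\varphi}\nabla^{\varphi}-\nabla^{\varphi}_{\nabla^M}\big)\tau(\varphi)-\mathrm{Tr}_g R^N(d\varphi,\tau(\varphi))d\varphi=0$, with the curvature convention $R^N(X,Y)=[\nabla_X,\nabla_Y]-\nabla_{[X,Y]}$. A biharmonic submanifold is (the image of) an isometric immersion that is a biharmonic map. An isometric immersion is minimal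 if its mean curvature vector field vanishes identically (equivalently, it is harmonic). *)

theory Defs
  imports "HOL-Analysis.Analysis"
begin

section \<open>Smooth maps between Euclidean spaces\<close>

text \<open>
  Meant for open \<open>S\<close> in a finite-dimensional space.  There, continuity of all iterated directional
  derivatives is the usual \<open>C\<^sup>k\<close> condition.
\<close>

primrec Ck_on :: "nat \<Rightarrow> 'a::real_normed_vector set \<Rightarrow> ('a \<Rightarrow> 'b::real_normed_vector) \<Rightarrow> bool" where
  "Ck_on 0 S f \<longleftrightarrow> continuous_on S f"
| "Ck_on (Suc k) S f \<longleftrightarrow> (\<forall>x\<in>S. f differentiable (at x)) \<and>
     (\<forall>v. Ck_on k S (\<lambda>x. frechet_derivative f (at x) v))"

definition smooth_on :: "'a::real_normed_vector set \<Rightarrow> ('a \<Rightarrow> 'b::real_normed_vector) \<Rightarrow> bool" where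
  "smooth_on S f \<longleftrightarrow> (\<forall>k. Ck_on k S f)"

section \<open>Riemannian manifolds\<close>

text \<open>
  A chart is a pair of a domain and a coordinate map; the values of the coordinate map outside the
  domain are irrelevant.  The dimension of the manifold is \<open>CARD('m)\<close>.  The metric is given by its
  coordinate matrices: \<open>gmat M c p\<close> is the Gram matrix of the inner product on the tangent
  space at \<open>p\<close> with respect to the coordinate frame of the chart \<open>c\<close>.
\<close>

type_synonym ('a, 'm) chart = "'a set \<times> ('a \<Rightarrow> real ^ 'm)"

record ('a, 'm) manifold_data =
  topo :: "'a topology"
  atlas :: "('a, 'm) chart set"
  gmat :: "('a, 'm) chart \<Rightarrow> 'a \<Rightarrow> real ^ 'm ^ 'm"

abbreviation points :: "('a, 'm::finite) manifold_data \<Rightarrow> 'a set" where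
  "points M \<equiv> topspace (topo M)"

definition chart_inv :: "('a, 'm::finite) chart \<Rightarrow> real ^ 'm \<Rightarrow> 'a" where
  "chart_inv c = inv_into (fst c) (snd c)"

definition smooth_manifold :: "('a, 'm::finite) manifold_data \<Rightarrow> bool" where
  "smooth_manifold M \<longleftrightarrow>
     Hausdorff_space (topo M) \<and> second_countable (topo M) \<and>
     (\<Union>c\<in>atlas M. fst c) = points M \<and>
     (\<forall>c\<in>atlas M. openin (topo M) (fst c) \<and> open (snd c ` fst c) \<and>
        homeomorphic_map (subtopology (topo M) (fst c)) (top_of_set (snd c ` fst c)) (snd c)) \<and>
     (\<forall>c\<in>atlas M. \<forall>d\<in>atlas M. smooth_on (snd c ` (fst c \<inter> fst d)) (snd d \<circ> chart_inv c))"

definition riemannian_manifold :: "('a, 'm::finite) manifold_data \<Rightarrow> bool" where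
  "riemannian_manifold M \<longleftrightarrow> smooth_manifold M \<and>
     (\<forall>c\<in>atlas M. smooth_on (snd c ` fst c) (gmat M c \<circ> chart_inv c)) \<and>
     (\<forall>c\<in>atlas M. \<forall>p\<in>fst c. transpose (gmat M c p) = gmat M c p \<and>
        (\<forall>v. v \<noteq> 0 \<longrightarrow> 0 < v \<bullet> (gmat M c p *v v))) \<and>
     (\<forall>c\<in>atlas M. \<forall>d\<in>atlas M. \<forall>p\<in>fst c \<inter> fst d.
        let J = matrix (frechet_derivative (snd d \<circ> chart_inv c) (at (snd c p)))
        in gmat M c p = transpose J ** gmat M d p ** J)"

definition smooth_map :: "('a, 'm::finite) manifold_data \<Rightarrow> ('a \<Rightarrow> 'b::real_normed_vector) \<Rightarrow> bool" where
  "smooth_map M f \<longleftrightarrow> (\<forall>c\<in>atlas M. smooth_on (snd c ` fst c) (f \<circ> chart_inv c))"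

text \<open>The differential at \<open>p\<close>, applied to the tangent vector with components \<open>v\<close> in the chart \<open>c\<close>.\<close>

definition differential ::
  "('a, 'm::finite) chart \<Rightarrow> ('a \<Rightarrow> 'b::real_normed_vector) \<Rightarrow> 'a \<Rightarrow> real ^ 'm \<Rightarrow> 'b" where
  "differential c f p v = frechet_derivative (f \<circ> chart_inv c) (at (snd c p)) v"

abbreviation pd :: "('a, 'm::finite) chart \<Rightarrow> 'm \<Rightarrow> ('a \<Rightarrow> 'b::real_normed_vector) \<Rightarrow> 'a \<Rightarrow> 'b" where
  "pd c i f p \<equiv> differential c f p (axis i 1)"

definition ginv :: "('a, 'm::finite) manifold_data \<Rightarrow> ('a, 'm) chart \<Rightarrow> 'a \<Rightarrow> real ^ 'm ^ 'm" where
  "ginv M c p = matrix_inv (gmat M c p)"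

text \<open>Christoffel symbols of the Levi-Civita connection of \<open>M\<close>, upper index first.\<close>

definition christoffel ::
  "('a, 'm::finite) manifold_data \<Rightarrow> ('a, 'm) chart \<Rightarrow> 'm \<Rightarrow> 'm \<Rightarrow> 'm \<Rightarrow> 'a \<Rightarrow> real" where
  "christoffel M c k i j p = (1/2) * (\<Sum>l\<in>UNIV. ginv M c p $ k $ l *
     (pd c i (\<lambda>q. gmat M c q $ j $ l) p + pd c j (\<lambda>q. gmat M c q $ i $ l) p
      - pd c l (\<lambda>q. gmat M c q $ i $ j) p))"

definition gradient ::
  "('a, 'm::finite) manifold_data \<Rightarrow> ('a, 'm) chart \<Rightarrow> ('a \<Rightarrow> real) \<Rightarrow> 'a \<Rightarrow> real ^ 'm" where
  "gradient M c f p = (\<chi> k. \<Sum>l\<in>UNIV. ginv M c p $ k $ l * pd c l f p)"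

text \<open>The divergence is the trace of the covariant derivative \<open>Y \<mapsto> \<nabla>\<^sub>Y X\<close>.\<close>

definition divergence ::
  "('a, 'm::finite) manifold_data \<Rightarrow> ('a, 'm) chart \<Rightarrow> ('a \<Rightarrow> real ^ 'm) \<Rightarrow> 'a \<Rightarrow> real" where
  "divergence M c X p =
     (\<Sum>i\<in>UNIV. pd c i (\<lambda>q. X q $ i) p + (\<Sum>k\<in>UNIV. christoffel M c i i k p * X p $ k))"

text \<open>
  The operators below do not depend on the chart in which they are computed, so that an arbitrary
  chart around the point can be used.
\<close>

definition chart_at :: "('a, 'm::finite) manifold_data \<Rightarrow> 'a \<Rightarrow> ('a, 'm) chart" where
  "chart_at M p = (SOME c. c \<in> atlas M \<and> p \<in> fst c)"

definition laplacian :: "('a, 'm::finite) manifold_data \<Rightarrow> ('a \<Rightarrow> real) \<Rightarrow> 'a \<Rightarrow> real" where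
  "laplacian M f p = divergence M (chart_at M p) (gradient M (chart_at M p) f) p"

definition vec_laplacian ::
  "('a, 'm::finite) manifold_data \<Rightarrow> ('a \<Rightarrow> real ^ 'n) \<Rightarrow> 'a \<Rightarrow> real ^ 'n" where
  "vec_laplacian M f p = (\<chi> a. laplacian M (\<lambda>q. f q $ a) p)"

text \<open>
  The Riemannian measure \<open>dv\<^sub>g\<close> is the Borel measure with density \<open>sqrt (det g)\<close> in every chart.
  As \<open>M\<close> is second countable, it exists and is uniquely determined.
\<close>

definition riemannian_measure :: "('a, 'm::finite) manifold_data \<Rightarrow> 'a measure \<Rightarrow> bool" where
  "riemannian_measure M \<mu> \<longleftrightarrow>
     space \<mu> = points M \<and> sets \<mu> = sigma_sets (points M) {U. openin (topo M) U} \<and>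
     (\<forall>c\<in>atlas M. \<forall>A\<in>sets \<mu>. A \<subseteq> fst c \<longrightarrow>
        emeasure \<mu> A = (\<integral>\<^sup>+x\<in>snd c ` A. ennreal (sqrt (det (gmat M c (chart_inv c x)))) \<partial>lborel))"

section \<open>Isometric immersions and maps into the unit sphere\<close>

definition isometric_immersion ::
  "('a, 'm::finite) manifold_data \<Rightarrow> ('a \<Rightarrow> real ^ 'n) \<Rightarrow> bool" where
  "isometric_immersion M \<phi> \<longleftrightarrow> smooth_map M \<phi> \<and>
     (\<forall>c\<in>atlas M. \<forall>p\<in>fst c. inj (differential c \<phi> p) \<and>
        (\<forall>v w. differential c \<phi> p v \<bullet> differential c \<phi> p w = v \<bullet> (gmat M c p *v w)))"

text \<open>
  For \<open>CARD('n) = n + 1\<close>, \<open>sphere 0 1 :: (real ^ 'n) set\<close> is the unit sphere \<open>S\<^sup>n\<close>, and a map into it is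
  a map into \<open>real ^ 'n\<close> with values of norm 1.  The Levi-Civita connection of the submanifold \<open>S\<^sup>n\<close>
  is the orthogonal projection to the tangent spaces of the flat connection; hence
  \<open>pullback_deriv\<close> is the covariant derivative, induced by \<open>\<phi>\<close>, of a section \<open>V\<close> of \<open>\<phi>\<^sup>*TS\<^sup>n\<close>
  along the \<open>i\<close>-th coordinate vector field.
\<close>

definition sphere_proj :: "real ^ 'n \<Rightarrow> real ^ 'n \<Rightarrow> real ^ 'n" where
  "sphere_proj y v = v - (v \<bullet> y) *\<^sub>R y"

definition pullback_deriv ::
  "('a, 'm::finite) chart \<Rightarrow> ('a \<Rightarrow> real ^ 'n) \<Rightarrow> 'm \<Rightarrow> ('a \<Rightarrow> real ^ 'n) \<Rightarrow> 'a \<Rightarrow> real ^ 'n" where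
  "pullback_deriv c \<phi> i V p = sphere_proj (\<phi> p) (pd c i V p)"

text \<open>
  The components of \<open>\<nabla>d\<phi>\<close> for \<open>\<phi>\<close> from \<open>M\<close> to \<open>S\<^sup>n\<close>.  If \<open>\<phi>\<close> is an isometric immersion, this is its
  vector-valued second fundamental form in \<open>S\<^sup>n\<close> (Gauss formula).
\<close>

definition second_ff ::
  "('a, 'm::finite) manifold_data \<Rightarrow> ('a, 'm) chart \<Rightarrow> ('a \<Rightarrow> real ^ 'n) \<Rightarrow> 'm \<Rightarrow> 'm \<Rightarrow> 'a \<Rightarrow> real ^ 'n" where
  "second_ff M c \<phi> i j p =
     pullback_deriv c \<phi> i (pd c j \<phi>) p - (\<Sum>k\<in>UNIV. christoffel M c k i j p *\<^sub>R pd c k \<phi> p)"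

definition tension :: "('a, 'm::finite) manifold_data \<Rightarrow> ('a \<Rightarrow> real ^ 'n) \<Rightarrow> 'a \<Rightarrow> real ^ 'n" where
  "tension M \<phi> p = (let c = chart_at M p in
     \<Sum>i\<in>UNIV. \<Sum>j\<in>UNIV. ginv M c p $ i $ j *\<^sub>R second_ff M c \<phi> i j p)"

definition mean_curvature :: "('a, 'm::finite) manifold_data \<Rightarrow> ('a \<Rightarrow> real ^ 'n) \<Rightarrow> 'a \<Rightarrow> real ^ 'n" where
  "mean_curvature M \<phi> p = (let c = chart_at M p in
     (1 / real CARD('m)) *\<^sub>R
       (\<Sum>i\<in>UNIV. \<Sum>j\<in>UNIV. ginv M c p $ i $ j *\<^sub>R second_ff M c \<phi> i j p))"

definition minimal_in_sphere :: "('a, 'm::finite) manifold_data \<Rightarrow> ('a \<Rightarrow> real ^ 'n) \<Rightarrow> bool" where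
  "minimal_in_sphere M \<phi> \<longleftrightarrow> (\<forall>p\<in>points M. mean_curvature M \<phi> p = 0)"

section \<open>Biharmonic maps into the unit sphere\<close>

definition bienergy ::
  "('a, 'm::finite) manifold_data \<Rightarrow> 'a measure \<Rightarrow> 'a set \<Rightarrow> ('a \<Rightarrow> real ^ 'n) \<Rightarrow> real" where
  "bienergy M \<mu> K \<phi> = (1/2) * (LINT p:K|\<mu>. (norm (tension M \<phi> p))\<^sup>2)"

definition sphere_variation ::
  "('a, 'm::finite) manifold_data \<Rightarrow> ('a \<Rightarrow> real ^ 'n) \<Rightarrow> real \<Rightarrow> 'a set \<Rightarrow> (real \<Rightarrow> 'a \<Rightarrow> real ^ 'n) \<Rightarrow> bool" where
  "sphere_variation M \<phi> \<epsilon> K \<Phi> \<longleftrightarrow> 0 < \<epsilon> \<and> compactin (topo M) K \<and>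
     (\<forall>t\<in>{-\<epsilon><..<\<epsilon>}. \<Phi> t ` points M \<subseteq> sphere 0 1) \<and>
     (\<forall>c\<in>atlas M. smooth_on ({-\<epsilon><..<\<epsilon>} \<times> (snd c ` fst c)) (\<lambda>(t, x). \<Phi> t (chart_inv c x))) \<and>
     (\<forall>p\<in>points M. \<Phi> 0 p = \<phi> p) \<and>
     (\<forall>t\<in>{-\<epsilon><..<\<epsilon>}. \<forall>p\<in>points M - K. \<Phi> t p = \<phi> p)"

text \<open>
  The bienergy over \<open>M\<close> may be infinite when \<open>M\<close> is not compact; as usual, it is restricted to a compact
  set off which the variation is constant.
\<close>

definition biharmonic_in_sphere :: "('a, 'm::finite) manifold_data \<Rightarrow> ('a \<Rightarrow> real ^ 'n) \<Rightarrow> bool" where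
  "biharmonic_in_sphere M \<phi> \<longleftrightarrow> smooth_map M \<phi> \<and> \<phi> ` points M \<subseteq> sphere 0 1 \<and>
     (\<exists>\<mu>. riemannian_measure M \<mu> \<and>
        (\<forall>\<epsilon> K \<Phi>. sphere_variation M \<phi> \<epsilon> K \<Phi> \<longrightarrow>
           ((\<lambda>t. bienergy M \<mu> K (\<Phi> t)) has_real_derivative 0) (at 0)))"

end

theory Submission
  imports Defs
begin

text \<open>
  Let \<open>\<tau>\<close> be the tension field of \<open>\<phi>\<close> as a map to the sphere.  Since \<open>\<langle>\<Delta>\<phi>, \<phi>\<rangle> = -m\<close>, we have
  \<open>\<Delta>\<phi> = \<tau> - m\<phi>\<close>, and \<open>\<Delta>\<^sup>2\<phi> = \<lambda>\<phi>\<close> becomes \<open>\<Delta>\<tau> = m\<tau> + (\<lambda> - m\<^sup>2)\<phi>\<close>.  The bienergy is tested with the single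
  variation \<open>(\<phi> + tV) / |\<phi> + tV|\<close>, where \<open>V = \<eta>\<tau>\<close> and \<open>\<eta> \<ge> 0\<close> is a bump function supported in one chart.
  Its derivative at \<open>t = 0\<close> is the integral of
  \<open>\<langle>\<tau>, \<Delta>V + mV\<rangle> = div (|\<tau>|\<^sup>2 \<nabla>\<eta>) + 2m\<eta>|\<tau>|\<^sup>2\<close>.
  The divergence integrates to zero, so \<open>\<tau> = 0\<close> wherever \<open>\<eta> > 0\<close>.  Then \<open>\<Delta>\<phi> = -m\<phi>\<close>, whence \<open>\<lambda> = m\<^sup>2\<close>.
\<close>

text \<open>The equation for \<lambda> is used only after pairing with \<tau>: as \<tau> is
  orthogonal to \<phi>, the \<lambda> term drops out and <\<Delta>\<tau>, \<tau>> = m|\<tau>|^2 for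
  an arbitrary function \<lambda>. Tested against \<eta>\<tau>, this turns the first variation into
  a divergence plus a term of one sign, so no Euler-Lagrange equation has to be derived. Two facts
  keep the variation computable. V is normal to \<phi>, so |\<phi> + tV|^2 = 1 + t^2 |V|^2 and the
  normalization has no first-order effect. The summand mV arises because the tangential projection
  moves with t, while <\<Delta>\<phi>, \<phi>> = -m. The formal obstacle is that
  \<open>laplacian\<close> picks a chart anew at every point, through \<open>chart_at\<close>.
  Before \<Delta>\<phi> can be differentiated again, the operator must be known not to depend on
  that choice. The immersion itself serves to prove this, in place of the transformation law of the
  Christoffel symbols.\<close>

section \<open>Calculus of \<open>C\<^sup>k\<close> maps\<close>

lemma has_derivative_cong_open:
  assumes "open S" "x \<in> S" "\<And>y. y \<in> S \<Longrightarrow> f y = g y"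
  shows "(f has_derivative F) (at x) \<longleftrightarrow> (g has_derivative F) (at x)"
  using assms by (auto elim!: has_derivative_transform_within_open)

lemma frechet_derivative_cong_open:
  assumes "open S" "x \<in> S" "\<And>y. y \<in> S \<Longrightarrow> f y = g y"
  shows "frechet_derivative f (at x) = frechet_derivative g (at x)"
  unfolding frechet_derivative_def by (simp add: has_derivative_cong_open[OF assms])

lemma differentiable_cong_open:
  assumes "open S" "x \<in> S" "\<And>y. y \<in> S \<Longrightarrow> f y = g y"
  shows "f differentiable (at x) \<longleftrightarrow> g differentiable (at x)"
  unfolding differentiable_def by (simp add: has_derivative_cong_open[OF assms])

lemma Ck_on_cong:
  assumes "open S" "\<And>x. x \<in> S \<Longrightarrow> f x = g x"
  shows "Ck_on k S f \<longleftrightarrow> Ck_on k S g"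
  using assms(2)
proof (induction k arbitrary: f g)
  case 0
  then show ?case by (simp cong: continuous_on_cong)
next
  case (Suc k)
  have "Ck_on k S (\<lambda>x. frechet_derivative f (at x) v) \<longleftrightarrow>
      Ck_on k S (\<lambda>x. frechet_derivative g (at x) v)" for v
    by (rule Suc.IH) (simp add: frechet_derivative_cong_open[OF assms(1) _ Suc.prems])
  then show ?case
    using differentiable_cong_open[OF assms(1) _ Suc.prems] by auto
qed

lemma smooth_on_cong:
  assumes "open S" "\<And>x. x \<in> S \<Longrightarrow> f x = g x"
  shows "smooth_on S f \<longleftrightarrow> smooth_on S g"
  using Ck_on_cong[OF assms] by (simp add: smooth_on_def)

lemma Ck_on_SucI:
  assumes "open S" "\<And>x. x \<in> S \<Longrightarrow> (f has_derivative f' x) (at x)"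
    and "\<And>v. Ck_on k S (\<lambda>x. f' x v)"
  shows "Ck_on (Suc k) S f"
proof -
  have "Ck_on k S (\<lambda>x. frechet_derivative f (at x) v)" for v
    using Ck_on_cong[OF assms(1), of "\<lambda>x. frechet_derivative f (at x) v" "\<lambda>x. f' x v" k]
      assms(2,3) frechet_derivative_at by metis
  then show ?thesis
    using assms(2) by (auto simp: differentiable_def)
qed

lemma Ck_on_Suc_has_derivative:
  assumes "Ck_on (Suc k) S f" "x \<in> S"
  shows "(f has_derivative frechet_derivative f (at x)) (at x)"
  using assms by (simp add: frechet_derivative_works)

lemma Ck_on_Suc_frechet: "Ck_on (Suc k) S f \<Longrightarrow> Ck_on k S (\<lambda>x. frechet_derivative f (at x) v)"
  by simp

lemma Ck_on_Suc_lower: "Ck_on (Suc k) S f \<Longrightarrow> Ck_on k S f"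
proof (induction k arbitrary: f)
  case 0
  then show ?case
    by (auto intro!: continuous_at_imp_continuous_on differentiable_imp_continuous_within)
next
  case (Suc k)
  then show ?case by auto
qed

lemma Ck_on_imp_continuous_on: "Ck_on k S f \<Longrightarrow> continuous_on S f"
  by (induction k) (use Ck_on_Suc_lower in \<open>auto simp del: Ck_on.simps(2)\<close>)

lemma Ck_on_subset: "Ck_on k S f \<Longrightarrow> T \<subseteq> S \<Longrightarrow> Ck_on k T f"
  by (induction k arbitrary: f) (auto intro: continuous_on_subset)

lemma Ck_on_const: "Ck_on k S (\<lambda>x. c)"
  by (induction k arbitrary: c) auto

lemma Ck_on_bounded_linear:
  assumes "open S" "bounded_linear L" "Ck_on k S f"
  shows "Ck_on k S (\<lambda>x. L (f x))"
  using assms(3)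
proof (induction k arbitrary: f)
  case 0
  then show ?case using bounded_linear.continuous_on[OF assms(2)] by simp
next
  case (Suc k)
  show ?case
  proof (rule Ck_on_SucI[OF assms(1)])
    show "((\<lambda>x. L (f x)) has_derivative (\<lambda>v. L (frechet_derivative f (at x) v))) (at x)"
      if "x \<in> S" for x
      using bounded_linear.has_derivative[OF assms(2) Ck_on_Suc_has_derivative[OF Suc.prems that]] .
    show "Ck_on k S (\<lambda>x. L (frechet_derivative f (at x) v))" for v
      using Suc by auto
  qed
qed

lemma Ck_on_add:
  assumes "open S" "Ck_on k S f" "Ck_on k S g"
  shows "Ck_on k S (\<lambda>x. f x + g x)"
  using assms(2,3)
proof (induction k arbitrary: f g)
  case 0
  then show ?case by (simp add: continuous_on_add)
next
  case (Suc k)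
  show ?case
  proof (rule Ck_on_SucI[OF assms(1)])
    show "((\<lambda>x. f x + g x) has_derivative
        (\<lambda>v. frechet_derivative f (at x) v + frechet_derivative g (at x) v)) (at x)"
      if "x \<in> S" for x
      by (rule has_derivative_add[OF Ck_on_Suc_has_derivative[OF Suc.prems(1) that]
            Ck_on_Suc_has_derivative[OF Suc.prems(2) that]])
    show "Ck_on k S (\<lambda>x. frechet_derivative f (at x) v + frechet_derivative g (at x) v)" for v
      using Suc by auto
  qed
qed

lemma Ck_on_sum:
  assumes "open S" "\<And>i. i \<in> I \<Longrightarrow> Ck_on k S (f i)"
  shows "Ck_on k S (\<lambda>x. \<Sum>i\<in>I. f i x)"
  using assms(2)
  by (induction I rule: infinite_finite_induct) (auto intro: Ck_on_const Ck_on_add[OF assms(1)])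

lemma Ck_on_bilinear:
  assumes "open S" "bounded_bilinear b" "Ck_on k S f" "Ck_on k S g"
  shows "Ck_on k S (\<lambda>x. b (f x) (g x))"
  using assms(3,4)
proof (induction k arbitrary: f g)
  case 0
  then show ?case using bounded_bilinear.continuous_on[OF assms(2)] by simp
next
  case (Suc k)
  show ?case
  proof (rule Ck_on_SucI[OF assms(1)])
    show "((\<lambda>x. b (f x) (g x)) has_derivative
        (\<lambda>v. b (f x) (frechet_derivative g (at x) v) + b (frechet_derivative f (at x) v) (g x))) (at x)"
      if "x \<in> S" for x
      by (rule bounded_bilinear.FDERIV[OF assms(2) Ck_on_Suc_has_derivative[OF Suc.prems(1) that]
            Ck_on_Suc_has_derivative[OF Suc.prems(2) that]])
    show "Ck_on k S
        (\<lambda>x. b (f x) (frechet_derivative g (at x) v) + b (frechet_derivative f (at x) v) (g x))" for v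
      using Suc.prems Suc.prems[THEN Ck_on_Suc_lower] by (intro Ck_on_add[OF assms(1)] Suc.IH) auto
  qed
qed

text \<open>The chain rule evaluates the derivative of \<open>f\<close> in a direction that depends
  on \<open>x\<close>, while \<open>Ck_on\<close> controls fixed directions only. Expanding that
  direction in \<open>Basis\<close> leaves finitely many fixed directions with scalar coefficients,
  to which the induction hypothesis and the product rule apply; hence the Euclidean domain of
  \<open>f\<close>.\<close>

lemma Ck_on_compose:
  fixes f :: "'b::euclidean_space \<Rightarrow> 'c::real_normed_vector" and h :: "'a::real_normed_vector \<Rightarrow> 'b"
  assumes "open S" "open T" "h ` S \<subseteq> T" "Ck_on k T f" "Ck_on k S h"
  shows "Ck_on k S (\<lambda>x. f (h x))"
  using assms(4,5)
proof (induction k arbitrary: f)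
  case 0
  then show ?case using assms(3) by (auto intro: continuous_on_compose2)
next
  case (Suc k)
  note hder = Ck_on_Suc_has_derivative[OF Suc.prems(2)]
  have fder: "(f has_derivative frechet_derivative f (at (h x))) (at (h x))" if "x \<in> S" for x
    using Ck_on_Suc_has_derivative[OF Suc.prems(1)] that assms(3) by auto
  show ?case
  proof (rule Ck_on_SucI[OF assms(1)])
    show "((\<lambda>x. f (h x)) has_derivative
        (\<lambda>v. \<Sum>e\<in>Basis. (frechet_derivative h (at x) v \<bullet> e) *\<^sub>R frechet_derivative f (at (h x)) e)) (at x)"
      if "x \<in> S" for x
    proof -
      have "linear (frechet_derivative f (at (h x)))"
        using fder[OF that] has_derivative_linear by blast
      then have eq: "frechet_derivative f (at (h x)) w =
          (\<Sum>e\<in>Basis. (w \<bullet> e) *\<^sub>R frechet_derivative f (at (h x)) e)" for w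
        using arg_cong[OF euclidean_representation[of w], of "frechet_derivative f (at (h x))"]
        by (simp add: linear_sum linear_scale)
      show ?thesis
        by (rule has_derivative_eq_rhs[OF has_derivative_compose[OF hder[OF that] fder[OF that]]])
          (rule ext, rule eq)
    qed
    show "Ck_on k S
        (\<lambda>x. \<Sum>e\<in>Basis. (frechet_derivative h (at x) v \<bullet> e) *\<^sub>R frechet_derivative f (at (h x)) e)" for v
    proof (rule Ck_on_sum[OF assms(1)])
      fix e :: 'b
      have "Ck_on k S (\<lambda>x. frechet_derivative h (at x) v \<bullet> e)"
        using Suc.prems(2)
        by (intro Ck_on_bounded_linear[OF assms(1) bounded_linear_inner_left]) simp
      moreover have "Ck_on k S (\<lambda>x. frechet_derivative f (at (h x)) e)"
        using Suc.prems Ck_on_Suc_lower[OF Suc.prems(2)]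
        by (intro Suc.IH[where f = "\<lambda>y. frechet_derivative f (at y) e"]) auto
      ultimately show "Ck_on k S
          (\<lambda>x. (frechet_derivative h (at x) v \<bullet> e) *\<^sub>R frechet_derivative f (at (h x)) e)"
        by (rule Ck_on_bilinear[OF assms(1) bounded_bilinear_scaleR])
    qed
  qed
qed

text \<open>The derivative is a polynomial in the inverse itself and the derivative of
  \<open>f\<close>, so the induction hypothesis one order below closes the step. The square root
  works in the same way.\<close>

lemma Ck_on_inverse:
  fixes f :: "'a::real_normed_vector \<Rightarrow> real"
  assumes "open S" "\<And>x. x \<in> S \<Longrightarrow> f x \<noteq> 0" "Ck_on k S f"
  shows "Ck_on k S (\<lambda>x. inverse (f x))"
  using assms(3)
proof (induction k)
  case 0
  then show ?case using assms(2) by (auto intro: continuous_on_inverse)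
next
  case (Suc k)
  note IH = Suc.IH[OF Ck_on_Suc_lower[OF Suc.prems]]
  show ?case
  proof (rule Ck_on_SucI[OF assms(1)])
    show "((\<lambda>x. inverse (f x)) has_derivative
        (\<lambda>v. - (inverse (f x) * frechet_derivative f (at x) v * inverse (f x)))) (at x)"
      if "x \<in> S" for x
      using Deriv.has_derivative_inverse[OF assms(2)[OF that] Ck_on_Suc_has_derivative[OF Suc.prems that]] .
    show "Ck_on k S (\<lambda>x. - (inverse (f x) * frechet_derivative f (at x) v * inverse (f x)))" for v
      using Suc.prems IH
      by (intro Ck_on_bounded_linear[OF assms(1) bounded_linear_minus[OF bounded_linear_ident]]
          Ck_on_bilinear[OF assms(1) bounded_bilinear_mult]) auto
  qed
qed

lemma Ck_on_sqrt:
  assumes "open S" "\<And>x. x \<in> S \<Longrightarrow> f x > 0" "Ck_on k S f"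
  shows "Ck_on k S (\<lambda>x. sqrt (f x))"
  using assms(3)
proof (induction k)
  case 0
  then show ?case by (auto intro: continuous_on_real_sqrt)
next
  case (Suc k)
  note IH = Suc.IH[OF Ck_on_Suc_lower[OF Suc.prems]]
  show ?case
  proof (rule Ck_on_SucI[OF assms(1)])
    show "((\<lambda>x. sqrt (f x)) has_derivative
        (\<lambda>v. frechet_derivative f (at x) v * (1/2 * inverse (sqrt (f x))))) (at x)"
      if "x \<in> S" for x
      using has_derivative_real_sqrt[OF assms(2)[OF that] Ck_on_Suc_has_derivative[OF Suc.prems that]]
      by (simp add: field_simps)
    have pos: "sqrt (f x) \<noteq> 0" if "x \<in> S" for x
      using assms(2)[OF that] by simp
    show "Ck_on k S (\<lambda>x. frechet_derivative f (at x) v * (1/2 * inverse (sqrt (f x))))" for v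
      using Suc.prems Ck_on_inverse[OF assms(1) pos IH]
      by (intro Ck_on_bilinear[OF assms(1) bounded_bilinear_mult] Ck_on_const) auto
  qed
qed

lemma Ck_on_componentwise:
  fixes f :: "'a::real_normed_vector \<Rightarrow> real ^ 'n"
  assumes "open S"
  shows "Ck_on k S f \<longleftrightarrow> (\<forall>i. Ck_on k S (\<lambda>x. f x $ i))"
proof
  assume "Ck_on k S f"
  then show "\<forall>i. Ck_on k S (\<lambda>x. f x $ i)"
    using Ck_on_bounded_linear[OF assms bounded_linear_vec_nth] by blast
next
  assume *: "\<forall>i. Ck_on k S (\<lambda>x. f x $ i)"
  have "f = (\<lambda>x. \<Sum>i\<in>UNIV. (f x $ i) *\<^sub>R axis i 1)"
    by (auto simp: vec_eq_iff axis_def if_distrib cong: if_cong)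
  moreover have "Ck_on k S (\<lambda>x. \<Sum>i\<in>UNIV. (f x $ i) *\<^sub>R (axis i 1 :: real^'n))"
    using * by (intro Ck_on_sum[OF assms] Ck_on_bilinear[OF assms bounded_bilinear_scaleR] Ck_on_const) auto
  ultimately show "Ck_on k S f" by simp
qed

section \<open>Closure properties of smooth maps\<close>

lemma smooth_on_imp_continuous_on: "smooth_on S f \<Longrightarrow> continuous_on S f"
  by (rule Ck_on_imp_continuous_on[where k = 0]) (simp add: smooth_on_def)

lemma smooth_on_has_derivative:
  "smooth_on S f \<Longrightarrow> x \<in> S \<Longrightarrow> (f has_derivative frechet_derivative f (at x)) (at x)"
  by (rule Ck_on_Suc_has_derivative[where k = 0]) (auto simp only: smooth_on_def)

lemma smooth_on_subset: "smooth_on S f \<Longrightarrow> T \<subseteq> S \<Longrightarrow> smooth_on T f"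
  unfolding smooth_on_def by (rule allI, rule Ck_on_subset[of _ S]) auto

lemma smooth_on_frechet: "smooth_on S f \<Longrightarrow> smooth_on S (\<lambda>x. frechet_derivative f (at x) v)"
  unfolding smooth_on_def by (rule allI, rule Ck_on_Suc_frechet) (rule spec)

lemma smooth_on_const: "smooth_on S (\<lambda>x. c)"
  by (simp add: smooth_on_def Ck_on_const)

lemma smooth_on_bounded_linear:
  "open S \<Longrightarrow> bounded_linear L \<Longrightarrow> smooth_on S f \<Longrightarrow> smooth_on S (\<lambda>x. L (f x))"
  unfolding smooth_on_def by (rule allI, rule Ck_on_bounded_linear) auto

lemma smooth_on_bounded_linear_ident:
  assumes "open S" "bounded_linear L"
  shows "smooth_on S L"
  unfolding smooth_on_def
proof
  fix k show "Ck_on k S L"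
  proof (cases k)
    case 0
    then show ?thesis
      using linear_continuous_on[OF assms(2)] by simp
  next
    case (Suc n)
    show ?thesis unfolding Suc
      by (rule Ck_on_SucI[OF assms(1), where f' = "\<lambda>_. L"])
        (auto intro: bounded_linear_imp_has_derivative assms Ck_on_const)
  qed
qed

lemma smooth_on_add: "open S \<Longrightarrow> smooth_on S f \<Longrightarrow> smooth_on S g \<Longrightarrow> smooth_on S (\<lambda>x. f x + g x)"
  unfolding smooth_on_def by (rule allI, rule Ck_on_add) auto

lemma smooth_on_bilinear:
  "open S \<Longrightarrow> bounded_bilinear b \<Longrightarrow> smooth_on S f \<Longrightarrow> smooth_on S g \<Longrightarrow> smooth_on S (\<lambda>x. b (f x) (g x))"
  unfolding smooth_on_def by (rule allI, rule Ck_on_bilinear) auto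

lemmas smooth_on_scaleR = smooth_on_bilinear[OF _ bounded_bilinear_scaleR]
lemmas smooth_on_mult = smooth_on_bilinear[OF _ bounded_bilinear_mult]
lemmas smooth_on_inner = smooth_on_bilinear[OF _ bounded_bilinear_inner]
lemmas smooth_on_minus = smooth_on_bounded_linear[OF _ bounded_linear_minus[OF bounded_linear_ident]]

lemma smooth_on_diff: "open S \<Longrightarrow> smooth_on S f \<Longrightarrow> smooth_on S g \<Longrightarrow> smooth_on S (\<lambda>x. f x - g x)"
  using smooth_on_add[OF _ _ smooth_on_minus, of S f g] by simp

lemma smooth_on_sum:
  "open S \<Longrightarrow> (\<And>i. i \<in> I \<Longrightarrow> smooth_on S (f i)) \<Longrightarrow> smooth_on S (\<lambda>x. \<Sum>i\<in>I. f i x)"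
  unfolding smooth_on_def by (rule allI, rule Ck_on_sum) auto

lemma smooth_on_prod:
  fixes f :: "'i \<Rightarrow> 'a::real_normed_vector \<Rightarrow> real"
  assumes "open S" "\<And>i. i \<in> I \<Longrightarrow> smooth_on S (f i)"
  shows "smooth_on S (\<lambda>x. \<Prod>i\<in>I. f i x)"
  using assms(2)
  by (induction I rule: infinite_finite_induct) (auto intro: smooth_on_const smooth_on_mult[OF assms(1)])

lemma smooth_on_compose:
  fixes f :: "'b::euclidean_space \<Rightarrow> 'c::real_normed_vector" and h :: "'a::real_normed_vector \<Rightarrow> 'b"
  assumes "open S" "open T" "h ` S \<subseteq> T" "smooth_on T f" "smooth_on S h"
  shows "smooth_on S (\<lambda>x. f (h x))"
  unfolding smooth_on_def
  by (rule allI, rule Ck_on_compose[OF assms(1-3)]) (use assms in \<open>auto simp: smooth_on_def\<close>)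

lemma smooth_on_inverse:
  fixes f :: "'a::real_normed_vector \<Rightarrow> real"
  assumes "open S" "\<And>x. x \<in> S \<Longrightarrow> f x \<noteq> 0" "smooth_on S f"
  shows "smooth_on S (\<lambda>x. inverse (f x))"
  unfolding smooth_on_def
  by (rule allI, rule Ck_on_inverse[OF assms(1,2)]) (use assms in \<open>auto simp: smooth_on_def\<close>)

lemma smooth_on_sqrt:
  assumes "open S" "\<And>x. x \<in> S \<Longrightarrow> f x > 0" "smooth_on S f"
  shows "smooth_on S (\<lambda>x. sqrt (f x))"
  unfolding smooth_on_def
  by (rule allI, rule Ck_on_sqrt[OF assms(1,2)]) (use assms in \<open>auto simp: smooth_on_def\<close>)

lemma smooth_on_componentwise:
  fixes f :: "'a::real_normed_vector \<Rightarrow> real ^ 'n"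
  assumes "open S"
  shows "smooth_on S f \<longleftrightarrow> (\<forall>i. smooth_on S (\<lambda>x. f x $ i))"
  by (auto simp: smooth_on_def Ck_on_componentwise[OF assms])

text \<open>Smoothness is local. This is the gluing step for functions extended by zero beyond a
  chart or a ball.\<close>

lemma smooth_on_open_cover:
  assumes "\<And>x. x \<in> S \<Longrightarrow> \<exists>T. open T \<and> x \<in> T \<and> smooth_on T f"
  shows "smooth_on S f"
  unfolding smooth_on_def
proof
  fix k
  have "\<forall>x\<in>S. \<exists>T. open T \<and> x \<in> T \<and> Ck_on k T f"
    using assms by (auto simp: smooth_on_def)
  then show "Ck_on k S f"
  proof (induction k arbitrary: f)
    case 0
    show ?case
      unfolding Ck_on.simps
    proof (intro continuous_at_imp_continuous_on ballI)
      fix x assume "x \<in> S"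
      then obtain T where "open T" "x \<in> T" "continuous_on T f"
        using 0 by auto
      then show "isCont f x"
        by (simp add: continuous_on_eq_continuous_at)
    qed
  next
    case (Suc k)
    have "Ck_on k S (\<lambda>x. frechet_derivative f (at x) v)" for v
      by (rule Suc.IH) (use Suc.prems in force)
    moreover have "f differentiable (at x)" if "x \<in> S" for x
      using Suc.prems that by auto
    ultimately show ?case by simp
  qed
qed

subsection \<open>Symmetry of second derivatives\<close>

text \<open>Two mean value steps: along \<open>u\<close> for the difference between \<open>f\<close>
  shifted by \<open>t *\<^sub>R v\<close> and \<open>f\<close>, then along \<open>v\<close> for the
  derivative of \<open>f\<close> in direction \<open>u\<close>.\<close>

lemma second_difference_mvt:
  fixes f :: "'a::real_normed_vector \<Rightarrow> real"
  assumes S: "open S" and f: "Ck_on 2 S f" and t: "0 < t"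
    and sub: "\<And>a b. 0 \<le> a \<Longrightarrow> a \<le> t \<Longrightarrow> 0 \<le> b \<Longrightarrow> b \<le> t \<Longrightarrow> x + a *\<^sub>R u + b *\<^sub>R v \<in> S"
  shows "\<exists>a b. 0 < a \<and> a < t \<and> 0 < b \<and> b < t \<and>
    f (x + t *\<^sub>R u + t *\<^sub>R v) - f (x + t *\<^sub>R u) - f (x + t *\<^sub>R v) + f x =
    t * t * frechet_derivative (\<lambda>y. frechet_derivative f (at y) u) (at (x + a *\<^sub>R u + b *\<^sub>R v)) v"
proof -
  have f1: "Ck_on (Suc 1) S f" and f2: "Ck_on (Suc 0) S (\<lambda>y. frechet_derivative f (at y) u)"
    using f by (auto simp: numeral_2_eq_2)
  have line: "((\<lambda>s. h (p + s *\<^sub>R w)) has_real_derivative frechet_derivative h (at (p + s *\<^sub>R w)) w) (at s)"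
    if "Ck_on (Suc k) S h" "p + s *\<^sub>R w \<in> S" for h k p s w
  proof -
    have "((\<lambda>s. p + s *\<^sub>R w) has_derivative (\<lambda>s. s *\<^sub>R w)) (at s)"
      by (auto intro!: derivative_eq_intros)
    from has_derivative_compose[OF this Ck_on_Suc_has_derivative[OF that]]
    have "((\<lambda>s. h (p + s *\<^sub>R w)) has_derivative (\<lambda>s'. frechet_derivative h (at (p + s *\<^sub>R w)) (s' *\<^sub>R w))) (at s)" .
    moreover have "frechet_derivative h (at (p + s *\<^sub>R w)) (s' *\<^sub>R w) = frechet_derivative h (at (p + s *\<^sub>R w)) w * s'" for s'
      using has_derivative_linear[OF Ck_on_Suc_has_derivative[OF that]] by (simp add: linear_scale)
    ultimately show ?thesis by (simp add: has_field_derivative_def)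
  qed
  let ?d = "\<lambda>s. f (x + t *\<^sub>R v + s *\<^sub>R u) - f (x + s *\<^sub>R u)"
  let ?d' = "\<lambda>s. frechet_derivative f (at (x + t *\<^sub>R v + s *\<^sub>R u)) u - frechet_derivative f (at (x + s *\<^sub>R u)) u"
  have "\<exists>a. 0 < a \<and> a < t \<and> ?d t - ?d 0 = (t - 0) * ?d' a"
  proof (rule MVT2[OF t])
    fix s assume s: "0 \<le> s" "s \<le> t"
    have "x + t *\<^sub>R v + s *\<^sub>R u \<in> S" "x + s *\<^sub>R u \<in> S"
      using sub[of s t] sub[of s 0] s t by (auto simp: algebra_simps)
    then show "DERIV ?d s :> ?d' s"
      by (intro DERIV_diff line[OF f1])
  qed
  then obtain a where a: "0 < a" "a < t" "?d t - ?d 0 = t * ?d' a" by auto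
  let ?e = "\<lambda>s. frechet_derivative f (at (x + a *\<^sub>R u + s *\<^sub>R v)) u"
  let ?e' = "\<lambda>s. frechet_derivative (\<lambda>y. frechet_derivative f (at y) u) (at (x + a *\<^sub>R u + s *\<^sub>R v)) v"
  have "\<exists>b. 0 < b \<and> b < t \<and> ?e t - ?e 0 = (t - 0) * ?e' b"
    using a sub by (intro MVT2[OF t] line[OF f2]) auto
  then obtain b where "0 < b" "b < t" "?e t - ?e 0 = t * ?e' b" by auto
  with a show ?thesis
    by (intro exI[of _ a] exI[of _ b]) (simp add: algebra_simps)
qed

text \<open>The second difference is symmetric in \<open>u\<close> and \<open>v\<close>, so the two
  mixed derivatives take a common value at two points of a small parallelogram. If they differed at
  \<open>x\<close>, continuity would keep them apart there.\<close>

lemma frechet_derivative_commute_real: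
  fixes f :: "'a::real_normed_vector \<Rightarrow> real"
  assumes S: "open S" and f: "Ck_on 2 S f" and x: "x \<in> S"
  shows "frechet_derivative (\<lambda>y. frechet_derivative f (at y) u) (at x) v =
    frechet_derivative (\<lambda>y. frechet_derivative f (at y) v) (at x) u"
proof (rule ccontr)
  define P where "P u v y = frechet_derivative (\<lambda>y. frechet_derivative f (at y) u) (at y) v" for u v y
  have cont: "continuous_on S (P u v)" for u v
    unfolding P_def using f by (auto simp: numeral_2_eq_2)
  assume "\<not> ?thesis"
  then have ne: "P u v x \<noteq> P v u x" by (simp add: P_def)
  define e where "e = \<bar>P u v x - P v u x\<bar> / 2"
  have e: "e > 0" using ne by (simp add: e_def)
  have "\<exists>d>0. \<forall>y. dist y x < d \<longrightarrow> \<bar>P u v y - P u v x\<bar> < e" for u v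
  proof -
    have "isCont (P u v) x"
      using cont[of u v] x S by (simp add: continuous_on_eq_continuous_at)
    then show ?thesis
      using e unfolding continuous_at_eps_delta dist_real_def by blast
  qed
  from this[of u v] this[of v u] obtain d1 d2 where d: "d1 > 0" "d2 > 0"
      "\<And>y. dist y x < d1 \<Longrightarrow> \<bar>P u v y - P u v x\<bar> < e"
      "\<And>y. dist y x < d2 \<Longrightarrow> \<bar>P v u y - P v u x\<bar> < e"
    by blast
  obtain d0 where d0: "d0 > 0" "ball x d0 \<subseteq> S"
    using S x openE by blast
  define r where "r = min d0 (min d1 d2)"
  have r: "r > 0" using d d0 by (simp add: r_def)
  \<comment> \<open>With this \<open>t\<close> the whole parallelogram spanned by
    \<open>t *\<^sub>R u\<close> and \<open>t *\<^sub>R v\<close> at \<open>x\<close> stays within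
    \<open>r / 2\<close> of \<open>x\<close>.\<close>
  define t where "t = r / (2 * (norm u + norm v + 1))"
  have pos: "norm u + norm v + 1 > 0" using norm_ge_zero[of u] norm_ge_zero[of v] by linarith
  have t: "t > 0" using r pos by (simp add: t_def)
  have near: "dist (x + a *\<^sub>R u + b *\<^sub>R v) x < r" if "0 \<le> a" "a \<le> t" "0 \<le> b" "b \<le> t" for a b
  proof -
    have "norm (a *\<^sub>R u + b *\<^sub>R v) \<le> a * norm u + b * norm v"
      using norm_triangle_ineq[of "a *\<^sub>R u" "b *\<^sub>R v"] that by simp
    also have "\<dots> \<le> t * norm u + t * norm v"
      using that by (intro add_mono mult_right_mono) auto
    also have "\<dots> \<le> t * (norm u + norm v + 1)"
      using t by (simp add: algebra_simps)
    also have "\<dots> = r / 2" using pos by (simp add: t_def field_simps)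
    also have "\<dots> < r" using r by simp
    finally show ?thesis by (simp add: dist_norm add.assoc)
  qed
  have sub: "x + a *\<^sub>R u + b *\<^sub>R v \<in> S" if "0 \<le> a" "a \<le> t" "0 \<le> b" "b \<le> t" for a b
    using near[OF that] d0 by (auto simp: r_def subset_iff dist_commute)
  have sub': "x + a *\<^sub>R v + b *\<^sub>R u \<in> S" if "0 \<le> a" "a \<le> t" "0 \<le> b" "b \<le> t" for a b
    using sub[OF that(3,4,1,2)] by (simp add: algebra_simps)
  obtain a b where ab: "0 < a" "a < t" "0 < b" "b < t"
     "f (x + t *\<^sub>R u + t *\<^sub>R v) - f (x + t *\<^sub>R u) - f (x + t *\<^sub>R v) + f x = t * t * P u v (x + a *\<^sub>R u + b *\<^sub>R v)"
    using second_difference_mvt[OF S f t, of x u v] sub unfolding P_def by blast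
  obtain a' b' where ab': "0 < a'" "a' < t" "0 < b'" "b' < t"
     "f (x + t *\<^sub>R v + t *\<^sub>R u) - f (x + t *\<^sub>R v) - f (x + t *\<^sub>R u) + f x = t * t * P v u (x + a' *\<^sub>R v + b' *\<^sub>R u)"
    using second_difference_mvt[OF S f t, of x v u] sub' unfolding P_def by blast
  have "t * t * P u v (x + a *\<^sub>R u + b *\<^sub>R v) = t * t * P v u (x + a' *\<^sub>R v + b' *\<^sub>R u)"
    using ab(5) ab'(5) by (simp add: algebra_simps)
  then have "P u v (x + a *\<^sub>R u + b *\<^sub>R v) = P v u (x + b' *\<^sub>R u + a' *\<^sub>R v)"
    using t by (simp add: algebra_simps)
  moreover have "\<bar>P u v (x + a *\<^sub>R u + b *\<^sub>R v) - P u v x\<bar> < e"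
    using near[of a b] ab by (intro d) (auto simp: r_def)
  moreover have "\<bar>P v u (x + b' *\<^sub>R u + a' *\<^sub>R v) - P v u x\<bar> < e"
    using near[of b' a'] ab' by (intro d) (auto simp: r_def)
  moreover have "\<bar>p - q\<bar> \<le> \<bar>r - p\<bar> + \<bar>r - q\<bar>" for p q r :: real
    by linarith
  ultimately show False
    unfolding e_def by (metis add_strict_mono field_sum_of_halves linorder_not_le)
qed

lemma frechet_derivative_bounded_linear:
  assumes "bounded_linear L" "f differentiable (at x)"
  shows "frechet_derivative (\<lambda>y. L (f y)) (at x) v = L (frechet_derivative f (at x) v)"
  using bounded_linear.has_derivative[OF assms(1)] assms(2) frechet_derivative_at frechet_derivative_works
  by metis

lemma frechet_derivative_commute:
  fixes f :: "'a::real_normed_vector \<Rightarrow> 'b::euclidean_space"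
  assumes S: "open S" and f: "smooth_on S f" and x: "x \<in> S"
  shows "frechet_derivative (\<lambda>y. frechet_derivative f (at y) u) (at x) v =
    frechet_derivative (\<lambda>y. frechet_derivative f (at y) v) (at x) u"
proof (rule euclidean_eqI)
  fix b :: 'b
  have fb: "Ck_on 2 S (\<lambda>y. f y \<bullet> b)"
    using f by (intro Ck_on_bounded_linear[OF S bounded_linear_inner_left]) (simp add: smooth_on_def)
  have "frechet_derivative (\<lambda>y. frechet_derivative f (at y) u) (at x) v \<bullet> b =
      frechet_derivative (\<lambda>y. frechet_derivative (\<lambda>y. f y \<bullet> b) (at y) u) (at x) v" for u v
  proof -
    have "frechet_derivative (\<lambda>y. frechet_derivative f (at y) u) (at x) v \<bullet> b
      = frechet_derivative (\<lambda>y. frechet_derivative f (at y) u \<bullet> b) (at x) v"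
      using smooth_on_has_derivative[OF smooth_on_frechet[OF f] x]
      by (intro frechet_derivative_bounded_linear[OF bounded_linear_inner_left, symmetric])
        (auto simp: differentiable_def)
    also have "\<dots> = frechet_derivative (\<lambda>y. frechet_derivative (\<lambda>y. f y \<bullet> b) (at y) u) (at x) v"
      using smooth_on_has_derivative[OF f]
      by (intro fun_cong[OF frechet_derivative_cong_open[OF S x]]
          frechet_derivative_bounded_linear[OF bounded_linear_inner_left, symmetric])
        (auto simp: differentiable_def)
    finally show ?thesis .
  qed
  then show "frechet_derivative (\<lambda>y. frechet_derivative f (at y) u) (at x) v \<bullet> b =
    frechet_derivative (\<lambda>y. frechet_derivative f (at y) v) (at x) u \<bullet> b"
    using frechet_derivative_commute_real[OF S fb x] by simp
qed

section \<open>Determinants and inverse matrices\<close>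

text \<open>The derivative at \<open>A\<close> in direction \<open>H\<close> of the Leibniz formula
  for the determinant, one factor differentiated at a time.\<close>

definition det_deriv :: "real^'n^'n \<Rightarrow> real^'n^'n \<Rightarrow> real" where
  "det_deriv A H = (\<Sum>p | p permutes UNIV. of_int (sign p) *
     (\<Sum>i\<in>UNIV. H $ i $ p i * (\<Prod>j\<in>UNIV - {i}. A $ j $ p j)))"

lemma det_has_derivative: "(det has_derivative det_deriv A) (at A)"
proof -
  have "((\<lambda>A. A $ i $ j) has_derivative (\<lambda>H. H $ i $ j)) (at A)" for i j and A :: "real^'n^'n"
    by (intro bounded_linear_imp_has_derivative bounded_linear_compose[OF bounded_linear_vec_nth]
        bounded_linear_vec_nth)
  then show ?thesis
    unfolding det_def[abs_def] det_deriv_def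
    by (intro has_derivative_sum has_derivative_mult_right has_derivative_prod)
qed

text \<open>A permutation other than the identity moves at least two points, so even with the factor
  at \<open>i\<close> replaced by an entry of \<open>H\<close> an off-diagonal zero of the identity
  matrix remains in the product.\<close>

lemma det_deriv_mat1:
  fixes H :: "real^'n^'n"
  shows "det_deriv (mat 1) H = trace H"
proof -
  have "(\<Sum>i\<in>UNIV. H $ i $ p i * (\<Prod>j\<in>UNIV - {i}. (mat 1 :: real^'n^'n) $ j $ p j)) = 0"
    if pid: "p \<noteq> id" and perm: "p permutes UNIV" for p :: "'n \<Rightarrow> 'n"
  proof (rule sum.neutral, intro ballI)
    fix i
    have "\<exists>j. j \<noteq> i \<and> p j \<noteq> j"
    proof (rule ccontr)
      assume *: "\<nexists>j. j \<noteq> i \<and> p j \<noteq> j"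
      obtain k where k: "p k \<noteq> k" using pid by (metis eq_id_iff)
      have "k = i" using * k by blast
      then have "p (p k) = p k" using * k by blast
      then show False
        using k permutes_inj[OF perm] by (auto dest: injD)
    qed
    then obtain j where "j \<noteq> i" "p j \<noteq> j" by blast
    then have "(\<Prod>j\<in>UNIV - {i}. (mat 1 :: real^'n^'n) $ j $ p j) = 0"
      by (intro prod_zero bexI[of _ j]) (auto simp: mat_def)
    then show "H $ i $ p i * (\<Prod>j\<in>UNIV - {i}. (mat 1 :: real^'n^'n) $ j $ p j) = 0" by simp
  qed
  then have "det_deriv (mat 1) H =
      (\<Sum>p\<in>{id}. of_int (sign p) *
        (\<Sum>i\<in>UNIV. H $ i $ p i * (\<Prod>j\<in>UNIV - {i}. (mat 1 :: real^'n^'n) $ j $ p j)))"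
    unfolding det_deriv_def
    by (intro sum.mono_neutral_right) (auto simp: permutes_id finite_permutations)
  also have "\<dots> = trace H"
    by (simp add: trace_def mat_def)
  finally show ?thesis .
qed

lemma bounded_linear_matrix_mult_left: "bounded_linear (\<lambda>X. A ** X :: real^'n^'n)"
  by (intro linear_conv_bounded_linear[THEN iffD1] linearI)
    (auto simp: matrix_add_ldistrib matrix_matrix_mult_def vec_eq_iff sum_distrib_left sum.distrib algebra_simps)

text \<open>Jacobi's formula by uniqueness of the derivative:
  \<open>X \<mapsto> det (A ** X)\<close> is differentiated at the identity once by the chain rule
  and once as \<open>det A * det X\<close>, which avoids the adjugate.\<close>

lemma det_deriv_mult: "det_deriv A (A ** C) = det A * trace C"
proof -
  have "((\<lambda>X. det (A ** X)) has_derivative (\<lambda>C. det_deriv A (A ** C))) (at (mat 1))"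
    using has_derivative_compose[OF bounded_linear_imp_has_derivative[OF bounded_linear_matrix_mult_left]
        det_has_derivative, of A "mat 1" UNIV] by simp
  moreover have "((\<lambda>X. det (A ** X)) has_derivative (\<lambda>C. det A * det_deriv (mat 1) C)) (at (mat 1))"
    unfolding det_mul by (intro has_derivative_mult_right det_has_derivative)
  ultimately have "(\<lambda>C. det_deriv A (A ** C)) = (\<lambda>C. det A * det_deriv (mat 1) C)"
    by (rule has_derivative_unique)
  then show ?thesis
    by (metis det_deriv_mat1)
qed

section \<open>Inverses of symmetric and positive definite matrices\<close>

lemma matrix_inv_mult:
  fixes A :: "real^'n^'n"
  assumes "invertible A"
  shows matrix_inv_right_mult: "A ** matrix_inv A = mat 1"
    and matrix_inv_left_mult: "matrix_inv A ** A = mat 1"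
proof -
  have "A ** matrix_inv A = mat 1 \<and> matrix_inv A ** A = mat 1"
    unfolding matrix_inv_def by (rule someI_ex) (use assms in \<open>simp add: invertible_def\<close>)
  then show "A ** matrix_inv A = mat 1" "matrix_inv A ** A = mat 1" by auto
qed

lemma det_deriv_invertible:
  assumes "invertible A"
  shows "det_deriv A H = det A * trace (matrix_inv A ** H)"
  using det_deriv_mult[of A "matrix_inv A ** H"] matrix_inv_mult[OF assms]
  by (simp add: matrix_mul_assoc)

lemma symmetric_matrix_inv:
  fixes A :: "real^'n^'n"
  assumes "invertible A" "transpose A = A"
  shows "transpose (matrix_inv A) = matrix_inv A"
proof -
  have "transpose (matrix_inv A) = transpose (matrix_inv A) ** (A ** matrix_inv A)"
    by (simp add: matrix_inv_mult[OF assms(1)])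
  also have "\<dots> = transpose (A ** matrix_inv A) ** matrix_inv A"
    by (metis assms(2) matrix_mul_assoc matrix_transpose_mul)
  also have "\<dots> = matrix_inv A"
    by (simp add: matrix_inv_mult[OF assms(1)] transpose_mat)
  finally show ?thesis .
qed

lemma posdef_invertible:
  fixes A :: "real^'n^'n"
  assumes "\<And>v. v \<noteq> 0 \<Longrightarrow> 0 < v \<bullet> (A *v v)"
  shows "invertible A"
proof -
  have "v = 0" if "A *v v = 0" for v
    using assms[of v] that by auto
  then show ?thesis
    using matrix_left_invertible_ker[of A] invertible_left_inverse[of A] by blast
qed

text \<open>The segment from the identity to \<open>A\<close> consists of positive definite, hence
  invertible, matrices. Along it the determinant starts at 1 and cannot cross zero.\<close>

lemma posdef_det_pos:
  fixes A :: "real^'n^'n"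
  assumes pos: "\<And>v. v \<noteq> 0 \<Longrightarrow> 0 < v \<bullet> (A *v v)"
  shows "det A > 0"
proof (rule ccontr)
  assume neg: "\<not> det A > 0"
  define P where "P t = (1 - t) *\<^sub>R mat 1 + t *\<^sub>R A" for t :: real
  have "continuous_on {0..1} (\<lambda>t. det (P t))"
    unfolding P_def det_def by (intro continuous_intros)
  moreover have "det (P 1) \<le> 0" "0 \<le> det (P 0)"
    using neg by (auto simp: P_def)
  ultimately obtain t where t: "0 \<le> t" "t \<le> 1" "det (P t) = 0"
    using IVT2'[of "\<lambda>t. det (P t)" 1 0 0] by auto
  have "0 < v \<bullet> (P t *v v)" if "v \<noteq> 0" for v
  proof -
    have "v \<bullet> (P t *v v) = (1 - t) * (v \<bullet> v) + t * (v \<bullet> (A *v v))"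
      by (simp add: P_def matrix_vector_mult_add_rdistrib scaleR_matrix_vector_assoc[symmetric] inner_add_right)
    moreover have "0 < v \<bullet> v" "0 < v \<bullet> (A *v v)" using pos that by auto
    ultimately show ?thesis
      using t by (cases "t = 0") (auto intro!: add_nonneg_pos)
  qed
  then have "invertible (P t)" by (rule posdef_invertible)
  then show False using t by (simp add: invertible_det_nz)
qed

text \<open>Writes each entry of the inverse as a quotient of determinants, from which smooth
  dependence on the matrix is immediate.\<close>

lemma matrix_inv_cramer:
  fixes A :: "real^'n^'n"
  assumes "invertible A"
  shows "matrix_inv A $ k $ j =
    det (\<chi> i l. if l = k then axis j 1 $ i else A $ i $ l) * inverse (det A)"
proof -
  have "A *v (matrix_inv A *v axis j 1) = axis j 1"
    by (simp add: matrix_vector_mul_assoc matrix_inv_mult[OF assms])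
  then have "matrix_inv A *v axis j 1 =
      (\<chi> k. det (\<chi> i l. if l = k then axis j 1 $ i else A $ i $ l) / det A)"
    using cramer[of A] assms by (simp add: invertible_det_nz)
  moreover have "(matrix_inv A *v axis j 1) $ k = matrix_inv A $ k $ j"
    by (simp add: matrix_vector_mult_def axis_def if_distrib cong: if_cong)
  ultimately show ?thesis by (simp add: divide_inverse)
qed

lemma smooth_on_matrix_entry:
  fixes g :: "'a::real_normed_vector \<Rightarrow> real^'n^'m"
  assumes "open S"
  shows "smooth_on S g \<longleftrightarrow> (\<forall>i j. smooth_on S (\<lambda>x. g x $ i $ j))"
proof
  assume "smooth_on S g"
  then show "\<forall>i j. smooth_on S (\<lambda>x. g x $ i $ j)"
    using smooth_on_bounded_linear[OF assms bounded_linear_compose[OF bounded_linear_vec_nth bounded_linear_vec_nth]]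
    by blast
next
  assume *: "\<forall>i j. smooth_on S (\<lambda>x. g x $ i $ j)"
  have ax: "(axis i (axis j 1) :: real^'n^'m) $ k $ l = (if i = k then if j = l then 1 else 0 else 0)"
    for i j k l
    by (simp add: axis_def)
  have "(\<Sum>j\<in>UNIV. g x $ i $ j * (if i = k then if j = l then 1 else 0 else 0)) =
      (if i = k then g x $ i $ l else 0)" for x i k l
    by (cases "i = k") (simp_all add: if_distrib[of "times _"] cong: if_cong)
  then have g: "g = (\<lambda>x. \<Sum>i\<in>UNIV. \<Sum>j\<in>UNIV. (g x $ i $ j) *\<^sub>R axis i (axis j 1))"
    by (simp add: fun_eq_iff vec_eq_iff ax)
  show "smooth_on S g"
    using * by (subst g) (intro smooth_on_sum smooth_on_scaleR smooth_on_const assms, auto)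
qed

lemma smooth_on_det:
  fixes g :: "'a::real_normed_vector \<Rightarrow> real^'n^'n"
  assumes "open S" "smooth_on S g"
  shows "smooth_on S (\<lambda>x. det (g x))"
  unfolding det_def using assms smooth_on_matrix_entry[OF assms(1), of g]
  by (intro smooth_on_sum smooth_on_mult smooth_on_const smooth_on_prod) auto

lemma smooth_on_matrix_inv:
  fixes g :: "'a::real_normed_vector \<Rightarrow> real^'n^'n"
  assumes S: "open S" and g: "smooth_on S g" and inv: "\<And>x. x \<in> S \<Longrightarrow> invertible (g x)"
  shows "smooth_on S (\<lambda>x. matrix_inv (g x))"
  unfolding smooth_on_matrix_entry[OF S]
proof (intro allI)
  fix k j
  let ?h = "\<lambda>x. det (\<chi> i l. if l = k then axis j 1 $ i else g x $ i $ l) * inverse (det (g x))"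
  have "smooth_on S (\<lambda>x. (\<chi> i l. if l = k then axis j 1 $ i else g x $ i $ l) :: real^'n^'n)"
    unfolding smooth_on_matrix_entry[OF S]
  proof (intro allI)
    fix i l
    show "smooth_on S (\<lambda>x. ((\<chi> i l. if l = k then axis j 1 $ i else g x $ i $ l) :: real^'n^'n) $ i $ l)"
      using g smooth_on_matrix_entry[OF S, of g] by (cases "l = k") (auto simp: smooth_on_const)
  qed
  moreover have "smooth_on S (\<lambda>x. inverse (det (g x)))"
    using inv by (intro smooth_on_inverse smooth_on_det S g) (auto simp: invertible_det_nz)
  ultimately have "smooth_on S ?h"
    by (intro smooth_on_mult S smooth_on_det)
  then show "smooth_on S (\<lambda>x. matrix_inv (g x) $ k $ j)"
    using smooth_on_cong[OF S, of "\<lambda>x. matrix_inv (g x) $ k $ j" ?h] matrix_inv_cramer[OF inv] by simp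
qed

section \<open>Bump functions\<close>

text \<open>
  The smoothness of \<open>flat 0\<close> is proved for all \<open>n\<close> at once, as derivatives stay in the span of the family.
\<close>

definition flat :: "nat \<Rightarrow> real \<Rightarrow> real" where
  "flat n t = (if t > 0 then exp (- (1 / t)) / t ^ n else 0)"

lemma tendsto_flat_0: "(flat n \<longlongrightarrow> 0) (at 0)"
proof -
  have "((\<lambda>t. (inverse t) ^ n / exp (inverse t)) \<longlongrightarrow> (0::real)) (at_right 0)"
    by (rule filterlim_compose[OF tendsto_power_div_exp_0 filterlim_inverse_at_top_right])
  then have "(flat n \<longlongrightarrow> 0) (at_right 0)"
    by (rule Lim_transform_eventually)
      (auto intro!: eventually_at_right_less[THEN eventually_mono]
        simp: flat_def exp_minus field_simps)
  moreover have "(flat n \<longlongrightarrow> 0) (at_left 0)"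
    by (rule Lim_transform_eventually[OF tendsto_const])
      (auto simp: flat_def eventually_at_left_field intro!: exI[of _ "-1"])
  ultimately show ?thesis
    using filterlim_split_at by blast
qed

lemma flat_has_derivative:
  "(flat n has_real_derivative (flat (n + 2) t - real n * flat (n + 1) t)) (at t)"
proof (cases t "0::real" rule: linorder_cases)
  case less
  have "((\<lambda>_. 0) has_real_derivative 0) (at t)" by simp
  then have "(flat n has_real_derivative 0) (at t)"
    by (rule has_field_derivative_transform_within_open[of _ _ _ "{..<0}"]) (use less in \<open>auto simp: flat_def\<close>)
  then show ?thesis using less by (simp add: flat_def)
next
  case equal
  \<comment> \<open>The difference quotient of \<open>flat n\<close> at 0 is
    \<open>flat (n + 1)\<close>, whose limit is known.\<close>
  have "((\<lambda>s. (flat n s - flat n 0) / (s - 0)) \<longlongrightarrow> 0) (at 0)"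
    by (rule Lim_transform_eventually[OF tendsto_flat_0[of "n + 1"]])
      (auto simp: flat_def eventually_at_filter field_simps)
  then show ?thesis
    using equal by (simp add: has_field_derivative_iff flat_def)
next
  case greater
  have "((\<lambda>t. exp (- (1 / t)) / t ^ n) has_real_derivative
      (flat (n + 2) t - real n * flat (n + 1) t)) (at t)"
  proof -
    have "real n * t ^ (n - 1) * (t * t) = real n * t * t ^ n"
      by (cases n) (auto simp: algebra_simps)
    then show ?thesis
      using greater
      by (auto intro!: derivative_eq_intros simp: flat_def divide_simps power_add power2_eq_square)
        (simp add: algebra_simps)
  qed
  then show ?thesis
    by (rule has_field_derivative_transform_within_open[of _ _ _ "{0<..}"]) (use greater in \<open>auto simp: flat_def\<close>)
qed

lemma smooth_on_flat: "smooth_on UNIV (flat n)"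
  unfolding smooth_on_def
proof
  fix k show "Ck_on k UNIV (flat n)"
  proof (induction k arbitrary: n)
    case 0
    show ?case
      using DERIV_isCont[OF flat_has_derivative] by (simp add: continuous_at_imp_continuous_on)
  next
    case (Suc k)
    show ?case
    proof (rule Ck_on_SucI)
      show "(flat n has_derivative (\<lambda>v. (flat (n + 2) t + (- real n) * flat (n + 1) t) * v)) (at t)" for t
        using flat_has_derivative[of n t] by (simp add: has_field_derivative_def)
      show "Ck_on k UNIV (\<lambda>t. (flat (n + 2) t + (- real n) * flat (n + 1) t) * v)" for v
        by (intro Ck_on_add Ck_on_bilinear[OF _ bounded_bilinear_mult] Ck_on_const Suc.IH) auto
    qed simp
  qed
qed

definition bump :: "'a::euclidean_space \<Rightarrow> real \<Rightarrow> 'a \<Rightarrow> real" where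
  "bump a r x = flat 0 (r\<^sup>2 - (x - a) \<bullet> (x - a))"

lemma smooth_on_bump: "smooth_on UNIV (bump a r)"
  unfolding bump_def
  by (rule smooth_on_compose[OF open_UNIV open_UNIV _ smooth_on_flat])
    (auto intro!: smooth_on_diff smooth_on_inner smooth_on_const
      smooth_on_bounded_linear_ident[OF _ bounded_linear_ident])

lemma bump_nonneg: "bump a r x \<ge> 0"
  by (simp add: bump_def flat_def)

lemma bump_pos: "r > 0 \<Longrightarrow> bump a r a > 0"
  by (simp add: bump_def flat_def)

lemma bump_eq_0: "x \<notin> cball a r \<Longrightarrow> r > 0 \<Longrightarrow> bump a r x = 0"
  using power_strict_mono[of r "dist a x" 2]
  by (auto simp: bump_def flat_def dist_norm power2_norm_eq_inner[symmetric] norm_minus_commute)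

section \<open>The divergence theorem for compactly supported functions\<close>

lemma frechet_derivative_eq_0_outside:
  assumes "closed K" "x \<notin> K" "\<And>y. y \<notin> K \<Longrightarrow> f y = 0"
  shows "frechet_derivative f (at x) v = 0"
  using frechet_derivative_cong_open[of "- K" x f "\<lambda>_. 0"] assms by (simp add: open_Compl)

text \<open>Translation invariance of Lebesgue measure makes the integral of every difference
  quotient of \<open>f\<close> in direction \<open>e\<close> vanish; dominated convergence passes
  this to the derivative. No iterated integrals occur.\<close>

lemma integral_compact_support_derivative:
  fixes f :: "'a::euclidean_space \<Rightarrow> real"
  assumes diff: "\<And>x. f differentiable (at x)"
    and cont: "continuous_on UNIV (\<lambda>x. frechet_derivative f (at x) e)"
    and K: "compact K" and zero: "\<And>x. x \<notin> K \<Longrightarrow> f x = 0"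
  shows "integrable lborel (\<lambda>x. frechet_derivative f (at x) e)"
    and "(LINT x|lborel. frechet_derivative f (at x) e) = 0"
proof -
  let ?D = "\<lambda>x. frechet_derivative f (at x) e"
  have D0: "?D x = 0" if "x \<notin> K" for x
    using frechet_derivative_eq_0_outside[OF compact_imp_closed[OF K] that zero] .
  have fcont: "continuous_on UNIV f"
    using diff by (auto intro!: continuous_at_imp_continuous_on differentiable_imp_continuous_within)
  have ind: "(\<lambda>x. indicator K x *\<^sub>R h x) = h" if "\<And>x. x \<notin> K \<Longrightarrow> h x = 0" for h :: "'a \<Rightarrow> real"
    using that by (auto simp: indicator_def fun_eq_iff)
  have f_int: "integrable lborel f"
    using borel_integrable_compact[OF K continuous_on_subset[OF fcont]] ind[OF zero] by simp
  show "integrable lborel ?D"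
    using borel_integrable_compact[OF K continuous_on_subset[OF cont]] ind[OF D0] by simp
  obtain C where C: "C > 0" "\<And>x. x \<in> K \<Longrightarrow> \<bar>?D x\<bar> \<le> C"
    using compact_imp_bounded[OF compact_continuous_image[OF continuous_on_subset[OF cont] K]]
    by (auto simp: bounded_pos)
  have C': "\<bar>?D x\<bar> \<le> C" for x
    using C D0[of x] by (cases "x \<in> K") auto
  obtain R where R: "\<And>x. x \<in> K \<Longrightarrow> norm x \<le> R"
    using compact_imp_bounded[OF K] by (auto simp: bounded_iff)
  have line: "((\<lambda>t. f (x + t *\<^sub>R e)) has_real_derivative ?D (x + t *\<^sub>R e)) (at t)" for x t
  proof -
    have "((\<lambda>t. x + t *\<^sub>R e) has_derivative (\<lambda>s. s *\<^sub>R e)) (at t)"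
      by (auto intro!: derivative_eq_intros)
    moreover have fd: "(f has_derivative frechet_derivative f (at (x + t *\<^sub>R e))) (at (x + t *\<^sub>R e))"
      using diff by (simp add: frechet_derivative_works)
    ultimately have "((\<lambda>t. f (x + t *\<^sub>R e)) has_derivative
        (\<lambda>s. frechet_derivative f (at (x + t *\<^sub>R e)) (s *\<^sub>R e))) (at t)"
      by (rule has_derivative_compose)
    then show ?thesis
      using has_derivative_linear[OF fd]
      by (simp add: has_field_derivative_def linear_scale mult.commute[of _ "?D _"])
  qed
  define h where "h n = inverse (real (Suc n))" for n
  have h: "h n > 0" "h n \<le> 1" for n
    by (auto simp: h_def field_simps)
  define s where "s n x = (f (x + h n *\<^sub>R e) - f x) / h n" for n x
  have hlim: "h \<longlonglongrightarrow> 0"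
    unfolding h_def by (rule LIMSEQ_inverse_real_of_nat)
  have s_lim: "(\<lambda>n. s n x) \<longlonglongrightarrow> ?D x" for x
  proof -
    have "((\<lambda>t. (f (x + t *\<^sub>R e) - f x) / t) \<longlongrightarrow> ?D x) (at 0)"
      using line[of x 0] by (simp add: has_field_derivative_iff)
    moreover have "filterlim h (at 0) sequentially"
      using hlim h(1) by (auto simp: filterlim_at less_imp_neq[symmetric] intro!: always_eventually)
    ultimately show ?thesis
      unfolding s_def by (rule filterlim_compose)
  qed
  \<comment> \<open>The step sizes are at most 1, so all difference quotients vanish outside the
    ball of radius \<open>R + norm e\<close>. Inside it the mean value theorem bounds them by the
    bound \<open>C\<close> for the derivative.\<close>
  have s_bound: "norm (s n x) \<le> C * indicator (cball 0 (R + norm e)) x" for n x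
  proof (cases "x \<in> cball 0 (R + norm e)")
    case True
    have "\<exists>z. 0 < z \<and> z < h n \<and> f (x + h n *\<^sub>R e) - f (x + 0 *\<^sub>R e) = (h n - 0) * ?D (x + z *\<^sub>R e)"
      using line h(1) by (intro MVT2)
    then obtain z where "f (x + h n *\<^sub>R e) - f x = h n * ?D (x + z *\<^sub>R e)" by auto
    then have "s n x = ?D (x + z *\<^sub>R e)" using h(1)[of n] by (simp add: s_def)
    then show ?thesis using True C' by simp
  next
    case False
    have "x \<notin> K" using False R[of x] norm_ge_zero[of e] by auto
    moreover have "x + h n *\<^sub>R e \<notin> K"
    proof
      assume "x + h n *\<^sub>R e \<in> K"
      then have "norm (x + h n *\<^sub>R e) \<le> R" by (rule R)
      moreover have "norm x \<le> norm (x + h n *\<^sub>R e) + norm (h n *\<^sub>R e)"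
        using norm_triangle_ineq4[of "x + h n *\<^sub>R e" "h n *\<^sub>R e"] by simp
      moreover have "norm (h n *\<^sub>R e) \<le> norm e"
        using h[of n] by (simp add: mult_left_le_one_le)
      ultimately show False using False by simp
    qed
    ultimately show ?thesis by (simp add: s_def zero False C(1) less_imp_le)
  qed
  have translate: "integrable lborel (\<lambda>x. f (x + c))" "(LINT x|lborel. f (x + c)) = (LINT x|lborel. f x)" for c
  proof -
    have m: "f \<in> borel_measurable borel"
      using fcont by (rule borel_measurable_continuous_onI)
    have "integrable (distr lborel borel ((+) c)) f"
      using f_int by (simp add: lborel_distr_plus)
    then show "integrable lborel (\<lambda>x. f (x + c))"
      using m by (simp add: integrable_distr_eq add.commute)
    have "(LINT x|distr lborel borel ((+) c). f x) = (LINT x|lborel. f (c + x))"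
      using m by (intro integral_distr) auto
    then show "(LINT x|lborel. f (x + c)) = (LINT x|lborel. f x)"
      by (simp add: lborel_distr_plus add.commute)
  qed
  have s_int: "(LINT x|lborel. s n x) = 0" for n
    unfolding s_def using translate f_int by simp
  have "(\<lambda>n. LINT x|lborel. s n x) \<longlonglongrightarrow> (LINT x|lborel. ?D x)"
  proof (rule integral_dominated_convergence)
    show "?D \<in> borel_measurable lborel"
      using borel_measurable_continuous_onI[OF cont] by simp
    have "f \<in> borel_measurable borel"
      using fcont by (rule borel_measurable_continuous_onI)
    then show "s n \<in> borel_measurable lborel" for n
      unfolding s_def by simp
    show "integrable lborel (\<lambda>x. C * indicator (cball 0 (R + norm e)) x)"
      by (intro integrable_mult_right integrable_real_indicator) (use emeasure_bounded_finite[OF bounded_cball] in \<open>auto simp: less_top\<close>)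
    show "AE x in lborel. (\<lambda>n. s n x) \<longlonglongrightarrow> ?D x"
      using s_lim by (intro AE_I2)
    show "AE x in lborel. norm (s n x) \<le> C * indicator (cball 0 (R + norm e)) x" for n
      using s_bound by (intro AE_I2)
  qed
  then show "(LINT x|lborel. ?D x) = 0"
    by (simp add: s_int LIMSEQ_const_iff)
qed

section \<open>Laplace operator in a chart\<close>

definition partial :: "'m::finite \<Rightarrow> (real^'m \<Rightarrow> 'b::real_normed_vector) \<Rightarrow> real^'m \<Rightarrow> 'b" where
  "partial i f x = frechet_derivative f (at x) (axis i 1)"

lemma partial_cong:
  "open S \<Longrightarrow> x \<in> S \<Longrightarrow> (\<And>y. y \<in> S \<Longrightarrow> f y = h y) \<Longrightarrow> partial i f x = partial i h x"
  unfolding partial_def using frechet_derivative_cong_open[of S x f h] by simp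

lemma smooth_on_partial: "smooth_on S f \<Longrightarrow> smooth_on S (partial i f)"
  unfolding partial_def[abs_def] by (rule smooth_on_frechet)

lemma has_derivative_partial:
  assumes "(f has_derivative f') (at x)"
  shows "partial i f x = f' (axis i 1)"
  unfolding partial_def frechet_derivative_at[OF assms, symmetric] ..

lemma frechet_derivative_partial:
  assumes "(f has_derivative f') (at x)"
  shows "f' v = (\<Sum>i\<in>UNIV. v $ i *\<^sub>R partial i f x)"
proof -
  have "v = (\<Sum>i\<in>UNIV. v $ i *\<^sub>R axis i 1)"
    by (simp add: vec_eq_iff axis_def if_distrib[of "times _"] cong: if_cong)
  then have "f' v = f' (\<Sum>i\<in>UNIV. v $ i *\<^sub>R axis i 1)"
    by simp
  also have "\<dots> = (\<Sum>i\<in>UNIV. v $ i *\<^sub>R f' (axis i 1))"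
    using has_derivative_linear[OF assms] by (simp add: linear_sum linear_scale)
  finally show ?thesis
    by (simp add: has_derivative_partial[OF assms])
qed

lemma partial_const: "partial i (\<lambda>_. c) x = 0"
  by (simp add: partial_def)

lemma partial_bounded_linear:
  assumes "bounded_linear L" "smooth_on S f" "x \<in> S"
  shows "partial i (\<lambda>y. L (f y)) x = L (partial i f x)"
  unfolding partial_def using smooth_on_has_derivative[OF assms(2,3)]
  by (intro frechet_derivative_bounded_linear assms) (auto simp: differentiable_def)

lemma partial_add:
  assumes "smooth_on S f" "smooth_on S h" "x \<in> S"
  shows "partial i (\<lambda>y. f y + h y) x = partial i f x + partial i h x"
  unfolding has_derivative_partial[OF has_derivative_add[OF smooth_on_has_derivative[OF assms(1,3)]
    smooth_on_has_derivative[OF assms(2,3)]]] by (simp add: partial_def)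

lemma partial_sum:
  assumes "\<And>a. a \<in> I \<Longrightarrow> smooth_on S (f a)" "x \<in> S"
  shows "partial i (\<lambda>y. \<Sum>a\<in>I. f a y) x = (\<Sum>a\<in>I. partial i (f a) x)"
proof -
  have "((\<lambda>y. \<Sum>a\<in>I. f a y) has_derivative (\<lambda>v. \<Sum>a\<in>I. frechet_derivative (f a) (at x) v)) (at x)"
    using assms by (intro has_derivative_sum smooth_on_has_derivative)
  from has_derivative_partial[OF this] show ?thesis
    by (simp add: partial_def)
qed

lemma partial_bilinear:
  assumes "bounded_bilinear b" "smooth_on S f" "smooth_on S h" "x \<in> S"
  shows "partial i (\<lambda>y. b (f y) (h y)) x = b (f x) (partial i h x) + b (partial i f x) (h x)"
  unfolding has_derivative_partial[OF bounded_bilinear.FDERIV[OF assms(1)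
      smooth_on_has_derivative[OF assms(2,4)] smooth_on_has_derivative[OF assms(3,4)]]]
  by (simp add: partial_def)

lemmas partial_mult = partial_bilinear[OF bounded_bilinear_mult]
lemmas partial_scaleR = partial_bilinear[OF bounded_bilinear_scaleR]
lemmas partial_inner = partial_bilinear[OF bounded_bilinear_inner]

lemma partial_commute:
  fixes f :: "real^'m::finite \<Rightarrow> 'b::euclidean_space"
  assumes "open S" "smooth_on S f" "x \<in> S"
  shows "partial i (partial j f) x = partial j (partial i f) x"
  unfolding partial_def[abs_def] by (rule frechet_derivative_commute[OF assms])

section \<open>Christoffel symbols and the Laplacian of a coordinate metric\<close>

definition chris ::
  "(real^'m \<Rightarrow> real^'m^'m) \<Rightarrow> 'm \<Rightarrow> 'm \<Rightarrow> 'm \<Rightarrow> real^'m::finite \<Rightarrow> real" where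
  "chris g k i j x = (1/2) * (\<Sum>l\<in>UNIV. matrix_inv (g x) $ k $ l *
     (partial i (\<lambda>y. g y $ j $ l) x + partial j (\<lambda>y. g y $ i $ l) x - partial l (\<lambda>y. g y $ i $ j) x))"

definition lap_coeff :: "(real^'m \<Rightarrow> real^'m^'m) \<Rightarrow> 'm \<Rightarrow> real^'m::finite \<Rightarrow> real" where
  "lap_coeff g k x = (\<Sum>i\<in>UNIV. \<Sum>j\<in>UNIV. matrix_inv (g x) $ i $ j * chris g k i j x)"

text \<open>The trace of the Hessian, with values in any normed space, so that one operator serves
  the immersion, the test field and scalar cut-offs. Its agreement with the divergence of the
  gradient is \<open>lap_divergence_form\<close>.\<close>

definition lap ::
  "(real^'m \<Rightarrow> real^'m^'m) \<Rightarrow> (real^'m \<Rightarrow> 'b::real_normed_vector) \<Rightarrow> real^'m::finite \<Rightarrow> 'b" where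
  "lap g f x = (\<Sum>i\<in>UNIV. \<Sum>j\<in>UNIV. matrix_inv (g x) $ i $ j *\<^sub>R partial i (partial j f) x)
     - (\<Sum>k\<in>UNIV. lap_coeff g k x *\<^sub>R partial k f x)"

definition grad :: "(real^'m \<Rightarrow> real^'m^'m) \<Rightarrow> (real^'m \<Rightarrow> real) \<Rightarrow> 'm \<Rightarrow> real^'m::finite \<Rightarrow> real" where
  "grad g f i x = (\<Sum>l\<in>UNIV. matrix_inv (g x) $ i $ l * partial l f x)"

lemma lap_cong_open:
  assumes S: "open S" "x \<in> S" and eq: "\<And>y. y \<in> S \<Longrightarrow> f y = h y"
  shows "lap g f x = lap g h x"
proof -
  have *: "partial j f y = partial j h y" if "y \<in> S" for j y
    by (rule partial_cong[OF S(1) that]) (rule eq)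
  have "partial i (partial j f) x = partial i (partial j h) x" for i j
    by (rule partial_cong[OF S]) (rule *)
  then show ?thesis
    unfolding lap_def *[OF S(2)] by simp
qed

lemma sum_rotate:
  "(\<Sum>i\<in>A. \<Sum>j\<in>B. \<Sum>k\<in>C. f i j k) = (\<Sum>k\<in>C. \<Sum>i\<in>A. \<Sum>j\<in>B. f i j k)"
proof -
  have "(\<Sum>i\<in>A. \<Sum>j\<in>B. \<Sum>k\<in>C. f i j k) = (\<Sum>i\<in>A. \<Sum>k\<in>C. \<Sum>j\<in>B. f i j k)"
    by (intro sum.cong refl sum.swap)
  also have "\<dots> = (\<Sum>k\<in>C. \<Sum>i\<in>A. \<Sum>j\<in>B. f i j k)"
    by (rule sum.swap)
  finally show ?thesis .
qed

locale metric_chart =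
  fixes U :: "(real^'m::finite) set" and g :: "real^'m \<Rightarrow> real^'m^'m"
  assumes open_U: "open U" and smooth_g: "smooth_on U g"
    and sym_g: "x \<in> U \<Longrightarrow> transpose (g x) = g x"
    and posdef_g: "x \<in> U \<Longrightarrow> v \<noteq> 0 \<Longrightarrow> 0 < v \<bullet> (g x *v v)"
begin

abbreviation G where "G x \<equiv> matrix_inv (g x)"

lemma invertible_g: "x \<in> U \<Longrightarrow> invertible (g x)"
  using posdef_g posdef_invertible by blast

lemma smooth_g_entry: "smooth_on U (\<lambda>x. g x $ i $ j)"
  using smooth_g smooth_on_matrix_entry[OF open_U] by blast

lemma smooth_G_entry: "smooth_on U (\<lambda>x. G x $ i $ j)"
  using smooth_on_matrix_inv[OF open_U smooth_g] invertible_g smooth_on_matrix_entry[OF open_U, of G]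
  by auto

lemma g_sym: "x \<in> U \<Longrightarrow> g x $ i $ j = g x $ j $ i"
  using arg_cong[OF sym_g[of x], of "\<lambda>A. A $ j $ i"] by (simp add: transpose_def)

lemma G_sym: "x \<in> U \<Longrightarrow> G x $ i $ j = G x $ j $ i"
  using arg_cong[OF symmetric_matrix_inv[OF invertible_g sym_g, of x], of "\<lambda>A. A $ j $ i"]
  by (simp add: transpose_def)

lemma G_g: "x \<in> U \<Longrightarrow> (\<Sum>k\<in>UNIV. G x $ i $ k * g x $ k $ j) = (if i = j then 1 else 0)"
  using matrix_inv_left_mult[OF invertible_g, of x]
  by (simp add: matrix_matrix_mult_def mat_def vec_eq_iff)

lemma g_G: "x \<in> U \<Longrightarrow> (\<Sum>k\<in>UNIV. g x $ i $ k * G x $ k $ j) = (if i = j then 1 else 0)"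
  using matrix_inv_right_mult[OF invertible_g, of x]
  by (simp add: matrix_matrix_mult_def mat_def vec_eq_iff)

lemmas smooth_intros = smooth_on_add[OF open_U] smooth_on_diff[OF open_U] smooth_on_sum[OF open_U]
  smooth_on_mult[OF open_U] smooth_on_scaleR[OF open_U] smooth_on_inner[OF open_U] smooth_on_const
  smooth_on_partial smooth_G_entry smooth_g_entry

lemma smooth_chris: "smooth_on U (chris g k i j)"
  unfolding chris_def[abs_def] by (intro smooth_intros)

lemma smooth_lap_coeff: "smooth_on U (lap_coeff g k)"
  unfolding lap_coeff_def[abs_def] by (intro smooth_intros smooth_chris)

lemma smooth_lap: "smooth_on U f \<Longrightarrow> smooth_on U (lap g f)"
  unfolding lap_def[abs_def] by (intro smooth_intros smooth_lap_coeff)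

lemma lap_bounded_linear:
  assumes "bounded_linear L" "smooth_on U f" "x \<in> U"
  shows "lap g (\<lambda>y. L (f y)) x = L (lap g f x)"
proof -
  note L = bounded_linear.linear[OF assms(1)]
  have *: "partial j (\<lambda>y. L (f y)) y = L (partial j f y)" if "y \<in> U" for j y
    using partial_bounded_linear[OF assms(1,2) that] .
  have "partial i (partial j (\<lambda>y. L (f y))) x = partial i (\<lambda>y. L (partial j f y)) x" for i j
    by (rule partial_cong[OF open_U assms(3)]) (rule *)
  then have "partial i (partial j (\<lambda>y. L (f y))) x = L (partial i (partial j f) x)" for i j
    using partial_bounded_linear[OF assms(1) smooth_on_partial[OF assms(2)] assms(3)] by simp
  then show ?thesis
    unfolding lap_def
    by (simp add: *[OF assms(3)] linear_diff[OF L] linear_scale[OF L] linear_sum[OF L])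
qed

lemma lap_add:
  assumes "smooth_on U f" "smooth_on U h" "x \<in> U"
  shows "lap g (\<lambda>y. f y + h y) x = lap g f x + lap g h x"
proof -
  have *: "partial j (\<lambda>y. f y + h y) y = partial j f y + partial j h y" if "y \<in> U" for j y
    using partial_add[OF assms(1,2) that] .
  have "partial i (partial j (\<lambda>y. f y + h y)) x = partial i (\<lambda>y. partial j f y + partial j h y) x" for i j
    by (rule partial_cong[OF open_U assms(3)]) (rule *)
  then have "partial i (partial j (\<lambda>y. f y + h y)) x = partial i (partial j f) x + partial i (partial j h) x" for i j
    using partial_add[OF smooth_on_partial[OF assms(1)] smooth_on_partial[OF assms(2)] assms(3)] by simp
  then show ?thesis
    unfolding lap_def using * assms(3)
    by (simp add: scaleR_add_right sum.distrib)
qed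

text \<open>One product rule for two uses: the inner product in \<open>lap_radial\<close>, and
  scaling a vector field by a function in \<open>tension_variation\<close> and
  \<open>variation_integrand\<close>. The two mixed sums coincide by the symmetry of
  \<open>G\<close>.\<close>

lemma lap_bilinear:
  assumes b: "bounded_bilinear b" and f: "smooth_on U f" and h: "smooth_on U h" and x: "x \<in> U"
  shows "lap g (\<lambda>y. b (f y) (h y)) x = b (f x) (lap g h x) + b (lap g f x) (h x) +
    2 *\<^sub>R (\<Sum>i\<in>UNIV. \<Sum>j\<in>UNIV. G x $ i $ j *\<^sub>R b (partial i f x) (partial j h x))"
proof -
  interpret b: bounded_bilinear b by fact
  note pf = smooth_on_partial[OF f] and ph = smooth_on_partial[OF h]
  have p1: "partial j (\<lambda>y. b (f y) (h y)) y = b (f y) (partial j h y) + b (partial j f y) (h y)" if "y \<in> U" for j y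
    using partial_bilinear[OF b f h that] .
  have p2: "partial i (partial j (\<lambda>y. b (f y) (h y))) x =
      b (f x) (partial i (partial j h) x) + b (partial i f x) (partial j h x) +
      (b (partial j f x) (partial i h x) + b (partial i (partial j f) x) (h x))" for i j
  proof -
    have "partial i (partial j (\<lambda>y. b (f y) (h y))) x =
        partial i (\<lambda>y. b (f y) (partial j h y) + b (partial j f y) (h y)) x"
      using p1 by (intro partial_cong[OF open_U x])
    also have "\<dots> = partial i (\<lambda>y. b (f y) (partial j h y)) x + partial i (\<lambda>y. b (partial j f y) (h y)) x"
      by (intro partial_add[OF _ _ x] smooth_on_bilinear[OF open_U b] f h pf ph)
    also have "\<dots> = b (f x) (partial i (partial j h) x) + b (partial i f x) (partial j h x) +
        (b (partial j f x) (partial i h x) + b (partial i (partial j f) x) (h x))"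
      by (simp add: partial_bilinear[OF b f ph x] partial_bilinear[OF b pf h x])
    finally show ?thesis .
  qed
  have "(\<Sum>i\<in>UNIV. \<Sum>j\<in>UNIV. G x $ i $ j *\<^sub>R b (partial j f x) (partial i h x)) =
      (\<Sum>i\<in>UNIV. \<Sum>j\<in>UNIV. G x $ i $ j *\<^sub>R b (partial i f x) (partial j h x))"
    by (subst sum.swap) (simp add: G_sym[OF x])
  then show ?thesis
    unfolding lap_def p2 p1[OF x]
    by (simp add: scaleR_add_right sum.distrib b.diff_left b.diff_right b.sum_left b.sum_right
        b.scaleR_left b.scaleR_right scaleR_2 algebra_simps)
qed

section \<open>The Laplacian as the divergence of the gradient\<close>

definition contr :: "'m \<Rightarrow> real^'m \<Rightarrow> real" where
  "contr a x = (\<Sum>i\<in>UNIV. \<Sum>j\<in>UNIV. G x $ i $ j * partial i (\<lambda>y. g y $ j $ a) x)"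

text \<open>By Jacobi's formula, the derivative of the logarithm of \<open>det g\<close> along
  coordinate \<open>a\<close>. Together with \<open>contr\<close> it expresses all first-order
  coefficients of the Laplacian.\<close>

definition log_det_deriv :: "'m \<Rightarrow> real^'m \<Rightarrow> real" where
  "log_det_deriv a x = (\<Sum>i\<in>UNIV. \<Sum>j\<in>UNIV. G x $ i $ j * partial a (\<lambda>y. g y $ i $ j) x)"

lemma partial_g_sym: "x \<in> U \<Longrightarrow> partial k (\<lambda>y. g y $ i $ j) x = partial k (\<lambda>y. g y $ j $ i) x"
  by (rule partial_cong[OF open_U]) (auto simp: g_sym)

text \<open>Under the trace, the first and third metric derivatives in the Christoffel symbol cancel
  by symmetry.\<close>

lemma chris_trace:
  assumes x: "x \<in> U"
  shows "(\<Sum>i\<in>UNIV. chris g i i k x) = log_det_deriv k x / 2"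
proof -
  have "(\<Sum>i\<in>UNIV. \<Sum>l\<in>UNIV. G x $ i $ l * partial i (\<lambda>y. g y $ k $ l) x) =
      (\<Sum>i\<in>UNIV. \<Sum>l\<in>UNIV. G x $ i $ l * partial l (\<lambda>y. g y $ i $ k) x)"
    by (subst sum.swap) (simp add: G_sym[OF x] partial_g_sym[OF x, of _ _ k])
  then show ?thesis
    unfolding chris_def log_det_deriv_def
    by (simp add: sum_distrib_left[symmetric] sum_subtractf sum.distrib sum_divide_distrib[symmetric]
        algebra_simps)
qed

lemma lap_coeff_eq:
  assumes x: "x \<in> U"
  shows "lap_coeff g k x = (\<Sum>a\<in>UNIV. G x $ k $ a * (contr a x - log_det_deriv a x / 2))"
proof -
  have eq: "(\<Sum>i\<in>UNIV. \<Sum>j\<in>UNIV. G x $ i $ j * partial j (\<lambda>y. g y $ i $ a) x) = contr a x" for a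
    unfolding contr_def by (subst sum.swap) (simp add: G_sym[OF x])
  have "lap_coeff g k x = (\<Sum>i\<in>UNIV. \<Sum>j\<in>UNIV. \<Sum>a\<in>UNIV. G x $ k $ a * (1/2 * (G x $ i $ j *
      (partial i (\<lambda>y. g y $ j $ a) x + partial j (\<lambda>y. g y $ i $ a) x - partial a (\<lambda>y. g y $ i $ j) x))))"
    unfolding lap_coeff_def chris_def by (simp add: sum_distrib_left mult_ac)
  also have "\<dots> = (\<Sum>a\<in>UNIV. \<Sum>i\<in>UNIV. \<Sum>j\<in>UNIV. G x $ k $ a * (1/2 * (G x $ i $ j *
      (partial i (\<lambda>y. g y $ j $ a) x + partial j (\<lambda>y. g y $ i $ a) x - partial a (\<lambda>y. g y $ i $ j) x))))"
    by (rule sum_rotate)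
  also have "\<dots> = (\<Sum>a\<in>UNIV. G x $ k $ a * (1/2 * (contr a x + contr a x - log_det_deriv a x)))"
    unfolding sum_distrib_left[symmetric]
    by (simp add: distrib_left right_diff_distrib sum.distrib sum_subtractf eq
        contr_def[symmetric] log_det_deriv_def[symmetric] del: mult_eq_if)
  finally show ?thesis by (simp add: field_simps)
qed

text \<open>Differentiate the identity \<open>G g = 1\<close> and multiply by \<open>G\<close> from
  the right.\<close>

lemma partial_G:
  assumes x: "x \<in> U"
  shows "partial k (\<lambda>y. G y $ i $ l) x =
    - (\<Sum>a\<in>UNIV. \<Sum>b\<in>UNIV. G x $ i $ a * partial k (\<lambda>y. g y $ a $ b) x * G x $ b $ l)"
proof -
  have zero: "(\<Sum>a\<in>UNIV. partial k (\<lambda>y. G y $ i $ a) x * g x $ a $ b) =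
      - (\<Sum>a\<in>UNIV. G x $ i $ a * partial k (\<lambda>y. g y $ a $ b) x)" for b
  proof -
    have "partial k (\<lambda>y. \<Sum>a\<in>UNIV. G y $ i $ a * g y $ a $ b) x = partial k (\<lambda>y. if i = b then 1 else 0) x"
      by (rule partial_cong[OF open_U x]) (simp add: G_g)
    also have "\<dots> = 0" by (simp add: partial_const)
    finally have "0 = (\<Sum>a\<in>UNIV. partial k (\<lambda>y. G y $ i $ a * g y $ a $ b) x)"
      by (subst (asm) partial_sum[OF _ x]) (intro smooth_intros, simp)
    also have "\<dots> = (\<Sum>a\<in>UNIV. G x $ i $ a * partial k (\<lambda>y. g y $ a $ b) x +
        partial k (\<lambda>y. G y $ i $ a) x * g x $ a $ b)"
      by (simp add: partial_mult[OF smooth_G_entry smooth_g_entry x])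
    finally show ?thesis by (simp add: sum.distrib)
  qed
  have "partial k (\<lambda>y. G y $ i $ l) x =
      (\<Sum>a\<in>UNIV. partial k (\<lambda>y. G y $ i $ a) x * (if a = l then 1 else 0))"
    by (simp add: if_distrib[of "times _"] cong: if_cong)
  also have "\<dots> = (\<Sum>a\<in>UNIV. \<Sum>b\<in>UNIV. partial k (\<lambda>y. G y $ i $ a) x * g x $ a $ b * G x $ b $ l)"
    by (simp add: g_G[OF x, symmetric] sum_distrib_left mult.assoc)
  also have "\<dots> = (\<Sum>b\<in>UNIV. (\<Sum>a\<in>UNIV. partial k (\<lambda>y. G y $ i $ a) x * g x $ a $ b) * G x $ b $ l)"
    by (subst sum.swap) (simp add: sum_distrib_right)
  also have "\<dots> = - (\<Sum>b\<in>UNIV. \<Sum>a\<in>UNIV. G x $ i $ a * partial k (\<lambda>y. g y $ a $ b) x * G x $ b $ l)"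
    by (simp add: zero sum_distrib_right sum_negf)
  also have "\<dots> = - (\<Sum>a\<in>UNIV. \<Sum>b\<in>UNIV. G x $ i $ a * partial k (\<lambda>y. g y $ a $ b) x * G x $ b $ l)"
    by (subst sum.swap) simp
  finally show ?thesis .
qed

lemma partial_G_trace:
  assumes x: "x \<in> U"
  shows "(\<Sum>i\<in>UNIV. partial i (\<lambda>y. G y $ i $ l) x) = - (\<Sum>b\<in>UNIV. contr b x * G x $ b $ l)"
proof -
  have "(\<Sum>i\<in>UNIV. partial i (\<lambda>y. G y $ i $ l) x) =
      - (\<Sum>i\<in>UNIV. \<Sum>a\<in>UNIV. \<Sum>b\<in>UNIV. G x $ i $ a * partial i (\<lambda>y. g y $ a $ b) x * G x $ b $ l)"
    by (simp add: partial_G[OF x] sum_negf)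
  also have "(\<Sum>i\<in>UNIV. \<Sum>a\<in>UNIV. \<Sum>b\<in>UNIV. G x $ i $ a * partial i (\<lambda>y. g y $ a $ b) x * G x $ b $ l)
    = (\<Sum>i\<in>UNIV. \<Sum>b\<in>UNIV. \<Sum>a\<in>UNIV. G x $ i $ a * partial i (\<lambda>y. g y $ a $ b) x * G x $ b $ l)"
    by (intro sum.cong refl sum.swap)
  also have "\<dots> = (\<Sum>b\<in>UNIV. \<Sum>i\<in>UNIV. \<Sum>a\<in>UNIV. G x $ i $ a * partial i (\<lambda>y. g y $ a $ b) x * G x $ b $ l)"
    by (rule sum.swap)
  also have "\<dots> = (\<Sum>b\<in>UNIV. contr b x * G x $ b $ l)"
    by (simp add: contr_def sum_distrib_right)
  finally show ?thesis .
qed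

lemma smooth_grad: "smooth_on U f \<Longrightarrow> smooth_on U (grad g f i)"
  unfolding grad_def[abs_def] by (intro smooth_intros)

text \<open>The first-order terms of the divergence form are \<open>contr\<close> with a minus sign,
  from differentiating \<open>G\<close>, and half of \<open>log_det_deriv\<close>, from the trace of
  the Christoffel symbols, both contracted with \<open>G\<close>. By \<open>lap_coeff_eq\<close>
  they add up to minus \<open>lap_coeff\<close>.\<close>

lemma lap_divergence_form:
  assumes f: "smooth_on U f" and x: "x \<in> U"
  shows "lap g f x = (\<Sum>i\<in>UNIV. partial i (grad g f i) x + (\<Sum>k\<in>UNIV. chris g i i k x * grad g f k x))"
proof -
  have "partial i (grad g f i) x = (\<Sum>l\<in>UNIV. G x $ i $ l * partial i (partial l f) x +
      partial i (\<lambda>y. G y $ i $ l) x * partial l f x)" for i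
  proof -
    have "partial i (grad g f i) x = (\<Sum>l\<in>UNIV. partial i (\<lambda>y. G y $ i $ l * partial l f y) x)"
      unfolding grad_def[abs_def] by (rule partial_sum[OF _ x]) (intro smooth_intros f)
    then show ?thesis
      by (simp add: partial_mult[OF smooth_G_entry smooth_on_partial[OF f] x])
  qed
  then have "(\<Sum>i\<in>UNIV. partial i (grad g f i) x) =
      (\<Sum>i\<in>UNIV. \<Sum>l\<in>UNIV. G x $ i $ l * partial i (partial l f) x) +
      (\<Sum>i\<in>UNIV. \<Sum>l\<in>UNIV. partial i (\<lambda>y. G y $ i $ l) x * partial l f x)"
    by (simp add: sum.distrib)
  also have "(\<Sum>i\<in>UNIV. \<Sum>l\<in>UNIV. partial i (\<lambda>y. G y $ i $ l) x * partial l f x) =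
      - (\<Sum>l\<in>UNIV. (\<Sum>b\<in>UNIV. contr b x * G x $ b $ l) * partial l f x)"
    by (subst sum.swap) (simp add: sum_distrib_right[symmetric] partial_G_trace[OF x] sum_negf)
  finally have 1: "(\<Sum>i\<in>UNIV. partial i (grad g f i) x) =
      (\<Sum>i\<in>UNIV. \<Sum>l\<in>UNIV. G x $ i $ l * partial i (partial l f) x)
      - (\<Sum>l\<in>UNIV. (\<Sum>b\<in>UNIV. contr b x * G x $ b $ l) * partial l f x)" by simp
  have "(\<Sum>i\<in>UNIV. \<Sum>k\<in>UNIV. chris g i i k x * grad g f k x) =
      (\<Sum>k\<in>UNIV. (log_det_deriv k x / 2) * grad g f k x)"
    by (subst sum.swap) (simp add: sum_distrib_right[symmetric] chris_trace[OF x])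
  also have "\<dots> = (\<Sum>k\<in>UNIV. \<Sum>l\<in>UNIV. (log_det_deriv k x / 2) * G x $ k $ l * partial l f x)"
    by (simp add: grad_def sum_distrib_left mult.assoc)
  also have "\<dots> = (\<Sum>l\<in>UNIV. (\<Sum>k\<in>UNIV. (log_det_deriv k x / 2) * G x $ k $ l) * partial l f x)"
    by (subst sum.swap) (simp add: sum_distrib_right)
  finally have 2: "(\<Sum>i\<in>UNIV. \<Sum>k\<in>UNIV. chris g i i k x * grad g f k x) =
     (\<Sum>l\<in>UNIV. (\<Sum>k\<in>UNIV. (log_det_deriv k x / 2) * G x $ k $ l) * partial l f x)" .
  have "lap_coeff g l x = (\<Sum>b\<in>UNIV. contr b x * G x $ b $ l) -
      (\<Sum>k\<in>UNIV. (log_det_deriv k x / 2) * G x $ k $ l)" for l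
    unfolding lap_coeff_eq[OF x] G_sym[OF x, of l]
    by (simp add: right_diff_distrib sum_subtractf mult.commute)
  then have "(\<Sum>l\<in>UNIV. lap_coeff g l x * partial l f x) =
      (\<Sum>l\<in>UNIV. (\<Sum>b\<in>UNIV. contr b x * G x $ b $ l) * partial l f x) -
      (\<Sum>l\<in>UNIV. (\<Sum>k\<in>UNIV. (log_det_deriv k x / 2) * G x $ k $ l) * partial l f x)"
    by (simp only: left_diff_distrib sum_subtractf)
  then show ?thesis
    unfolding lap_def sum.distrib 1 2 by simp
qed

section \<open>The volume density\<close>

definition vol :: "real^'m \<Rightarrow> real" where
  "vol x = sqrt (det (g x))"

lemma smooth_det_g: "smooth_on U (\<lambda>x. det (g x))"
  by (rule smooth_on_det[OF open_U smooth_g])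

lemma det_g_pos: "x \<in> U \<Longrightarrow> det (g x) > 0"
  using posdef_g posdef_det_pos by blast

lemma vol_pos: "x \<in> U \<Longrightarrow> vol x > 0"
  by (simp add: vol_def det_g_pos)

lemma smooth_vol: "smooth_on U vol"
  unfolding vol_def[abs_def] by (intro smooth_on_sqrt[OF open_U] smooth_det_g det_g_pos)

lemma partial_vol:
  assumes x: "x \<in> U"
  shows "partial k vol x = vol x * log_det_deriv k x / 2"
proof -
  define H where "H = frechet_derivative g (at x) (axis k 1)"
  have H: "H $ i $ j = partial k (\<lambda>y. g y $ i $ j) x" for i j
    using partial_bounded_linear[OF bounded_linear_compose[OF bounded_linear_vec_nth bounded_linear_vec_nth]
      smooth_g x, of k i j] by (simp add: H_def partial_def)
  have "((\<lambda>y. det (g y)) has_derivative (\<lambda>v. det_deriv (g x) (frechet_derivative g (at x) v))) (at x)"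
    by (rule has_derivative_compose[OF smooth_on_has_derivative[OF smooth_g x] det_has_derivative])
  from has_derivative_real_sqrt[OF det_g_pos[OF x] this]
  have "partial k vol x = det_deriv (g x) H / sqrt (det (g x)) / 2"
    unfolding vol_def[abs_def] by (subst has_derivative_partial) (auto simp: H_def field_simps)
  also have "det_deriv (g x) H = det (g x) * trace (G x ** H)"
    by (rule det_deriv_invertible[OF invertible_g[OF x]])
  also have "trace (G x ** H) = log_det_deriv k x"
    unfolding trace_def matrix_matrix_mult_def log_det_deriv_def
    by (simp add: H partial_g_sym[OF x, of k])
  finally have "partial k vol x = (det (g x) / sqrt (det (g x))) * log_det_deriv k x / 2"
    by simp
  then show ?thesis
    using det_g_pos[OF x] by (simp add: vol_def real_div_sqrt)
qed

text \<open>By \<open>partial_vol\<close>, the derivative of the density supplies the Christoffel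
  trace. So \<open>vol\<close> times the divergence of the field h grad f is an ordinary coordinate
  divergence, which Lebesgue integration can handle.\<close>

lemma weighted_divergence:
  assumes f: "smooth_on U f" and h: "smooth_on U h" and x: "x \<in> U"
  shows "(\<Sum>i\<in>UNIV. partial i (\<lambda>y. vol y * h y * grad g f i y) x) =
    vol x * (h x * lap g f x + (\<Sum>i\<in>UNIV. grad g f i x * partial i h x))"
proof -
  note vh = smooth_on_mult[OF open_U smooth_vol h]
  have "partial i (\<lambda>y. vol y * h y * grad g f i y) x =
      vol x * h x * partial i (grad g f i) x +
      (vol x * partial i h x + vol x * log_det_deriv i x / 2 * h x) * grad g f i x" for i
    by (simp add: partial_mult[OF vh smooth_grad[OF f] x] partial_mult[OF smooth_vol h x] partial_vol[OF x])
  then have "(\<Sum>i\<in>UNIV. partial i (\<lambda>y. vol y * h y * grad g f i y) x) =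
      vol x * (h x * ((\<Sum>i\<in>UNIV. partial i (grad g f i) x) + (\<Sum>i\<in>UNIV. log_det_deriv i x / 2 * grad g f i x))
       + (\<Sum>i\<in>UNIV. grad g f i x * partial i h x))"
    by (simp add: sum.distrib sum_distrib_left distrib_left algebra_simps)
  also have "(\<Sum>i\<in>UNIV. log_det_deriv i x / 2 * grad g f i x) =
      (\<Sum>i\<in>UNIV. \<Sum>k\<in>UNIV. chris g i i k x * grad g f k x)"
    by (subst sum.swap) (simp add: sum_distrib_right[symmetric] chris_trace[OF x])
  finally show ?thesis
    by (simp add: lap_divergence_form[OF f x] sum.distrib)
qed

end

section \<open>Isometric immersions in coordinates\<close>

locale immersion_chart = metric_chart U g for U :: "(real^'m::finite) set" and g +
  fixes \<psi> :: "real^'m \<Rightarrow> real^'n::finite"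
  assumes smooth_psi: "smooth_on U \<psi>"
    and g_eq: "x \<in> U \<Longrightarrow> g x $ i $ j = partial i \<psi> x \<bullet> partial j \<psi> x"
begin

lemma partial_g_eq:
  assumes x: "x \<in> U"
  shows "partial k (\<lambda>y. g y $ i $ j) x =
    partial i \<psi> x \<bullet> partial k (partial j \<psi>) x + partial k (partial i \<psi>) x \<bullet> partial j \<psi> x"
  using partial_cong[OF open_U x, of "\<lambda>y. g y $ i $ j" "\<lambda>y. partial i \<psi> y \<bullet> partial j \<psi> y" k] g_eq
    partial_inner[OF smooth_on_partial[OF smooth_psi] smooth_on_partial[OF smooth_psi] x]
  by simp

text \<open>The product rule on \<open>g_eq\<close> writes \<open>contr\<close> and
  \<open>log_det_deriv\<close> through second derivatives of \<open>\<psi>\<close>. By their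
  symmetry, \<open>contr k x - log_det_deriv k x / 2\<close> reduces to the trace of
  \<open>A i j \<bullet> P k\<close>: the first-order part of \<open>lap\<close> removes exactly the
  tangential part of the second-order one.\<close>

lemma lap_normal:
  assumes x: "x \<in> U"
  shows "lap g \<psi> x \<bullet> partial k \<psi> x = 0"
proof -
  define A where "A i j = partial i (partial j \<psi>) x" for i j
  define P where "P j = partial j \<psi> x" for j
  have A_sym: "A i j = A j i" for i j
    unfolding A_def by (rule partial_commute[OF open_U smooth_psi x])
  have "(\<Sum>l\<in>UNIV. lap_coeff g l x * g x $ l $ k) =
      (\<Sum>l\<in>UNIV. \<Sum>a\<in>UNIV. g x $ k $ l * G x $ l $ a * (contr a x - log_det_deriv a x / 2))"
    unfolding lap_coeff_eq[OF x] sum_distrib_right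
    by (simp add: g_sym[OF x, of _ k] mult_ac)
  also have "\<dots> = (\<Sum>a\<in>UNIV. (\<Sum>l\<in>UNIV. g x $ k $ l * G x $ l $ a) * (contr a x - log_det_deriv a x / 2))"
    by (subst sum.swap) (simp add: sum_distrib_right)
  also have "\<dots> = contr k x - log_det_deriv k x / 2"
    by (simp add: g_G[OF x] if_distribR if_distrib[of "\<lambda>u. u * _"] cong: if_cong)
  also have "contr k x = (\<Sum>i\<in>UNIV. \<Sum>j\<in>UNIV. G x $ i $ j * (P j \<bullet> A i k + A i j \<bullet> P k))"
    unfolding contr_def partial_g_eq[OF x] A_def P_def ..
  also have "log_det_deriv k x = (\<Sum>i\<in>UNIV. \<Sum>j\<in>UNIV. G x $ i $ j * (P i \<bullet> A k j + A k i \<bullet> P j))"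
    unfolding log_det_deriv_def partial_g_eq[OF x] A_def P_def ..
  also have "\<dots> = (\<Sum>i\<in>UNIV. \<Sum>j\<in>UNIV. G x $ i $ j * (P i \<bullet> A k j)) + (\<Sum>i\<in>UNIV. \<Sum>j\<in>UNIV. G x $ i $ j * (P j \<bullet> A i k))"
    by (simp add: distrib_left sum.distrib inner_commute A_sym[of k])
  also have "(\<Sum>i\<in>UNIV. \<Sum>j\<in>UNIV. G x $ i $ j * (P i \<bullet> A k j)) = (\<Sum>i\<in>UNIV. \<Sum>j\<in>UNIV. G x $ i $ j * (P j \<bullet> A i k))"
    by (subst sum.swap) (simp add: G_sym[OF x] A_sym[of k])
  finally have "(\<Sum>l\<in>UNIV. lap_coeff g l x * g x $ l $ k) = (\<Sum>i\<in>UNIV. \<Sum>j\<in>UNIV. G x $ i $ j * (A i j \<bullet> P k))"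
    by (simp add: distrib_left sum.distrib)
  then show ?thesis
    unfolding lap_def
    by (simp add: inner_diff_left inner_sum_left g_eq[OF x] A_def P_def)
qed

text \<open>Apply the Laplacian to the constant \<open>\<psi> \<bullet> \<psi>\<close>. The gradient
  term of the product rule is the trace of \<open>G g\<close>, which is the dimension.\<close>

lemma lap_radial:
  assumes x: "x \<in> U" and sph: "\<And>y. y \<in> U \<Longrightarrow> \<psi> y \<bullet> \<psi> y = 1"
  shows "lap g \<psi> x \<bullet> \<psi> x = - real CARD('m)"
proof -
  have "lap g (\<lambda>y. \<psi> y \<bullet> \<psi> y) x = lap g (\<lambda>y. 1::real) x"
    using sph by (intro lap_cong_open[OF open_U x]) auto
  also have "\<dots> = 0"
    by (simp add: lap_def partial_const[abs_def])
  finally have "0 = lap g (\<lambda>y. \<psi> y \<bullet> \<psi> y) x" ..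
  also have "\<dots> = 2 * (lap g \<psi> x \<bullet> \<psi> x) + 2 * (\<Sum>i\<in>UNIV. \<Sum>j\<in>UNIV. G x $ i $ j * g x $ j $ i)"
    by (simp add: lap_bilinear[OF bounded_bilinear_inner smooth_psi smooth_psi x] g_eq[OF x] inner_commute)
  finally show ?thesis
    by (simp add: G_g[OF x])
qed

end

section \<open>Change of charts\<close>

lemma partial_compose:
  assumes W: "open W" and T: "smooth_on W T" "T ` W \<subseteq> U" and F: "smooth_on U F" and y: "y \<in> W"
  shows "partial j (\<lambda>z. F (T z)) y = (\<Sum>a\<in>UNIV. (partial j T y $ a) *\<^sub>R partial a F (T y))"
proof -
  have FT: "(F has_derivative frechet_derivative F (at (T y))) (at (T y))"
    using smooth_on_has_derivative[OF F] T(2) y by auto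
  have "((\<lambda>z. F (T z)) has_derivative (\<lambda>v. frechet_derivative F (at (T y)) (frechet_derivative T (at y) v))) (at y)"
    by (rule has_derivative_compose[OF smooth_on_has_derivative[OF T(1) y] FT])
  from has_derivative_partial[OF this, of j]
  have "partial j (\<lambda>z. F (T z)) y = frechet_derivative F (at (T y)) (partial j T y)"
    by (simp only: partial_def[of j T])
  also have "\<dots> = (\<Sum>a\<in>UNIV. (partial j T y $ a) *\<^sub>R partial a F (T y))"
    by (rule frechet_derivative_partial[OF FT])
  finally show ?thesis .
qed

text \<open>
  The two Laplacians differ by a first-order term \<open>Z\<close> that does not depend on the function.  Applied
  to the immersion itself, \<open>Z\<close> gives a tangential vector, while both Laplacians are normal: \<open>Z = 0\<close>.
\<close>

lemma lap_change_of_chart: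
  fixes \<psi>1 \<psi>2 :: "real^'m::finite \<Rightarrow> real^'n::finite"
    and F :: "real^'m \<Rightarrow> 'b::real_normed_vector"
  assumes 1: "immersion_chart U1 g1 \<psi>1" and 2: "immersion_chart U2 g2 \<psi>2"
    and W: "open W" "W \<subseteq> U1" and T: "smooth_on W T" "T ` W \<subseteq> U2"
    and psi: "\<And>y. y \<in> W \<Longrightarrow> \<psi>1 y = \<psi>2 (T y)"
    and F: "smooth_on U2 F" and x: "x \<in> W"
  shows "lap g1 (\<lambda>y. F (T y)) x = lap g2 F (T x)"
proof -
  interpret c1: immersion_chart U1 g1 \<psi>1 by fact
  interpret c2: immersion_chart U2 g2 \<psi>2 by fact
  have x1: "x \<in> U1" and x2: "T x \<in> U2" using x W T by auto
  define J where "J y = (\<chi> a j. partial j T y $ a)" for y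
  have J: "J y $ a $ j = partial j T y $ a" for y a j by (simp add: J_def)
  have smJ: "smooth_on W (\<lambda>y. J y $ a $ j)" for a j
    unfolding J using smooth_on_partial[OF T(1)] smooth_on_componentwise[OF W(1)] by blast
  have psi1: "partial i \<psi>1 y = (\<Sum>a\<in>UNIV. J y $ a $ i *\<^sub>R partial a \<psi>2 (T y))" if "y \<in> W" for i y
    using partial_cong[OF W(1) that, of \<psi>1 "\<lambda>z. \<psi>2 (T z)" i] psi
      partial_compose[OF W(1) T c2.smooth_psi that] by (simp add: J)
  have g1: "g1 x = transpose (J x) ** g2 (T x) ** J x"
  proof -
    have "g1 x $ i $ j = (\<Sum>b\<in>UNIV. \<Sum>a\<in>UNIV. J x $ b $ j * (J x $ a $ i * g2 (T x) $ a $ b))" for i j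
      unfolding c1.g_eq[OF x1] psi1[OF x] c2.g_eq[OF x2]
      by (simp add: inner_sum_left inner_sum_right sum_distrib_left inner_commute mult.left_commute)
    then show ?thesis
      by (simp add: vec_eq_iff matrix_matrix_mult_def transpose_def sum_distrib_left mult_ac)
  qed
  \<comment> \<open>Invertibility of the Jacobian is read off the determinants in \<open>g1\<close>,
    without an inverse map of \<open>T\<close>.\<close>
  have invJ: "invertible (J x)"
    using c1.invertible_g[OF x1] unfolding g1 invertible_det_nz det_mul by auto
  \<comment> \<open>Towards \<open>c2.G = J ** c1.G ** transpose J\<close>: insert the formula for
    \<open>g1\<close> into \<open>c1.G ** g1 = mat 1\<close>, then cancel \<open>J\<close> on the
    right and multiply by \<open>c2.G\<close>.\<close>
  have "J x ** c1.G x ** transpose (J x) ** g2 (T x) ** J x = J x ** (c1.G x ** g1 x)"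
    unfolding g1 by (simp only: matrix_mul_assoc)
  also have "\<dots> = J x"
    by (simp add: matrix_inv_left_mult[OF c1.invertible_g[OF x1]])
  finally have "J x ** c1.G x ** transpose (J x) ** g2 (T x) ** (J x ** matrix_inv (J x)) = J x ** matrix_inv (J x)"
    by (simp only: matrix_mul_assoc)
  then have "J x ** c1.G x ** transpose (J x) ** g2 (T x) = mat 1"
    by (simp add: matrix_inv_right_mult[OF invJ])
  then have "J x ** c1.G x ** transpose (J x) ** (g2 (T x) ** c2.G (T x)) = c2.G (T x)"
    by (simp only: matrix_mul_assoc matrix_mul_lid)
  then have "c2.G (T x) = J x ** c1.G x ** transpose (J x)"
    by (simp add: matrix_inv_right_mult[OF c2.invertible_g[OF x2]])
  then have G2: "c2.G (T x) $ b $ a = (\<Sum>j\<in>UNIV. \<Sum>i\<in>UNIV. c1.G x $ i $ j * J x $ b $ i * J x $ a $ j)" for a b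
    by (simp add: matrix_matrix_mult_def transpose_def sum_distrib_left mult_ac)
  define Z where "Z a = (\<Sum>i\<in>UNIV. \<Sum>j\<in>UNIV. c1.G x $ i $ j * partial i (\<lambda>y. J y $ a $ j) x)
      - (\<Sum>k\<in>UNIV. lap_coeff g1 k x * J x $ a $ k) + lap_coeff g2 a (T x)" for a
  \<comment> \<open>Proved for an arbitrary target space, because it is applied both to
    \<open>F\<close> and to \<open>\<psi>2\<close>.\<close>
  have key: "lap g1 (\<lambda>y. F (T y)) x = lap g2 F (T x) + (\<Sum>a\<in>UNIV. Z a *\<^sub>R partial a F (T x))"
    if F: "smooth_on U2 F" for F :: "real^'m \<Rightarrow> 'c::real_normed_vector"
  proof -
    have p1: "partial j (\<lambda>z. F (T z)) y = (\<Sum>a\<in>UNIV. J y $ a $ j *\<^sub>R partial a F (T y))" if "y \<in> W" for j y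
      using partial_compose[OF W(1) T F that] by (simp add: J)
    have p2: "partial i (partial j (\<lambda>z. F (T z))) x =
        (\<Sum>a\<in>UNIV. \<Sum>b\<in>UNIV. (J x $ b $ i * J x $ a $ j) *\<^sub>R partial b (partial a F) (T x)) +
        (\<Sum>a\<in>UNIV. partial i (\<lambda>y. J y $ a $ j) x *\<^sub>R partial a F (T x))" for i j
    proof -
      have smF: "smooth_on W (\<lambda>y. partial a F (T y))" for a
        by (rule smooth_on_compose[OF W(1) c2.open_U T(2) smooth_on_partial[OF F] T(1)])
      have "partial i (partial j (\<lambda>z. F (T z))) x = partial i (\<lambda>y. \<Sum>a\<in>UNIV. J y $ a $ j *\<^sub>R partial a F (T y)) x"
        by (rule partial_cong[OF W(1) x]) (rule p1)
      also have "\<dots> = (\<Sum>a\<in>UNIV. partial i (\<lambda>y. J y $ a $ j *\<^sub>R partial a F (T y)) x)"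
        by (rule partial_sum[OF _ x]) (intro smooth_on_scaleR[OF W(1)] smJ smF)
      also have "\<dots> = (\<Sum>a\<in>UNIV. J x $ a $ j *\<^sub>R partial i (\<lambda>y. partial a F (T y)) x +
          partial i (\<lambda>y. J y $ a $ j) x *\<^sub>R partial a F (T x))"
        by (simp add: partial_scaleR[OF smJ smF x])
      also have "\<dots> = (\<Sum>a\<in>UNIV. J x $ a $ j *\<^sub>R (\<Sum>b\<in>UNIV. J x $ b $ i *\<^sub>R partial b (partial a F) (T x)) +
          partial i (\<lambda>y. J y $ a $ j) x *\<^sub>R partial a F (T x))"
        using partial_compose[OF W(1) T smooth_on_partial[OF F] x] by (simp add: J)
      finally show ?thesis
        by (simp add: sum.distrib scaleR_sum_right mult.commute)
    qed
    have "(\<Sum>i\<in>UNIV. \<Sum>j\<in>UNIV. c1.G x $ i $ j *\<^sub>R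
          (\<Sum>a\<in>UNIV. \<Sum>b\<in>UNIV. (J x $ b $ i * J x $ a $ j) *\<^sub>R partial b (partial a F) (T x))) =
        (\<Sum>i\<in>UNIV. \<Sum>j\<in>UNIV. \<Sum>a\<in>UNIV. \<Sum>b\<in>UNIV.
          (c1.G x $ i $ j * J x $ b $ i * J x $ a $ j) *\<^sub>R partial b (partial a F) (T x))"
      by (simp add: scaleR_sum_right mult.assoc)
    also have "\<dots> = (\<Sum>a\<in>UNIV. \<Sum>i\<in>UNIV. \<Sum>j\<in>UNIV. \<Sum>b\<in>UNIV.
          (c1.G x $ i $ j * J x $ b $ i * J x $ a $ j) *\<^sub>R partial b (partial a F) (T x))"
      by (rule sum_rotate)
    also have "\<dots> = (\<Sum>a\<in>UNIV. \<Sum>b\<in>UNIV. \<Sum>i\<in>UNIV. \<Sum>j\<in>UNIV.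
          (c1.G x $ i $ j * J x $ b $ i * J x $ a $ j) *\<^sub>R partial b (partial a F) (T x))"
      by (intro sum.cong[OF refl] sum_rotate)
    also have "\<dots> = (\<Sum>a\<in>UNIV. \<Sum>b\<in>UNIV. c2.G (T x) $ b $ a *\<^sub>R partial b (partial a F) (T x))"
      unfolding G2 scaleR_sum_left by (intro sum.cong[OF refl] sum.swap)
    also have "\<dots> = (\<Sum>b\<in>UNIV. \<Sum>a\<in>UNIV. c2.G (T x) $ b $ a *\<^sub>R partial b (partial a F) (T x))"
      by (rule sum.swap)
    finally have e1: "(\<Sum>i\<in>UNIV. \<Sum>j\<in>UNIV. c1.G x $ i $ j *\<^sub>R
          (\<Sum>a\<in>UNIV. \<Sum>b\<in>UNIV. (J x $ b $ i * J x $ a $ j) *\<^sub>R partial b (partial a F) (T x))) =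
        (\<Sum>b\<in>UNIV. \<Sum>a\<in>UNIV. c2.G (T x) $ b $ a *\<^sub>R partial b (partial a F) (T x))" .
    have e2: "(\<Sum>i\<in>UNIV. \<Sum>j\<in>UNIV. c1.G x $ i $ j *\<^sub>R (\<Sum>a\<in>UNIV. partial i (\<lambda>y. J y $ a $ j) x *\<^sub>R partial a F (T x)))
        = (\<Sum>a\<in>UNIV. (\<Sum>i\<in>UNIV. \<Sum>j\<in>UNIV. c1.G x $ i $ j * partial i (\<lambda>y. J y $ a $ j) x) *\<^sub>R partial a F (T x))"
      unfolding scaleR_sum_right scaleR_sum_left scaleR_scaleR by (rule sum_rotate)
    have e3: "(\<Sum>k\<in>UNIV. lap_coeff g1 k x *\<^sub>R (\<Sum>a\<in>UNIV. J x $ a $ k *\<^sub>R partial a F (T x))) =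
        (\<Sum>a\<in>UNIV. (\<Sum>k\<in>UNIV. lap_coeff g1 k x * J x $ a $ k) *\<^sub>R partial a F (T x))"
      unfolding scaleR_sum_right scaleR_sum_left scaleR_scaleR by (rule sum.swap)
    show ?thesis
      unfolding lap_def p2 p1[OF x] scaleR_add_right sum.distrib e1 e2 e3 Z_def
      by (simp add: scaleR_add_left scaleR_diff_left sum.distrib sum_subtractf)
  qed
  define N where "N = (\<Sum>a\<in>UNIV. Z a *\<^sub>R partial a \<psi>2 (T x))"
  have N: "lap g1 \<psi>1 x = lap g2 \<psi>2 (T x) + N"
  proof -
    have "lap g1 \<psi>1 x = lap g1 (\<lambda>y. \<psi>2 (T y)) x"
      by (rule lap_cong_open[OF W(1) x]) (rule psi)
    then show ?thesis
      using key[OF c2.smooth_psi] by (simp add: N_def)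
  qed
  have "lap g2 \<psi>2 (T x) \<bullet> N = 0"
    unfolding N_def by (simp add: inner_sum_right c2.lap_normal[OF x2])
  moreover have "lap g1 \<psi>1 x \<bullet> N = 0"
  proof -
    \<comment> \<open>\<open>z\<close> is the vector \<open>Z\<close> in the coordinates of the
      first chart. It exhibits \<open>N\<close> as a combination of the derivatives of
      \<open>\<psi>1\<close>, so that \<open>lap_normal\<close> applies in the first chart as
      well.\<close>
    define z where "z = matrix_inv (J x) *v (\<chi> a. Z a)"
    have Jz: "J x *v z = (\<chi> a. Z a)"
      by (simp add: z_def matrix_vector_mul_assoc matrix_inv_right_mult[OF invJ])
    have "Z a = (\<Sum>i\<in>UNIV. J x $ a $ i * z $ i)" for a
      using arg_cong[OF Jz, of "\<lambda>v. v $ a"] by (simp add: matrix_vector_mult_def)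
    then have "N = (\<Sum>a\<in>UNIV. \<Sum>i\<in>UNIV. (J x $ a $ i * z $ i) *\<^sub>R partial a \<psi>2 (T x))"
      unfolding N_def by (simp add: scaleR_sum_left)
    also have "\<dots> = (\<Sum>i\<in>UNIV. z $ i *\<^sub>R partial i \<psi>1 x)"
      unfolding psi1[OF x] by (subst sum.swap) (simp add: scaleR_sum_right mult.commute)
    finally show ?thesis
      by (simp add: inner_sum_right c1.lap_normal[OF x1])
  qed
  ultimately have "N \<bullet> N = 0"
    unfolding N by (simp add: inner_add_left)
  \<comment> \<open>\<open>N \<bullet> N\<close> is the quadratic form of \<open>g2\<close> at
    \<open>Z\<close>, so definiteness of the metric gives \<open>Z = 0\<close>.\<close>
  then have "(\<Sum>a\<in>UNIV. \<Sum>b\<in>UNIV. Z a * (Z b * g2 (T x) $ a $ b)) = 0"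
    unfolding N_def by (simp add: inner_sum_left inner_sum_right c2.g_eq[OF x2] sum_distrib_left inner_commute
        mult.left_commute)
  then have "(\<chi> a. Z a) \<bullet> (g2 (T x) *v (\<chi> a. Z a)) = 0"
    by (simp add: inner_vec_def matrix_vector_mult_def sum_distrib_left mult_ac)
  then have "(\<chi> a. Z a) = 0"
    using c2.posdef_g[OF x2, of "\<chi> a. Z a"] by auto
  then have "Z a = 0" for a
    by (simp add: vec_eq_iff)
  then show ?thesis
    using key[OF F] by simp
qed

section \<open>Laplacian and tension field on the manifold\<close>

abbreviation chart_dom :: "('a, 'm::finite) chart \<Rightarrow> (real^'m) set" where
  "chart_dom c \<equiv> snd c ` fst c"

abbreviation chart_rep :: "('a, 'm::finite) chart \<Rightarrow> ('a \<Rightarrow> 'b) \<Rightarrow> real^'m \<Rightarrow> 'b" where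
  "chart_rep c f \<equiv> (\<lambda>x. f (chart_inv c x))"

lemma pd_eq_partial: "pd c i f p = partial i (chart_rep c f) (snd c p)"
  by (simp add: differential_def partial_def comp_def)

lemma smooth_map_def': "smooth_map M f \<longleftrightarrow> (\<forall>c\<in>atlas M. smooth_on (chart_dom c) (chart_rep c f))"
  by (simp add: smooth_map_def comp_def)

lemma smooth_mapD: "smooth_map M f \<Longrightarrow> c \<in> atlas M \<Longrightarrow> smooth_on (chart_dom c) (chart_rep c f)"
  unfolding smooth_map_def' by (rule bspec)

section \<open>Charts of the manifold\<close>

locale riemannian_immersion =
  fixes M :: "('a, 'm::finite) manifold_data" and \<phi> :: "'a \<Rightarrow> real^'n::finite"
  assumes rm: "riemannian_manifold M" and iso: "isometric_immersion M \<phi>"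
begin

lemma smooth_M: "smooth_manifold M"
  using rm by (simp add: riemannian_manifold_def)

lemma chart_subset: "c \<in> atlas M \<Longrightarrow> fst c \<subseteq> points M"
  using smooth_M by (auto simp: smooth_manifold_def)

lemma chart_openin: "c \<in> atlas M \<Longrightarrow> openin (topo M) (fst c)"
  using smooth_M by (auto simp: smooth_manifold_def)

lemma open_chart_dom: "c \<in> atlas M \<Longrightarrow> open (chart_dom c)"
  using smooth_M by (auto simp: smooth_manifold_def)

lemma chart_homeo:
  "c \<in> atlas M \<Longrightarrow> homeomorphic_map (subtopology (topo M) (fst c)) (top_of_set (chart_dom c)) (snd c)"
  using smooth_M by (auto simp: smooth_manifold_def)

lemma topspace_chart: "c \<in> atlas M \<Longrightarrow> topspace (subtopology (topo M) (fst c)) = fst c"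
  using chart_subset by (simp add: topspace_subtopology Int_absorb1)

lemma chart_inj: "c \<in> atlas M \<Longrightarrow> inj_on (snd c) (fst c)"
  using homeomorphic_imp_injective_map[OF chart_homeo] topspace_chart by simp

lemma chart_inv_chart: "c \<in> atlas M \<Longrightarrow> p \<in> fst c \<Longrightarrow> chart_inv c (snd c p) = p"
  unfolding chart_inv_def by (rule inv_into_f_f[OF chart_inj])

lemma chart_chart_inv: "x \<in> chart_dom c \<Longrightarrow> snd c (chart_inv c x) = x"
  unfolding chart_inv_def by (rule f_inv_into_f)

lemma chart_inv_in: "x \<in> chart_dom c \<Longrightarrow> chart_inv c x \<in> fst c"
  unfolding chart_inv_def by (rule inv_into_into)

lemma open_chart_image:
  assumes c: "c \<in> atlas M" and V: "openin (topo M) V"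
  shows "open (snd c ` (fst c \<inter> V))"
proof -
  have "openin (subtopology (topo M) (fst c)) (fst c \<inter> V)"
    using V openin_subtopology_Int2 by blast
  then have "openin (top_of_set (chart_dom c)) (snd c ` (fst c \<inter> V))"
    using homeomorphic_imp_open_map[OF chart_homeo[OF c]] by (simp add: open_map_def)
  then show ?thesis
    using open_chart_dom[OF c] openin_open_trans by blast
qed

lemma open_overlap: "c \<in> atlas M \<Longrightarrow> d \<in> atlas M \<Longrightarrow> open (snd c ` (fst c \<inter> fst d))"
  by (intro open_chart_image chart_openin)

lemma smooth_transition:
  "c \<in> atlas M \<Longrightarrow> d \<in> atlas M \<Longrightarrow> smooth_on (snd c ` (fst c \<inter> fst d)) (chart_rep c (snd d))"
  using smooth_M by (simp add: smooth_manifold_def comp_def)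

lemma chart_at:
  assumes "p \<in> points M"
  shows "chart_at M p \<in> atlas M \<and> p \<in> fst (chart_at M p)"
proof -
  have "p \<in> (\<Union>c\<in>atlas M. fst c)"
    using smooth_M assms by (simp add: smooth_manifold_def)
  then have "\<exists>c. c \<in> atlas M \<and> p \<in> fst c" by blast
  then show ?thesis
    unfolding chart_at_def by (rule someI_ex)
qed

lemma immersion_chart:
  assumes c: "c \<in> atlas M"
  shows "immersion_chart (chart_dom c) (chart_rep c (gmat M c)) (chart_rep c \<phi>)"
proof
  show "open (chart_dom c)" by (rule open_chart_dom[OF c])
  show "smooth_on (chart_dom c) (chart_rep c (gmat M c))"
    using rm c by (simp add: riemannian_manifold_def comp_def)
  show "smooth_on (chart_dom c) (chart_rep c \<phi>)"
    using iso c by (simp add: isometric_immersion_def smooth_map_def')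
  fix x assume x: "x \<in> chart_dom c"
  note p = chart_inv_in[OF x]
  show "transpose (gmat M c (chart_inv c x)) = gmat M c (chart_inv c x)"
    using rm c p by (simp add: riemannian_manifold_def)
  show "0 < v \<bullet> (gmat M c (chart_inv c x) *v v)" if "v \<noteq> 0" for v
    using rm c p that by (simp add: riemannian_manifold_def)
  fix i j
  have "axis i 1 \<bullet> (gmat M c (chart_inv c x) *v axis j 1) = gmat M c (chart_inv c x) $ i $ j"
    by (simp add: inner_axis' matrix_vector_mult_basis column_def)
  moreover have "axis i 1 \<bullet> (gmat M c (chart_inv c x) *v axis j 1) =
      pd c i \<phi> (chart_inv c x) \<bullet> pd c j \<phi> (chart_inv c x)"
    using iso c p by (simp add: isometric_immersion_def)
  ultimately show "gmat M c (chart_inv c x) $ i $ j =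
      partial i (chart_rep c \<phi>) x \<bullet> partial j (chart_rep c \<phi>) x"
    using chart_chart_inv[OF x] by (simp add: pd_eq_partial)
qed

lemma metric_chart: "c \<in> atlas M \<Longrightarrow> metric_chart (chart_dom c) (chart_rep c (gmat M c))"
  using immersion_chart immersion_chart.axioms(1) by blast

section \<open>The intrinsic operators in coordinates\<close>

lemma ginv_eq: "c \<in> atlas M \<Longrightarrow> p \<in> fst c \<Longrightarrow> ginv M c p = matrix_inv (chart_rep c (gmat M c) (snd c p))"
  by (simp add: ginv_def chart_inv_chart)

lemma christoffel_eq:
  "c \<in> atlas M \<Longrightarrow> p \<in> fst c \<Longrightarrow> christoffel M c k i j p = chris (chart_rep c (gmat M c)) k i j (snd c p)"
  by (simp add: christoffel_def chris_def ginv_eq pd_eq_partial)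

lemma lap_transition:
  assumes c: "c \<in> atlas M" and d: "d \<in> atlas M" and p: "p \<in> fst c" "p \<in> fst d"
    and f: "smooth_on (chart_dom d) (chart_rep d f)"
  shows "lap (chart_rep c (gmat M c)) (chart_rep c f) (snd c p) =
    lap (chart_rep d (gmat M d)) (chart_rep d f) (snd d p)"
proof -
  let ?W = "snd c ` (fst c \<inter> fst d)"
  have inv: "chart_inv d (snd d (chart_inv c y)) = chart_inv c y" if "y \<in> ?W" for y
    using that by (auto simp: chart_inv_chart c d)
  have x: "snd c p \<in> ?W" using p by blast
  have "lap (chart_rep c (gmat M c)) (\<lambda>y. chart_rep d f (snd d (chart_inv c y))) (snd c p) =
      lap (chart_rep d (gmat M d)) (chart_rep d f) (snd d (chart_inv c (snd c p)))"
    by (rule lap_change_of_chart[OF immersion_chart[OF c] immersion_chart[OF d] open_overlap[OF c d] _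
        smooth_transition[OF c d] _ _ f x])
      (auto simp: chart_inv_chart c d)
  moreover have "lap (chart_rep c (gmat M c)) (chart_rep c f) (snd c p) =
      lap (chart_rep c (gmat M c)) (\<lambda>y. chart_rep d f (snd d (chart_inv c y))) (snd c p)"
    by (rule lap_cong_open[OF open_overlap[OF c d] x]) (simp add: inv)
  ultimately show ?thesis
    by (simp add: chart_inv_chart[OF c p(1)])
qed

text \<open>For the value at \<open>p\<close>, \<open>laplacian\<close> uses the chart chosen at
  \<open>p\<close> for the gradient at all nearby points too, so the computation stays in this
  single chart.\<close>

lemma laplacian_chart_at:
  assumes f: "smooth_map M f" and p: "p \<in> points M" and d: "d = chart_at M p"
  shows "laplacian M f p = lap (chart_rep d (gmat M d)) (chart_rep d f) (snd d p)"
proof -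
  have dM: "d \<in> atlas M" "p \<in> fst d" using chart_at[OF p] d by auto
  interpret d: metric_chart "chart_dom d" "chart_rep d (gmat M d)"
    by (rule metric_chart[OF dM(1)])
  have x: "snd d p \<in> chart_dom d" using dM by blast
  have sf: "smooth_on (chart_dom d) (chart_rep d f)"
    by (rule smooth_mapD[OF f dM(1)])
  have grad: "gradient M d f q $ i = grad (chart_rep d (gmat M d)) (chart_rep d f) i (snd d q)" if "q \<in> fst d" for q i
    using dM that by (simp add: gradient_def grad_def ginv_eq pd_eq_partial)
  have "pd d i (\<lambda>q. gradient M d f q $ i) p =
      partial i (grad (chart_rep d (gmat M d)) (chart_rep d f) i) (snd d p)" for i
    unfolding pd_eq_partial
    by (rule partial_cong[OF d.open_U x]) (simp add: grad chart_inv_in chart_chart_inv)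
  then show ?thesis
    unfolding laplacian_def d[symmetric] divergence_def d.lap_divergence_form[OF sf x]
    using dM by (simp add: grad christoffel_eq)
qed

text \<open>Removes the pointwise choice made by \<open>chart_at\<close>: one chart \<open>c\<close>
  now computes the Laplacian at all of its points. Smoothness of the result, and hence iteration of
  the operator, rest on this.\<close>

lemma vec_laplacian_chart:
  assumes f: "smooth_map M f" and c: "c \<in> atlas M" and p: "p \<in> fst c"
  shows "vec_laplacian M f p = lap (chart_rep c (gmat M c)) (chart_rep c f) (snd c p)"
proof -
  have pM: "p \<in> points M" using c p chart_subset by blast
  define d where "d = chart_at M p"
  have d: "d \<in> atlas M" "p \<in> fst d" using chart_at[OF pM] d_def by auto
  interpret d: metric_chart "chart_dom d" "chart_rep d (gmat M d)"
    by (rule metric_chart[OF d(1)])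
  have sf: "smooth_on (chart_dom d) (chart_rep d f)"
    by (rule smooth_mapD[OF f d(1)])
  have comp: "smooth_map M (\<lambda>q. f q $ a)" for a
    unfolding smooth_map_def'
  proof
    fix e assume e: "e \<in> atlas M"
    show "smooth_on (chart_dom e) (chart_rep e (\<lambda>q. f q $ a))"
      by (rule smooth_on_bounded_linear[OF open_chart_dom[OF e] bounded_linear_vec_nth smooth_mapD[OF f e]])
  qed
  have "vec_laplacian M f p $ a = lap (chart_rep d (gmat M d)) (chart_rep d f) (snd d p) $ a" for a
    using laplacian_chart_at[OF comp pM d_def, of a]
      d.lap_bounded_linear[OF bounded_linear_vec_nth sf, of "snd d p" a] d
    by (simp add: vec_laplacian_def)
  then show ?thesis
    using lap_transition[OF c d(1) p d(2) sf] by (simp add: vec_eq_iff)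
qed

lemma chart_rep_vec_laplacian:
  assumes "smooth_map M f" "c \<in> atlas M" "x \<in> chart_dom c"
  shows "vec_laplacian M f (chart_inv c x) = lap (chart_rep c (gmat M c)) (chart_rep c f) x"
  using vec_laplacian_chart[OF assms(1,2) chart_inv_in[OF assms(3)]] by (simp add: chart_chart_inv[OF assms(3)])

lemma smooth_map_vec_laplacian:
  assumes f: "smooth_map M f"
  shows "smooth_map M (vec_laplacian M f)"
  unfolding smooth_map_def'
proof
  fix c assume c: "c \<in> atlas M"
  have "smooth_on (chart_dom c) (lap (chart_rep c (gmat M c)) (chart_rep c f))"
    by (rule metric_chart.smooth_lap[OF metric_chart[OF c] smooth_mapD[OF f c]])
  then show "smooth_on (chart_dom c) (chart_rep c (vec_laplacian M f))"
    by (subst smooth_on_cong[OF open_chart_dom[OF c] chart_rep_vec_laplacian[OF f c]])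
qed

lemma linear_sphere_proj: "linear (sphere_proj y)"
  by (rule linearI) (simp_all add: sphere_proj_def inner_add_left algebra_simps)

text \<open>Since F has unit length, its derivatives are tangent to the sphere. The projection
  therefore fixes the Christoffel terms and can be pulled out of the whole trace. Isometry of
  \<open>F\<close> is not assumed, as the varied maps are not isometric in general.\<close>

lemma tension_eq:
  assumes F: "smooth_map M F" and sph: "F ` points M \<subseteq> sphere 0 1" and p: "p \<in> points M"
  shows "tension M F p = sphere_proj (F p) (vec_laplacian M F p)"
proof -
  define d where "d = chart_at M p"
  have d: "d \<in> atlas M" "p \<in> fst d" using chart_at[OF p] d_def by auto
  interpret d: metric_chart "chart_dom d" "chart_rep d (gmat M d)"
    by (rule metric_chart[OF d(1)])
  let ?g = "chart_rep d (gmat M d)" and ?F = "chart_rep d F"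
  have x: "snd d p \<in> chart_dom d" using d by blast
  have sF: "smooth_on (chart_dom d) ?F"
    by (rule smooth_mapD[OF F d(1)])
  have "?F y \<bullet> ?F y = 1" if "y \<in> chart_dom d" for y
  proof -
    have "F (chart_inv d y) \<in> sphere 0 1"
      using sph chart_inv_in[OF that] chart_subset[OF d(1)] by blast
    then show ?thesis by (simp add: dot_square_norm)
  qed
  then have "partial k (\<lambda>y. ?F y \<bullet> ?F y) (snd d p) = 0" for k
    using partial_cong[OF d.open_U x, of "\<lambda>y. ?F y \<bullet> ?F y" "\<lambda>_. 1" k] by (simp add: partial_const)
  then have "partial k ?F (snd d p) \<bullet> F p = 0" for k
    using partial_inner[OF sF sF x, of k] d by (simp add: inner_commute chart_inv_chart)
  then have tang: "sphere_proj (F p) (partial k ?F (snd d p)) = partial k ?F (snd d p)" for k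
    by (simp add: sphere_proj_def)
  have pd2: "pd d i (pd d j F) p = partial i (partial j ?F) (snd d p)" for i j
    by (subst pd_eq_partial, rule partial_cong[OF d.open_U x]) (simp add: pd_eq_partial chart_chart_inv)
  note L = linear_sphere_proj[of "F p"]
  have "tension M F p = (\<Sum>i\<in>UNIV. \<Sum>j\<in>UNIV. matrix_inv (?g (snd d p)) $ i $ j *\<^sub>R
      (sphere_proj (F p) (partial i (partial j ?F) (snd d p)) -
       (\<Sum>k\<in>UNIV. chris ?g k i j (snd d p) *\<^sub>R sphere_proj (F p) (partial k ?F (snd d p)))))"
    unfolding tension_def d_def[symmetric] Let_def second_ff_def pullback_deriv_def tang pd2
    using d by (simp add: ginv_eq christoffel_eq pd_eq_partial)
  also have "\<dots> = sphere_proj (F p) (\<Sum>i\<in>UNIV. \<Sum>j\<in>UNIV. matrix_inv (?g (snd d p)) $ i $ j *\<^sub>R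
      (partial i (partial j ?F) (snd d p) -
       (\<Sum>k\<in>UNIV. chris ?g k i j (snd d p) *\<^sub>R partial k ?F (snd d p))))"
    by (simp add: linear_sum[OF L] linear_scale[OF L] linear_diff[OF L])
  also have "(\<Sum>i\<in>UNIV. \<Sum>j\<in>UNIV. matrix_inv (?g (snd d p)) $ i $ j *\<^sub>R
      (partial i (partial j ?F) (snd d p) -
       (\<Sum>k\<in>UNIV. chris ?g k i j (snd d p) *\<^sub>R partial k ?F (snd d p)))) = lap ?g ?F (snd d p)"
  proof -
    have "(\<Sum>k\<in>UNIV. lap_coeff ?g k (snd d p) *\<^sub>R partial k ?F (snd d p)) =
        (\<Sum>i\<in>UNIV. \<Sum>j\<in>UNIV. \<Sum>k\<in>UNIV. (matrix_inv (?g (snd d p)) $ i $ j * chris ?g k i j (snd d p)) *\<^sub>R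
          partial k ?F (snd d p))"
      unfolding lap_coeff_def scaleR_sum_left by (rule sum_rotate[symmetric])
    then show ?thesis
      unfolding lap_def by (simp add: scaleR_diff_right scaleR_sum_right sum_subtractf)
  qed
  finally show ?thesis
    by (simp add: vec_laplacian_chart[OF F d])
qed

lemma mean_curvature_eq: "mean_curvature M F p = (1 / real CARD('m)) *\<^sub>R tension M F p"
  by (simp add: mean_curvature_def tension_def Let_def)

section \<open>Cut-off functions supported in one chart\<close>

lemma compactin_chart_inv:
  assumes c: "c \<in> atlas M" and K: "compact K" "K \<subseteq> chart_dom c"
  shows "compactin (topo M) (chart_inv c ` K)"
proof -
  have "snd c (chart_inv c x) = x" if "x \<in> K" for x
    using chart_chart_inv[of x c] K(2) that by auto
  then have "snd c ` (chart_inv c ` K) = K"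
    by (simp add: image_image)
  moreover have "chart_inv c ` K \<subseteq> fst c"
    using chart_inv_in[of _ c] K(2) by (auto simp: subset_iff)
  moreover have "compactin (top_of_set (chart_dom c)) K"
    using K by (simp add: compactin_subtopology)
  moreover have "chart_inv c ` K \<subseteq> points M"
    using chart_inv_in[of _ c] K(2) chart_subset[OF c] by (auto simp: subset_iff)
  ultimately have "compactin (subtopology (topo M) (fst c)) (chart_inv c ` K)"
    using homeomorphic_map_compactness_eq[OF chart_homeo[OF c], of "chart_inv c ` K"] topspace_chart[OF c]
    by simp
  then show ?thesis
    by (simp add: compactin_subtopology)
qed

definition manifold_bump :: "('a, 'm) chart \<Rightarrow> real^'m \<Rightarrow> real \<Rightarrow> 'a \<Rightarrow> real" where
  "manifold_bump c a r q = (if q \<in> fst c then bump a r (snd c q) else 0)"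

lemma manifold_bump_eq_0:
  assumes "c \<in> atlas M" "r > 0" "q \<notin> chart_inv c ` cball a r"
  shows "manifold_bump c a r q = 0"
proof (cases "q \<in> fst c")
  case True
  then have "snd c q \<notin> cball a r"
    using assms chart_inv_chart[OF assms(1) True] by (metis imageI)
  then show ?thesis
    using bump_eq_0[of "snd c q" a r] assms(2) by (simp add: manifold_bump_def)
qed (simp add: manifold_bump_def)

text \<open>The support lies in a compact set \<open>?K\<close> inside the chart, and compact sets
  are closed in a Hausdorff space. So the chart and the complement of \<open>?K\<close> form an open
  cover; on the first the function is a composition with the transition map, on the second it is
  0.\<close>

lemma smooth_manifold_bump:
  assumes c: "c \<in> atlas M" and r: "r > 0" and sub: "cball a r \<subseteq> chart_dom c"
  shows "smooth_map M (manifold_bump c a r)"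
  unfolding smooth_map_def'
proof
  fix d assume d: "d \<in> atlas M"
  let ?K = "chart_inv c ` cball a r"
  have "compactin (topo M) ?K" by (rule compactin_chart_inv[OF c _ sub]) simp
  then have "closedin (topo M) ?K"
    using smooth_M by (auto simp: smooth_manifold_def intro: compactin_imp_closedin)
  then have "openin (topo M) (points M - ?K)" by (simp add: openin_diff)
  then have openB: "open (snd d ` (fst d \<inter> (points M - ?K)))"
    by (rule open_chart_image[OF d])
  have A: "smooth_on (snd d ` (fst d \<inter> fst c)) (chart_rep d (manifold_bump c a r))"
  proof -
    have "smooth_on (snd d ` (fst d \<inter> fst c)) (\<lambda>x. bump a r (chart_rep d (snd c) x))"
      by (rule smooth_on_compose[OF open_overlap[OF d c] open_UNIV _ smooth_on_bump smooth_transition[OF d c]]) simp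
    then show ?thesis
      by (subst smooth_on_cong[OF open_overlap[OF d c], of _ "\<lambda>x. bump a r (chart_rep d (snd c) x)"])
        (auto simp: manifold_bump_def chart_inv_chart[OF d])
  qed
  have B: "smooth_on (snd d ` (fst d \<inter> (points M - ?K))) (chart_rep d (manifold_bump c a r))"
    by (subst smooth_on_cong[OF openB, of _ "\<lambda>_. 0"])
      (auto simp: chart_inv_chart[OF d] manifold_bump_eq_0[OF c r] smooth_on_const)
  have "?K \<subseteq> fst c" using chart_inv_in[of _ c] sub by (auto simp: subset_iff)
  then have cover: "x \<in> snd d ` (fst d \<inter> fst c) \<or> x \<in> snd d ` (fst d \<inter> (points M - ?K))" if "x \<in> chart_dom d" for x
    using that chart_subset[OF d] by blast
  show "smooth_on (chart_dom d) (chart_rep d (manifold_bump c a r))"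
  proof (rule smooth_on_open_cover)
    fix x assume "x \<in> chart_dom d"
    from cover[OF this]
    show "\<exists>T. open T \<and> x \<in> T \<and> smooth_on T (chart_rep d (manifold_bump c a r))"
      using A B openB open_overlap[OF d c] by (elim disjE) (intro exI conjI; assumption)+
  qed
qed

end

section \<open>Integrals of families with a first-order expansion\<close>

text \<open>
  The derivative of the bienergy is needed only at \<open>t = 0\<close>; a remainder of second order that is
  jointly continuous on \<open>[-1, 1] \<times> B\<close> makes differentiation under the integral elementary.
\<close>

definition expands ::
  "'x::topological_space set \<Rightarrow> (real \<Rightarrow> 'x \<Rightarrow> 'b::real_normed_vector) \<Rightarrow> ('x \<Rightarrow> 'b) \<Rightarrow> ('x \<Rightarrow> 'b) \<Rightarrow> bool" where
  "expands B f a b \<longleftrightarrow> continuous_on B a \<and> continuous_on B b \<and>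
     (\<exists>r. continuous_on ({-1..1} \<times> B) r \<and>
       (\<forall>t\<in>{-1..1}. \<forall>x\<in>B. f t x = a x + t *\<^sub>R b x + t\<^sup>2 *\<^sub>R r (t, x)))"

lemma continuous_on_snd_times: "continuous_on B a \<Longrightarrow> continuous_on (T \<times> B) (\<lambda>z. a (snd z))"
  by (rule continuous_on_compose2[of B]) (auto intro: continuous_intros)

lemma expands_const: "continuous_on B a \<Longrightarrow> expands B (\<lambda>t. a) a (\<lambda>_. 0)"
  unfolding expands_def by (auto intro!: exI[of _ "\<lambda>_. 0"])

lemma expands_linear: "continuous_on B b \<Longrightarrow> expands B (\<lambda>t x. t *\<^sub>R b x) (\<lambda>_. 0) b"
  unfolding expands_def by (auto intro!: exI[of _ "\<lambda>_. 0"])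

lemma expands_quadratic:
  assumes "continuous_on ({-1..1} \<times> B) r"
  shows "expands B (\<lambda>t x. t\<^sup>2 *\<^sub>R r (t, x)) (\<lambda>_. 0) (\<lambda>_. 0)"
  unfolding expands_def using assms by (auto intro!: exI[of _ r])

lemma expands_add:
  assumes "expands B f a b" "expands B f' a' b'"
  shows "expands B (\<lambda>t x. f t x + f' t x) (\<lambda>x. a x + a' x) (\<lambda>x. b x + b' x)"
proof -
  obtain r r' where r: "continuous_on ({-1..1} \<times> B) r" "continuous_on ({-1..1} \<times> B) r'"
    "\<forall>t\<in>{-1..1}. \<forall>x\<in>B. f t x = a x + t *\<^sub>R b x + t\<^sup>2 *\<^sub>R r (t, x)"
    "\<forall>t\<in>{-1..1}. \<forall>x\<in>B. f' t x = a' x + t *\<^sub>R b' x + t\<^sup>2 *\<^sub>R r' (t, x)"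
    using assms by (auto simp: expands_def)
  show ?thesis
    using assms r unfolding expands_def
    by (auto intro!: continuous_intros exI[of _ "\<lambda>z. r z + r' z"] simp: algebra_simps)
qed

lemma expands_bilinear:
  assumes b: "bounded_bilinear p" and "expands B f a b" "expands B f' a' b'"
  shows "expands B (\<lambda>t x. p (f t x) (f' t x)) (\<lambda>x. p (a x) (a' x)) (\<lambda>x. p (a x) (b' x) + p (b x) (a' x))"
proof -
  interpret p: bounded_bilinear p by fact
  obtain r r' where r: "continuous_on ({-1..1} \<times> B) r" "continuous_on ({-1..1} \<times> B) r'"
    "\<forall>t\<in>{-1..1}. \<forall>x\<in>B. f t x = a x + t *\<^sub>R b x + t\<^sup>2 *\<^sub>R r (t, x)"
    "\<forall>t\<in>{-1..1}. \<forall>x\<in>B. f' t x = a' x + t *\<^sub>R b' x + t\<^sup>2 *\<^sub>R r' (t, x)"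
    and c: "continuous_on B a" "continuous_on B b" "continuous_on B a'" "continuous_on B b'"
    using assms by (auto simp: expands_def)
  note cs = c[THEN continuous_on_snd_times[where T = "{-1..1::real}"]]
  \<comment> \<open>All contributions of order two to four in \<open>t\<close>, with
    \<open>t\<^sup>2\<close> divided out.\<close>
  define R where "R z = p (b (snd z)) (b' (snd z)) + p (a (snd z)) (r' z) + p (r z) (a' (snd z)) +
    fst z *\<^sub>R (p (b (snd z)) (r' z) + p (r z) (b' (snd z))) + (fst z)\<^sup>2 *\<^sub>R p (r z) (r' z)" for z
  have "continuous_on ({-1..1} \<times> B) R"
    unfolding R_def by (intro continuous_intros p.continuous_on cs r(1,2))
  moreover have "p (f t x) (f' t x) =
      p (a x) (a' x) + t *\<^sub>R (p (a x) (b' x) + p (b x) (a' x)) + t\<^sup>2 *\<^sub>R R (t, x)"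
    if "t \<in> {-1..1}" "x \<in> B" for t x
    using r(3,4) that
    by (simp add: R_def p.add_left p.add_right p.scaleR_left p.scaleR_right scaleR_add_right power2_eq_square)
  ultimately show ?thesis
    unfolding expands_def using c by (auto intro!: continuous_intros p.continuous_on exI[of _ R])
qed

lemma expands_cong:
  assumes "expands B f a b"
    and "\<And>t x. t \<in> {-1..1} \<Longrightarrow> x \<in> B \<Longrightarrow> f t x = f' t x"
    and "\<And>x. x \<in> B \<Longrightarrow> a x = a' x" "\<And>x. x \<in> B \<Longrightarrow> b x = b' x"
  shows "expands B f' a' b'"
proof -
  have "continuous_on B a'" "continuous_on B b'"
    using assms(1,3,4) by (auto simp: expands_def cong: continuous_on_cong)
  moreover obtain r where "continuous_on ({-1..1} \<times> B) r"
     "\<forall>t\<in>{-1..1}. \<forall>x\<in>B. f t x = a x + t *\<^sub>R b x + t\<^sup>2 *\<^sub>R r (t, x)"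
    using assms(1) by (auto simp: expands_def)
  ultimately show ?thesis
    unfolding expands_def using assms(2-4) by (auto intro!: exI[of _ r])
qed

lemma expands_continuous:
  assumes "expands B f a b" "t \<in> {-1..1}"
  shows "continuous_on B (f t)"
proof -
  obtain r where r: "continuous_on ({-1..1} \<times> B) r"
     "\<forall>t\<in>{-1..1}. \<forall>x\<in>B. f t x = a x + t *\<^sub>R b x + t\<^sup>2 *\<^sub>R r (t, x)"
    and ab: "continuous_on B a" "continuous_on B b"
    using assms(1) by (auto simp: expands_def)
  have "continuous_on B (\<lambda>x. r (t, x))"
    by (rule continuous_on_compose2[OF r(1)]) (use assms(2) in \<open>auto intro!: continuous_intros\<close>)
  then have "continuous_on B (\<lambda>x. a x + t *\<^sub>R b x + t\<^sup>2 *\<^sub>R r (t, x))"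
    using ab by (intro continuous_intros)
  then show ?thesis
    using r(2) assms(2) by (simp cong: continuous_on_cong)
qed

lemma expands_inverse_sqrt:
  assumes \<rho>: "continuous_on B \<rho>" "\<And>x. x \<in> B \<Longrightarrow> \<rho> x \<ge> 0"
  shows "expands B (\<lambda>t x. inverse (sqrt (1 + t\<^sup>2 * \<rho> x))) (\<lambda>_. 1) (\<lambda>_. 0)"
proof -
  \<comment> \<open>With \<open>q = sqrt (1 + t\<^sup>2 * \<rho> x)\<close> one has
    \<open>1/q - 1 = (1 - q\<^sup>2) / (q * (1 + q))\<close>. The numerator is
    \<open>- t\<^sup>2 * \<rho> x\<close>, so the remainder needs no division by \<open>t\<close>
    and is continuous at \<open>t = 0\<close>.\<close>
  define r where "r z = - \<rho> (snd z) / (sqrt (1 + (fst z)\<^sup>2 * \<rho> (snd z)) * (1 + sqrt (1 + (fst z)\<^sup>2 * \<rho> (snd z))))"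
    for z
  have pos: "1 + t\<^sup>2 * \<rho> x > 0" if "x \<in> B" for t x
    using \<rho>(2)[OF that] by (simp add: add_pos_nonneg)
  have ne: "1 + t\<^sup>2 * \<rho> x \<noteq> 0" "1 + sqrt (1 + t\<^sup>2 * \<rho> x) \<noteq> 0" if "x \<in> B" for t x
    using pos[OF that, of t] real_sqrt_gt_zero[OF pos[OF that, of t]] by linarith+
  have "continuous_on ({-1..1} \<times> B) r"
    unfolding r_def by (intro continuous_intros continuous_on_snd_times \<rho>) (auto simp: ne)
  moreover have "inverse (sqrt (1 + t\<^sup>2 * \<rho> x)) = 1 + t\<^sup>2 * r (t, x)" if "x \<in> B" for t x
  proof -
    define q where "q = sqrt (1 + t\<^sup>2 * \<rho> x)"
    have q: "q > 0" "q * q = 1 + t\<^sup>2 * \<rho> x" using pos[OF that, of t] by (auto simp: q_def)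
    have "1 + t\<^sup>2 * r (t, x) = 1 - (q * q - 1) / (q * (1 + q))"
      by (simp add: r_def q_def[symmetric] q(2))
    also have "\<dots> = inverse q"
      using q(1) by (simp add: divide_simps) (simp add: algebra_simps)
    finally show ?thesis by (simp add: q_def)
  qed
  ultimately show ?thesis
    unfolding expands_def by (auto intro!: exI[of _ r])
qed

section \<open>Differentiation under the integral and strict positivity\<close>

lemma set_integrable_compact:
  fixes f :: "'a::euclidean_space \<Rightarrow> real"
  assumes "compact B" "continuous_on B f"
  shows "set_integrable lborel B f"
  using borel_integrable_compact[OF assms] by (simp add: set_integrable_def)

lemma expands_integral_derivative:
  fixes f :: "real \<Rightarrow> 'x::euclidean_space \<Rightarrow> real"
  assumes B: "compact B" and f: "expands B f a b" and w: "continuous_on B w"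
  shows "((\<lambda>t. LINT x:B|lborel. w x * f t x) has_real_derivative (LINT x:B|lborel. w x * b x)) (at 0)"
proof -
  obtain r where r: "continuous_on ({-1..1} \<times> B) r"
    and eq: "\<And>t x. t \<in> {-1..1} \<Longrightarrow> x \<in> B \<Longrightarrow> f t x = a x + t *\<^sub>R b x + t\<^sup>2 *\<^sub>R r (t, x)"
    and c: "continuous_on B a" "continuous_on B b"
    using f by (auto simp: expands_def)
  let ?I = "\<lambda>h. LINT x:B|lborel. w x * h x"
  define R where "R t = ?I (\<lambda>x. r (t, x))" for t
  have rt: "continuous_on B (\<lambda>x. r (t, x))" if "t \<in> {-1..1}" for t
    by (rule continuous_on_compose2[OF r]) (use that in \<open>auto intro!: continuous_intros\<close>)
  have int: "set_integrable lborel B (\<lambda>x. w x * h x)" if "continuous_on B h" for h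
    using w that by (intro set_integrable_compact[OF B] continuous_intros)
  have expand: "?I (f t) = ?I a + t * ?I b + t\<^sup>2 * R t" if t: "t \<in> {-1..1}" for t
  proof -
    have "?I (f t) = (LINT x:B|lborel. w x * a x + (t * (w x * b x) + t\<^sup>2 * (w x * r (t, x))))"
      using B t by (intro set_lebesgue_integral_cong) (auto simp: eq algebra_simps compact_imp_closed)
    also have "\<dots> = ?I a + (t * ?I b + t\<^sup>2 * R t)"
      using int[OF c(1)] int[OF c(2)] int[OF rt[OF t]]
      by (simp add: set_integral_add R_def)
    finally show ?thesis by simp
  qed
  \<comment> \<open>This is where joint continuity of the remainder matters: on the compact set
    \<open>{-1..1} \<times> B\<close> it is bounded uniformly in \<open>t\<close>, so its
    contribution to the difference quotient is at most a constant times
    \<open>\<bar>t\<bar>\<close>.\<close>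
  have "compact ((\<lambda>z. w (snd z) * r z) ` ({-1..1} \<times> B))"
    using B w r by (intro compact_continuous_image compact_Times continuous_intros continuous_on_snd_times) auto
  then obtain C where C: "C > 0" "\<And>t x. t \<in> {-1..1} \<Longrightarrow> x \<in> B \<Longrightarrow> \<bar>w x * r (t, x)\<bar> \<le> C"
    using compact_imp_bounded by (force simp: bounded_pos)
  define C' where "C' = (LINT x:B|lborel. C)"
  have R_bound: "\<bar>R t\<bar> \<le> C'" if t: "t \<in> {-1..1}" for t
  proof -
    have i1: "set_integrable lborel B (\<lambda>x. C)"
      by (intro set_integrable_compact[OF B] continuous_intros)
    have "norm (R t) \<le> (LINT x:B|lborel. norm (w x * r (t, x)))"
      unfolding R_def by (rule set_integral_norm_bound[OF int[OF rt[OF t]]])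
    also have "\<dots> \<le> C'"
      unfolding C'_def using C(2)[OF t] i1
      by (intro set_integral_mono set_integrable_norm int rt t) auto
    finally show ?thesis by simp
  qed
  have "((\<lambda>t. t * R t) \<longlongrightarrow> 0) (at 0)"
  proof (rule Lim_null_comparison)
    show "((\<lambda>t. \<bar>t\<bar> * C') \<longlongrightarrow> 0) (at 0)"
      by (auto intro!: tendsto_eq_intros)
    have "eventually (\<lambda>t. t \<in> {-1<..<1::real}) (at 0)"
      by (intro eventually_at_in_open') auto
    then show "eventually (\<lambda>t. norm (t * R t) \<le> \<bar>t\<bar> * C') (at 0)"
      by eventually_elim (auto simp: abs_mult intro!: mult_left_mono R_bound)
  qed
  then have lim: "((\<lambda>t. ?I b + t * R t) \<longlongrightarrow> ?I b) (at 0)"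
    using tendsto_add[OF tendsto_const[of "?I b"], of "\<lambda>t. t * R t" 0 "at 0"] by simp
  have "((\<lambda>t. (?I (f t) - ?I (f 0)) / (t - 0)) \<longlongrightarrow> ?I b) (at 0)"
  proof (rule Lim_transform_eventually[OF lim])
    have "eventually (\<lambda>t. t \<in> {-1<..<1::real} - {0}) (at 0)"
      by (intro eventually_at_in_open) auto
    then show "eventually (\<lambda>t. ?I b + t * R t = (?I (f t) - ?I (f 0)) / (t - 0)) (at 0)"
    proof eventually_elim
      case (elim t)
      then have "?I (f t) - ?I (f 0) = t * (?I b + t * R t)"
        using expand[of t] expand[of 0] by (simp add: power2_eq_square algebra_simps)
      then show ?case using elim by simp
    qed
  qed
  then show ?thesis
    by (simp add: has_field_derivative_iff)
qed

text \<open>A zero integral would force \<open>f = 0\<close> almost everywhere on \<open>B\<close>,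
  but \<open>f\<close> is positive on a nonempty open subset, which is not a null set.\<close>

lemma set_integral_continuous_pos:
  fixes f :: "'a::euclidean_space \<Rightarrow> real"
  assumes B: "compact B" and f: "continuous_on B f" and nonneg: "\<And>x. x \<in> B \<Longrightarrow> f x \<ge> 0"
    and a: "a \<in> interior B" "f a > 0"
  shows "(LINT x:B|lborel. f x) > 0"
proof -
  have int: "integrable lborel (\<lambda>x. indicator B x *\<^sub>R f x)"
    by (rule borel_integrable_compact[OF B f])
  have ge: "(LINT x:B|lborel. f x) \<ge> 0"
    unfolding set_lebesgue_integral_def using nonneg
    by (intro Bochner_Integration.integral_nonneg) (auto simp: indicator_def)
  moreover have "(LINT x:B|lborel. f x) \<noteq> 0"
  proof
    assume "(LINT x:B|lborel. f x) = 0"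
    then have "AE x in lborel. indicator B x *\<^sub>R f x = 0"
      unfolding set_lebesgue_integral_def
      by (subst (asm) integral_nonneg_eq_0_iff_AE[OF int]) (auto simp: indicator_def nonneg)
    moreover have "continuous_on (interior B) f"
      using f interior_subset continuous_on_subset by blast
    then have o: "open {x \<in> interior B. f x > 0}"
      using continuous_open_preimage[of "interior B" f "{0<..}"] by (simp add: vimage_def Int_def)
    ultimately have "AE x in lborel. x \<notin> {x \<in> interior B. f x > 0}"
      using interior_subset[of B] by (auto elim!: eventually_mono simp: indicator_def)
    then have "{x \<in> interior B. f x > 0} \<in> null_sets lborel"
      using o by (subst AE_iff_null_sets) auto
    then have "negligible {x \<in> interior B. f x > 0}"
      unfolding negligible_iff_null_sets by (rule null_sets_completionI)
    then show False
      using open_not_negligible[OF o] a by blast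
  qed
  ultimately show ?thesis by simp
qed

section \<open>Integration over a compact piece of a chart\<close>

context riemannian_immersion
begin

text \<open>Open sets generate \<open>sets \<mu>\<close>, and the preimage of an open set under the
  inverse chart is its chart image, which is open, cut down to \<open>B\<close>.\<close>

lemma measurable_chart_inv:
  assumes mu: "riemannian_measure M \<mu>" and c: "c \<in> atlas M" and B: "B \<subseteq> chart_dom c"
  shows "chart_inv c \<in> measurable (restrict_space borel B) \<mu>"
proof (rule measurable_sigma_sets)
  show "sets \<mu> = sigma_sets (points M) {U. openin (topo M) U}"
    using mu by (simp add: riemannian_measure_def)
  show "{U. openin (topo M) U} \<subseteq> Pow (points M)"
    using openin_subset by auto
  show "chart_inv c \<in> space (restrict_space borel B) \<rightarrow> points M"
  proof
    fix x assume "x \<in> space (restrict_space borel B)"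
    then have "x \<in> chart_dom c" using B by (auto simp: space_restrict_space)
    from chart_inv_in[OF this] chart_subset[OF c] show "chart_inv c x \<in> points M" by blast
  qed
  fix V assume "V \<in> {U. openin (topo M) U}"
  then have o: "open (snd c ` (fst c \<inter> V))"
    by (intro open_chart_image[OF c]) simp
  have eq: "chart_inv c -` V \<inter> space (restrict_space borel B) = snd c ` (fst c \<inter> V) \<inter> B"
  proof (intro equalityI subsetI)
    fix x assume "x \<in> chart_inv c -` V \<inter> space (restrict_space borel B)"
    then have x: "x \<in> B" "chart_inv c x \<in> V" "x \<in> chart_dom c"
      using B by (auto simp: space_restrict_space)
    have "snd c (chart_inv c x) \<in> snd c ` (fst c \<inter> V)"
      using chart_inv_in[OF x(3)] x(2) by (intro imageI) simp
    then show "x \<in> snd c ` (fst c \<inter> V) \<inter> B"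
      using x chart_chart_inv[OF x(3)] by simp
  next
    fix x assume "x \<in> snd c ` (fst c \<inter> V) \<inter> B"
    then show "x \<in> chart_inv c -` V \<inter> space (restrict_space borel B)"
      using chart_inv_chart[OF c] by (auto simp: space_restrict_space)
  qed
  show "chart_inv c -` V \<inter> space (restrict_space borel B) \<in> sets (restrict_space borel B)"
    unfolding eq sets_restrict_space
    by (rule image_eqI[of _ _ "snd c ` (fst c \<inter> V)"]) (rule Int_commute, rule borel_open[OF o])
qed

text \<open>\<open>riemannian_measure\<close> only gives the measure of sets inside a chart. This
  identifies \<mu>, restricted to the image \<open>K\<close> of \<open>B\<close>, with the
  push-forward of the Lebesgue measure on \<open>B\<close> weighted by the density. The integral
  formula is then a change of variables; \<open>f\<close> is known on \<open>K\<close> alone, where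
  it is \<open>h\<close> composed with the chart.\<close>

lemma chart_integral:
  fixes h :: "real^'m \<Rightarrow> real"
  assumes mu: "riemannian_measure M \<mu>" and c: "c \<in> atlas M"
    and B: "compact B" "B \<subseteq> chart_dom c" and h: "continuous_on B h"
    and f: "\<And>x. x \<in> B \<Longrightarrow> f (chart_inv c x) = h x"
  shows "(LINT p:chart_inv c ` B|\<mu>. f p) =
    (LINT x:B|lborel. sqrt (det (gmat M c (chart_inv c x))) * h x)"
proof -
  interpret c: metric_chart "chart_dom c" "chart_rep c (gmat M c)"
    by (rule metric_chart[OF c])
  define K where "K = chart_inv c ` B"
  define w where "w x = sqrt (det (gmat M c (chart_inv c x)))" for x
  have cw: "continuous_on B w"
    using continuous_on_subset[OF smooth_on_imp_continuous_on[OF c.smooth_vol] B(2)]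
    by (simp add: w_def c.vol_def[abs_def])
  have w0: "w x \<ge> 0" if "x \<in> B" for x
    using c.vol_pos[of x] that B(2) by (auto simp: w_def c.vol_def)
  have spmu: "space \<mu> = points M" and setsmu: "sets \<mu> = sigma_sets (points M) {U. openin (topo M) U}"
    using mu by (auto simp: riemannian_measure_def)
  have open_sets: "V \<in> sets \<mu>" if "openin (topo M) V" for V
    unfolding setsmu using that by (intro sigma_sets.Basic) simp
  have Kc: "K \<subseteq> fst c" unfolding K_def using chart_inv_in[of _ c] B(2) by auto
  have "compactin (topo M) K" unfolding K_def by (rule compactin_chart_inv[OF c B])
  then have "closedin (topo M) K"
    using smooth_M by (auto simp: smooth_manifold_def intro: compactin_imp_closedin)
  then have "points M - K \<in> sets \<mu>" by (intro open_sets) (simp add: openin_diff)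
  then have "space \<mu> - (points M - K) \<in> sets \<mu>" by (rule sets.compl_sets)
  moreover have "space \<mu> - (points M - K) = K"
    using Kc chart_subset[OF c] by (auto simp: spmu)
  ultimately have K: "K \<in> sets \<mu>" by simp
  have Bs: "B \<in> sets borel" using B(1) by (simp add: compact_imp_closed borel_closed)
  define D where "D = density (restrict_space lborel B) (\<lambda>x. ennreal (w x))"
  have setsD: "sets D = sets (restrict_space borel B)" and spD: "space D = B"
    by (auto simp: D_def sets_restrict_space space_restrict_space)
  have wm: "w \<in> borel_measurable (restrict_space lborel B)"
    using borel_measurable_continuous_on_restrict[OF cw]
    by (simp add: measurable_cong_sets[OF sets_restrict_space_cong[OF sets_lborel] refl])
  have hm: "h \<in> borel_measurable (restrict_space lborel B)"
    using borel_measurable_continuous_on_restrict[OF h]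
    by (simp add: measurable_cong_sets[OF sets_restrict_space_cong[OF sets_lborel] refl])
  have inv_meas: "chart_inv c \<in> measurable D (restrict_space \<mu> K)"
  proof (rule measurable_restrict_space2)
    show "chart_inv c \<in> space D \<rightarrow> K" by (auto simp: spD K_def)
    show "chart_inv c \<in> measurable D \<mu>"
      using measurable_chart_inv[OF mu c B(2)] by (simp add: measurable_cong_sets[OF setsD refl])
  qed
  have distr: "restrict_space \<mu> K = distr D (restrict_space \<mu> K) (chart_inv c)"
  proof (rule measure_eqI)
    fix A assume "A \<in> sets (restrict_space \<mu> K)"
    then have A: "A \<in> sets \<mu>" "A \<subseteq> K"
      using K by (auto simp: sets_restrict_space_iff[of K \<mu>])
    have img: "chart_inv c -` A \<inter> B = snd c ` A"
    proof (intro equalityI subsetI)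
      fix x assume "x \<in> chart_inv c -` A \<inter> B"
      then have "x \<in> chart_dom c" "chart_inv c x \<in> A" using B(2) by auto
      then show "x \<in> snd c ` A"
        using chart_chart_inv[of x c] imageI[of "chart_inv c x" A "snd c"] by simp
    next
      fix x assume "x \<in> snd c ` A"
      then obtain p where p: "p \<in> A" "x = snd c p" by blast
      then obtain y where "y \<in> B" "p = chart_inv c y" using A(2) K_def by auto
      then show "x \<in> chart_inv c -` A \<inter> B"
        using p chart_chart_inv[of y c] B(2) by auto
    qed
    have m: "chart_inv c -` A \<inter> B \<in> sets (restrict_space lborel B)"
    proof -
      have "A \<in> sets (restrict_space \<mu> K)" by fact
      from measurable_sets[OF inv_meas this] show ?thesis
        by (simp add: spD setsD sets_restrict_space)
    qed
    have "emeasure (distr D (restrict_space \<mu> K) (chart_inv c)) A = emeasure D (chart_inv c -` A \<inter> B)"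
      using emeasure_distr[OF inv_meas \<open>A \<in> sets (restrict_space \<mu> K)\<close>] by (simp add: spD)
    also have "\<dots> = (\<integral>\<^sup>+x. ennreal (w x) * indicator (chart_inv c -` A \<inter> B) x \<partial>restrict_space lborel B)"
      unfolding D_def by (rule emeasure_density[OF _ m]) (use wm in simp)
    also have "\<dots> = (\<integral>\<^sup>+x. ennreal (w x) * indicator (chart_inv c -` A \<inter> B) x * indicator B x \<partial>lborel)"
      by (rule nn_integral_restrict_space) (use Bs in simp)
    also have "\<dots> = (\<integral>\<^sup>+x\<in>snd c ` A. ennreal (w x) \<partial>lborel)"
      by (intro nn_integral_cong) (auto simp: indicator_def img[symmetric])
    also have "\<dots> = emeasure \<mu> A"
      using mu c A Kc by (auto simp: riemannian_measure_def w_def)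
    also have "\<dots> = emeasure (restrict_space \<mu> K) A"
      using emeasure_restrict_space[of K \<mu> A] K A by simp
    finally show "emeasure (restrict_space \<mu> K) A = emeasure (distr D (restrict_space \<mu> K) (chart_inv c)) A" ..
  qed simp
  \<comment> \<open>The integrand on \<open>K\<close> is \<open>h\<close> composed with
    \<open>snd c\<close>, so the change of variables also requires measurability in this
    direction.\<close>
  have snd_meas: "snd c \<in> measurable (restrict_space \<mu> K) (restrict_space lborel B)"
  proof (rule measurable_restrict_space2)
    have "snd c (chart_inv c x) \<in> B" if "x \<in> B" for x
      using that B(2) chart_chart_inv[of x c] by auto
    then show "snd c \<in> space (restrict_space \<mu> K) \<rightarrow> B"
      by (auto simp: space_restrict_space K_def)
    have "snd c \<in> borel_measurable (restrict_space \<mu> K)"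
    proof (rule borel_measurableI)
      fix S :: "(real^'m) set" assume S: "open S"
      have "continuous_map (subtopology (topo M) (fst c)) (top_of_set (chart_dom c)) (snd c)"
        using homeomorphic_imp_continuous_map[OF chart_homeo[OF c]] .
      then have "continuous_map (subtopology (topo M) (fst c)) euclidean (snd c)"
        using continuous_map_into_fulltopology by blast
      from openin_continuous_map_preimage[OF this, of S]
      have "openin (subtopology (topo M) (fst c)) {p \<in> fst c. snd c p \<in> S}"
        using S by (simp only: topspace_chart[OF c] open_openin)
      then have "openin (topo M) {p \<in> fst c. snd c p \<in> S}"
        using openin_trans_full[OF _ chart_openin[OF c]] by blast
      then have "{p \<in> fst c. snd c p \<in> S} \<in> sets \<mu>" by (rule open_sets)
      moreover have "snd c -` S \<inter> space (restrict_space \<mu> K) = K \<inter> {p \<in> fst c. snd c p \<in> S}"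
        using Kc chart_subset[OF c] by (auto simp: space_restrict_space spmu)
      ultimately show "snd c -` S \<inter> space (restrict_space \<mu> K) \<in> sets (restrict_space \<mu> K)"
        unfolding sets_restrict_space by (simp only: image_eqI)
    qed
    then show "snd c \<in> measurable (restrict_space \<mu> K) lborel" by simp
  qed
  have "(LINT p:K|\<mu>. f p) = (LINT p|restrict_space \<mu> K. f p)"
    unfolding set_lebesgue_integral_def using K by (intro integral_restrict_space[symmetric]) auto
  also have "\<dots> = (LINT p|restrict_space \<mu> K. h (snd c p))"
  proof (rule Bochner_Integration.integral_cong[OF refl])
    fix p assume "p \<in> space (restrict_space \<mu> K)"
    then obtain x where x: "x \<in> B" "p = chart_inv c x" by (auto simp: space_restrict_space K_def)
    then show "f p = h (snd c p)"
      using f chart_chart_inv[of x c] B(2) by auto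
  qed
  also have "\<dots> = (LINT p|distr D (restrict_space \<mu> K) (chart_inv c). h (snd c p))"
    using distr by simp
  also have "\<dots> = (LINT x|D. h (snd c (chart_inv c x)))"
    by (rule integral_distr[OF inv_meas measurable_compose[OF snd_meas hm]])
  also have "\<dots> = (LINT x|D. h x)"
    using B(2) chart_chart_inv[of _ c] by (intro Bochner_Integration.integral_cong refl) (auto simp: spD)
  also have "\<dots> = (LINT x|restrict_space lborel B. w x *\<^sub>R h x)"
    unfolding D_def using w0
    by (intro integral_density hm wm AE_I2) (auto simp: space_restrict_space)
  also have "\<dots> = (LINT x:B|lborel. w x * h x)"
    unfolding set_lebesgue_integral_def using Bs by (subst integral_restrict_space) auto
  finally show ?thesis by (simp add: K_def w_def)
qed

end

lemma sphere_proj_add_radial: "y \<bullet> y = 1 \<Longrightarrow> sphere_proj y (z + k *\<^sub>R y) = sphere_proj y z"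
  by (simp add: sphere_proj_def inner_add_left algebra_simps)

lemma norm_sphere_proj: "y \<bullet> y = 1 \<Longrightarrow> (norm (sphere_proj y z))\<^sup>2 = z \<bullet> z - (z \<bullet> y) * (z \<bullet> y)"
  by (simp add: power2_norm_eq_inner sphere_proj_def inner_diff_left inner_diff_right inner_commute)

section \<open>Normal variations of an immersion into the sphere\<close>

locale spherical_immersion = riemannian_immersion M \<phi>
  for M :: "('a, 'm::finite) manifold_data" and \<phi> :: "'a \<Rightarrow> real^'n::finite" +
  assumes sph: "\<phi> ` points M \<subseteq> sphere 0 1"
begin

text \<open>The tension field of \<phi>, by \<open>tension_phi\<close>, in a form that is smooth by
  inspection and to which the Laplacian applies directly.\<close>

definition tau :: "'a \<Rightarrow> real^'n" where
  "tau q = vec_laplacian M \<phi> q + real CARD('m) *\<^sub>R \<phi> q"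

text \<open>For \<open>V\<close> normal to \<phi>, the square root is the length of \<phi> + tV. In
  this form the denominator is positive for every \<open>V\<close> and \<open>t\<close>, which makes
  smoothness unconditional.\<close>

definition normal_variation :: "('a \<Rightarrow> real^'n) \<Rightarrow> real \<Rightarrow> 'a \<Rightarrow> real^'n" where
  "normal_variation V t q = inverse (sqrt (1 + t\<^sup>2 * (V q \<bullet> V q))) *\<^sub>R (\<phi> q + t *\<^sub>R V q)"

lemma smooth_phi: "smooth_map M \<phi>"
  using iso by (simp add: isometric_immersion_def)

lemma phi_unit: "p \<in> points M \<Longrightarrow> \<phi> p \<bullet> \<phi> p = 1"
  using sph by (auto simp: dot_square_norm)

lemma chart_inv_points: "c \<in> atlas M \<Longrightarrow> x \<in> chart_dom c \<Longrightarrow> chart_inv c x \<in> points M"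
  using chart_inv_in[of x c] chart_subset[of c] by blast

lemma smooth_tau: "smooth_map M tau"
  unfolding smooth_map_def' tau_def
proof
  fix c assume c: "c \<in> atlas M"
  show "smooth_on (chart_dom c) (chart_rep c (\<lambda>q. vec_laplacian M \<phi> q + real CARD('m) *\<^sub>R \<phi> q))"
    by (intro smooth_on_add smooth_on_scaleR smooth_on_const open_chart_dom[OF c]
      smooth_mapD[OF smooth_phi c] smooth_mapD[OF smooth_map_vec_laplacian[OF smooth_phi] c])
qed

lemma vec_laplacian_phi_radial:
  assumes p: "p \<in> points M"
  shows "vec_laplacian M \<phi> p \<bullet> \<phi> p = - real CARD('m)"
proof -
  obtain c where c: "c \<in> atlas M" "p \<in> fst c" using chart_at[OF p] by blast
  interpret c: immersion_chart "chart_dom c" "chart_rep c (gmat M c)" "chart_rep c \<phi>"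
    by (rule immersion_chart[OF c(1)])
  have "lap (chart_rep c (gmat M c)) (chart_rep c \<phi>) (snd c p) \<bullet> chart_rep c \<phi> (snd c p) = - real CARD('m)"
    using c phi_unit[OF chart_inv_points[OF c(1)]] by (intro c.lap_radial) auto
  then show ?thesis
    by (simp add: vec_laplacian_chart[OF smooth_phi c] chart_inv_chart[OF c])
qed

lemma tau_normal: "p \<in> points M \<Longrightarrow> tau p \<bullet> \<phi> p = 0"
  by (simp add: tau_def inner_add_left vec_laplacian_phi_radial phi_unit)

lemma tension_phi: "p \<in> points M \<Longrightarrow> tension M \<phi> p = tau p"
  by (simp add: tension_eq[OF smooth_phi sph] sphere_proj_def vec_laplacian_phi_radial tau_def)

lemma variation_factor_pos: "1 + t\<^sup>2 * (v \<bullet> v) > (0::real)"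
  by (simp add: add_pos_nonneg)

lemma variation_factor_ne: "1 + t\<^sup>2 * (v \<bullet> v) \<noteq> (0::real)"
  using variation_factor_pos[of t v] by simp

lemma normal_variation_unit:
  assumes "V p \<bullet> \<phi> p = 0" "p \<in> points M"
  shows "normal_variation V t p \<bullet> normal_variation V t p = 1"
proof -
  have "(\<phi> p + t *\<^sub>R V p) \<bullet> (\<phi> p + t *\<^sub>R V p) = 1 + t\<^sup>2 * (V p \<bullet> V p)"
    using assms(1) phi_unit[OF assms(2)]
    by (simp add: inner_add_left inner_add_right inner_commute power2_eq_square)
  moreover have "inverse (sqrt u) * (inverse (sqrt u) * u) = 1" if "u > 0" for u :: real
    using that by (simp add: field_simps)
  ultimately show ?thesis
    using variation_factor_pos[of t "V p"]
    by (simp only: normal_variation_def inner_scaleR_left inner_scaleR_right)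
qed

lemma smooth_normal_variation_joint:
  assumes V: "smooth_map M V" and c: "c \<in> atlas M"
  shows "smooth_on (UNIV \<times> chart_dom c) (\<lambda>z. normal_variation V (fst z) (chart_inv c (snd z)))"
proof -
  let ?S = "(UNIV :: real set) \<times> chart_dom c"
  have o: "open ?S" by (intro open_Times open_UNIV open_chart_dom[OF c])
  have sf: "smooth_on ?S (\<lambda>z. chart_rep c f (snd z))" if "smooth_map M f" for f :: "'a \<Rightarrow> real^'n"
    by (rule smooth_on_compose[OF o open_chart_dom[OF c] _ smooth_mapD[OF that c]
        smooth_on_bounded_linear_ident[OF o bounded_linear_snd]]) auto
  have st: "smooth_on ?S fst"
    by (rule smooth_on_bounded_linear_ident[OF o bounded_linear_fst])
  show ?thesis
    unfolding normal_variation_def power2_eq_square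
    by (intro smooth_on_scaleR smooth_on_inverse smooth_on_sqrt smooth_on_add smooth_on_const
        smooth_on_mult smooth_on_inner o sf[OF V] sf[OF smooth_phi] st)
      (auto simp: variation_factor_pos[unfolded power2_eq_square] variation_factor_ne[unfolded power2_eq_square])
qed

lemma smooth_normal_variation:
  assumes V: "smooth_map M V"
  shows "smooth_map M (normal_variation V t)"
  unfolding smooth_map_def'
proof
  fix c assume c: "c \<in> atlas M"
  have o: "open ((UNIV :: real set) \<times> chart_dom c)" by (intro open_Times open_UNIV open_chart_dom[OF c])
  \<comment> \<open>\<open>Pair t\<close> is affine, hence smooth as a constant plus a bounded
    linear map.\<close>
  have "smooth_on (chart_dom c) (\<lambda>x. (t, 0) + (0::real, x))"
    by (intro smooth_on_add smooth_on_const smooth_on_bounded_linear_ident open_chart_dom[OF c]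
        bounded_linear_Pair bounded_linear_zero bounded_linear_ident)
  then have "smooth_on (chart_dom c) (Pair t)" by simp
  from smooth_on_compose[OF open_chart_dom[OF c] o _ smooth_normal_variation_joint[OF V c] this]
  show "smooth_on (chart_dom c) (chart_rep c (normal_variation V t))" by auto
qed

lemma sphere_variation_normal:
  assumes V: "smooth_map M V" and normal: "\<And>p. p \<in> points M \<Longrightarrow> V p \<bullet> \<phi> p = 0"
    and K: "compactin (topo M) K" and supp: "\<And>p. p \<in> points M - K \<Longrightarrow> V p = 0"
  shows "sphere_variation M \<phi> 1 K (normal_variation V)"
  unfolding sphere_variation_def
proof (intro conjI ballI)
  show "(0::real) < 1" by simp
  show "normal_variation V t ` points M \<subseteq> sphere 0 1" for t
    using normal_variation_unit normal by (auto simp: norm_eq_1)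
  show "smooth_on ({-1<..<1} \<times> chart_dom c) (\<lambda>(t, x). normal_variation V t (chart_inv c x))"
    if "c \<in> atlas M" for c
    using smooth_on_subset[OF smooth_normal_variation_joint[OF V that], of "{-1<..<1} \<times> chart_dom c"]
    by (auto simp: case_prod_unfold)
qed (use K supp in \<open>auto simp: normal_variation_def\<close>)

end

section \<open>The varied tension field in one chart\<close>

locale variation_chart = spherical_immersion M \<phi>
  for M :: "('a, 'm::finite) manifold_data" and \<phi> :: "'a \<Rightarrow> real^'n::finite" +
  fixes V :: "'a \<Rightarrow> real^'n" and c :: "('a, 'm) chart"
  assumes smooth_V: "smooth_map M V" and normal_V: "\<And>p. p \<in> points M \<Longrightarrow> V p \<bullet> \<phi> p = 0"
    and c: "c \<in> atlas M"
begin

abbreviation "g \<equiv> chart_rep c (gmat M c)"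
abbreviation "\<psi> \<equiv> chart_rep c \<phi>"
abbreviation "v \<equiv> chart_rep c V"

sublocale chart: immersion_chart "chart_dom c" g \<psi>
  by (rule immersion_chart[OF c])

definition sqnorm_V :: "real^'m \<Rightarrow> real" where "sqnorm_V x = v x \<bullet> v x"

definition factor :: "real \<Rightarrow> real^'m \<Rightarrow> real" where
  "factor t x = inverse (sqrt (1 + t\<^sup>2 * sqnorm_V x))"

text \<open>The metric pairing of the gradient of |V|^2 with the derivative of \<open>w\<close>. It
  is what the product rule leaves when a function of |V|^2 multiplies \<open>w\<close>.\<close>

definition cross_term :: "(real^'m \<Rightarrow> real^'n) \<Rightarrow> real^'m \<Rightarrow> real^'n" where
  "cross_term w x = (\<Sum>i\<in>UNIV. \<Sum>j\<in>UNIV. matrix_inv (g x) $ i $ j *\<^sub>R partial i sqnorm_V x *\<^sub>R partial j w x)"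

text \<open>
  The Laplacian of the normal variation without its radial part, which the projection to the
  tangent space of the sphere removes.
\<close>

definition lap_mod :: "real \<Rightarrow> real^'m \<Rightarrow> real^'n" where
  "lap_mod t x = factor t x *\<^sub>R (lap g \<psi> x + t *\<^sub>R lap g v x)
     + t\<^sup>2 *\<^sub>R (- ((factor t x * factor t x * factor t x) *\<^sub>R (cross_term \<psi> x + t *\<^sub>R cross_term v x)))"

lemma unit_normal_variation: "p \<in> points M \<Longrightarrow> normal_variation V t p \<bullet> normal_variation V t p = 1"
  by (simp add: normal_variation_unit normal_V)

lemma smooth_v: "smooth_on (chart_dom c) v"
  by (rule smooth_mapD[OF smooth_V c])

lemma smooth_sqnorm_V: "smooth_on (chart_dom c) sqnorm_V"
  unfolding sqnorm_V_def[abs_def] by (intro chart.smooth_intros smooth_v)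

lemma smooth_factor: "smooth_on (chart_dom c) (factor t)"
  unfolding factor_def[abs_def] sqnorm_V_def
  by (intro smooth_on_inverse smooth_on_sqrt smooth_on_add smooth_on_mult smooth_on_const
      smooth_on_inner smooth_v chart.open_U)
    (auto simp: variation_factor_pos variation_factor_ne)

lemma smooth_cross_term: "smooth_on (chart_dom c) w \<Longrightarrow> smooth_on (chart_dom c) (cross_term w)"
  unfolding cross_term_def[abs_def] by (intro chart.smooth_intros smooth_sqnorm_V)

lemma partial_factor:
  assumes x: "x \<in> chart_dom c"
  shows "partial i (factor t) x = - (t\<^sup>2 * (factor t x * factor t x * factor t x) / 2) * partial i sqnorm_V x"
proof -
  let ?k = "\<lambda>r. inverse (sqrt (1 + t\<^sup>2 * r))"
  have pos: "1 + t\<^sup>2 * sqnorm_V x > 0" unfolding sqnorm_V_def by (rule variation_factor_pos)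
  have "DERIV ?k (sqnorm_V x) :> - (t\<^sup>2 * (?k (sqnorm_V x) * ?k (sqnorm_V x) * ?k (sqnorm_V x)) / 2)"
    using pos by (auto intro!: derivative_eq_intros simp: power2_eq_square field_simps)
  from has_derivative_partial[OF DERIV_compose_FDERIV[OF this smooth_on_has_derivative[OF smooth_sqnorm_V x]], of i]
  show ?thesis
    by (simp add: factor_def[abs_def] partial_def)
qed

text \<open>In the product rule for \<open>factor t\<close> times \<open>w\<close>, the term
  containing the Laplacian of \<open>factor t\<close> is a multiple of \<open>w\<close>, hence of
  the varied map itself. The projection kills it, so that Laplacian is never computed.\<close>

lemma tension_variation:
  assumes x: "x \<in> chart_dom c"
  shows "tension M (normal_variation V t) (chart_inv c x) =
    sphere_proj (normal_variation V t (chart_inv c x)) (lap_mod t x)"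
proof -
  note pM = chart_inv_points[OF c x]
  define w where "w y = \<psi> y + t *\<^sub>R v y" for y
  have sw: "smooth_on (chart_dom c) w"
    unfolding w_def[abs_def] by (intro chart.smooth_intros smooth_v chart.smooth_psi)
  have rep: "chart_rep c (normal_variation V t) = (\<lambda>y. factor t y *\<^sub>R w y)"
    by (simp add: normal_variation_def factor_def sqnorm_V_def w_def)
  have stv: "smooth_on (chart_dom c) (\<lambda>y. t *\<^sub>R v y)"
    by (intro chart.smooth_intros smooth_v)
  have lap_w: "lap g w x = lap g \<psi> x + t *\<^sub>R lap g v x"
    unfolding w_def[abs_def] chart.lap_add[OF chart.smooth_psi stv x]
    by (simp add: chart.lap_bounded_linear[OF bounded_linear_scaleR_right smooth_v x])
  have p_w: "partial j w x = partial j \<psi> x + t *\<^sub>R partial j v x" for j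
    unfolding w_def[abs_def] partial_add[OF chart.smooth_psi stv x]
    by (simp add: partial_bounded_linear[OF bounded_linear_scaleR_right smooth_v x])
  \<comment> \<open>The gradient of \<open>factor t\<close> carries \<open>t\<^sup>2\<close>, so the
    mixed term cannot affect the first variation.\<close>
  have "2 *\<^sub>R (\<Sum>i\<in>UNIV. \<Sum>j\<in>UNIV. chart.G x $ i $ j *\<^sub>R partial i (factor t) x *\<^sub>R partial j w x) =
      t\<^sup>2 *\<^sub>R (- ((factor t x * factor t x * factor t x) *\<^sub>R cross_term w x))"
    by (simp add: partial_factor[OF x] cross_term_def scaleR_sum_right sum_negf[symmetric] mult_ac)
  also have "cross_term w x = cross_term \<psi> x + t *\<^sub>R cross_term v x"
    unfolding cross_term_def p_w by (simp add: scaleR_add_right sum.distrib scaleR_sum_right mult_ac)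
  finally have "lap g (\<lambda>y. factor t y *\<^sub>R w y) x = lap_mod t x + lap g (factor t) x *\<^sub>R w x"
    by (simp add: chart.lap_bilinear[OF bounded_bilinear_scaleR smooth_factor sw x] lap_mod_def lap_w)
  moreover have "w x = sqrt (1 + t\<^sup>2 * sqnorm_V x) *\<^sub>R normal_variation V t (chart_inv c x)"
    using fun_cong[OF rep, of x] variation_factor_pos[of t "v x"] by (simp add: factor_def sqnorm_V_def)
  ultimately have "vec_laplacian M (normal_variation V t) (chart_inv c x) =
      lap_mod t x + (lap g (factor t) x * sqrt (1 + t\<^sup>2 * sqnorm_V x)) *\<^sub>R normal_variation V t (chart_inv c x)"
    by (simp add: chart_rep_vec_laplacian[OF smooth_normal_variation[OF smooth_V] c x] rep)
  moreover have "normal_variation V t ` points M \<subseteq> sphere 0 1"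
    using unit_normal_variation by (auto simp: norm_eq_1)
  ultimately show ?thesis
    by (simp add: tension_eq[OF smooth_normal_variation[OF smooth_V] _ pM]
        sphere_proj_add_radial unit_normal_variation[OF pM])
qed

text \<open>For a unit vector y, the projection of z has squared length |z|^2 - <z, y>^2. Here z is
  \<open>lap_mod\<close> and y the varied map; as \<open>factor\<close> expands to 1 with no linear
  term, they contribute \<open>lap g \<psi> + t *\<^sub>R lap g v\<close> and
  \<open>\<psi> + t *\<^sub>R v\<close> to first order.\<close>

lemma tension_expands:
  assumes B: "B \<subseteq> chart_dom c"
  shows "expands B (\<lambda>t x. (norm (tension M (normal_variation V t) (chart_inv c x)))\<^sup>2)
    (\<lambda>x. lap g \<psi> x \<bullet> lap g \<psi> x - (lap g \<psi> x \<bullet> \<psi> x) * (lap g \<psi> x \<bullet> \<psi> x))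
    (\<lambda>x. 2 * (lap g \<psi> x \<bullet> lap g v x - (lap g \<psi> x \<bullet> \<psi> x) * (lap g \<psi> x \<bullet> v x + lap g v x \<bullet> \<psi> x)))"
proof -
  have co: "continuous_on B f" if "smooth_on (chart_dom c) f" for f :: "real^'m \<Rightarrow> 'z::real_normed_vector"
    using smooth_on_imp_continuous_on[OF that] B by (rule continuous_on_subset)
  note cs = co[OF chart.smooth_lap[OF chart.smooth_psi]] co[OF chart.smooth_lap[OF smooth_v]]
    co[OF smooth_cross_term[OF chart.smooth_psi]] co[OF smooth_cross_term[OF smooth_v]]
    co[OF chart.smooth_psi] co[OF smooth_v]
  have f: "expands B factor (\<lambda>_. 1) (\<lambda>_. 0)"
    unfolding factor_def[abs_def]
    by (rule expands_inverse_sqrt[OF co[OF smooth_sqnorm_V]]) (simp add: sqnorm_V_def)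
  define r where "r z = - ((factor (fst z) (snd z) * factor (fst z) (snd z) * factor (fst z) (snd z)) *\<^sub>R
      (cross_term \<psi> (snd z) + fst z *\<^sub>R cross_term v (snd z)))" for z
  have "continuous_on ({-1..1} \<times> B) (\<lambda>z. factor (fst z) (snd z))"
    unfolding factor_def
    by (intro continuous_intros continuous_on_snd_times co smooth_sqnorm_V)
      (auto simp: sqnorm_V_def variation_factor_ne)
  then have "continuous_on ({-1..1} \<times> B) r"
    unfolding r_def by (intro continuous_intros continuous_on_snd_times cs)
  note q = expands_quadratic[OF this]
  have P: "expands B (\<lambda>t x. lap g \<psi> x + t *\<^sub>R lap g v x) (lap g \<psi>) (lap g v)"
    by (rule expands_cong[OF expands_add[OF expands_const[OF cs(1)] expands_linear[OF cs(2)]]]) auto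
  have W: "expands B (\<lambda>t x. \<psi> x + t *\<^sub>R v x) \<psi> v"
    by (rule expands_cong[OF expands_add[OF expands_const[OF cs(5)] expands_linear[OF cs(6)]]]) auto
  have A: "expands B lap_mod (lap g \<psi>) (lap g v)"
    by (rule expands_cong[OF expands_add[OF expands_bilinear[OF bounded_bilinear_scaleR f P] q]])
      (auto simp: lap_mod_def r_def)
  have Y: "expands B (\<lambda>t x. factor t x *\<^sub>R (\<psi> x + t *\<^sub>R v x)) \<psi> v"
    by (rule expands_cong[OF expands_bilinear[OF bounded_bilinear_scaleR f W]]) auto
  note AY = expands_bilinear[OF bounded_bilinear_inner A Y]
  have neg: "expands B (\<lambda>t x. -1 * (f t x :: real)) (\<lambda>x. - a x) (\<lambda>x. - b x)" if "expands B f a b" for f a b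
    by (rule expands_cong[OF expands_bilinear[OF bounded_bilinear_mult
          expands_const[of B "\<lambda>_. -1 :: real"] that]]) auto
  show ?thesis
  proof (rule expands_cong[OF expands_add[OF expands_bilinear[OF bounded_bilinear_inner A A]
          neg[OF expands_bilinear[OF bounded_bilinear_mult AY AY]]]], goal_cases)
    case (1 t x)
    then have x: "x \<in> chart_dom c" using B by blast
    note pM = chart_inv_points[OF c x]
    have "normal_variation V t (chart_inv c x) = factor t x *\<^sub>R (\<psi> x + t *\<^sub>R v x)"
      by (simp add: normal_variation_def factor_def sqnorm_V_def)
    then show ?case
      unfolding tension_variation[OF x] norm_sphere_proj[OF unit_normal_variation[OF pM]]
      by simp
  qed (simp_all add: inner_commute algebra_simps)
qed

lemma bienergy_derivative:
  assumes mu: "riemannian_measure M \<mu>" and B: "compact B" "B \<subseteq> chart_dom c"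
  shows "((\<lambda>t. bienergy M \<mu> (chart_inv c ` B) (normal_variation V t)) has_real_derivative
    (LINT x:B|lborel. chart.vol x *
      (lap g \<psi> x \<bullet> lap g v x - (lap g \<psi> x \<bullet> \<psi> x) * (lap g \<psi> x \<bullet> v x + lap g v x \<bullet> \<psi> x)))) (at 0)"
proof -
  let ?q = "\<lambda>t x. (norm (tension M (normal_variation V t) (chart_inv c x)))\<^sup>2"
  let ?b = "\<lambda>x. lap g \<psi> x \<bullet> lap g v x - (lap g \<psi> x \<bullet> \<psi> x) * (lap g \<psi> x \<bullet> v x + lap g v x \<bullet> \<psi> x)"
  note ex = tension_expands[OF B(2)]
  have cv: "continuous_on B chart.vol"
    using smooth_on_imp_continuous_on[OF chart.smooth_vol] B(2) by (rule continuous_on_subset)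
  have "((\<lambda>t. 1/2 * (LINT x:B|lborel. chart.vol x * ?q t x)) has_real_derivative
      1/2 * (LINT x:B|lborel. chart.vol x * (2 * ?b x))) (at 0)"
    by (intro DERIV_cmult expands_integral_derivative[OF B(1) ex cv])
  also have "1/2 * (LINT x:B|lborel. chart.vol x * (2 * ?b x)) = (LINT x:B|lborel. chart.vol x * ?b x)"
  proof -
    have "(\<lambda>x. chart.vol x * (2 * ?b x)) = (\<lambda>x. 2 * (chart.vol x * ?b x))"
      by (simp add: fun_eq_iff)
    then show ?thesis by (simp only: set_integral_mult_right)
  qed
  finally show ?thesis
  proof (rule has_field_derivative_transform_within_open[of _ _ _ "{-1<..<1}"])
    fix t :: real assume t: "t \<in> {-1<..<1}"
    have "(LINT p:chart_inv c ` B|\<mu>. (norm (tension M (normal_variation V t) p))\<^sup>2) =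
        (LINT x:B|lborel. sqrt (det (gmat M c (chart_inv c x))) * ?q t x)"
      by (rule chart_integral[OF mu c B expands_continuous[OF ex]]) (use t in auto)
    then show "1/2 * (LINT x:B|lborel. chart.vol x * ?q t x) =
        bienergy M \<mu> (chart_inv c ` B) (normal_variation V t)"
      by (simp add: bienergy_def chart.vol_def)
  qed auto
qed

end

section \<open>Biharmonic immersions with \<open>\<Delta>\<^sup>2 \<phi> = \<lambda> \<phi>\<close>\<close>

context spherical_immersion
begin

text \<open>The integrand is the coordinate divergence of the field \<open>X\<close> from
  \<open>weighted_divergence\<close>. Extended by zero, \<open>X\<close> is smooth on the whole
  coordinate space and vanishes off the ball, so each of its partial derivatives integrates to
  0.\<close>

lemma bump_flux_integral:
  assumes c: "c \<in> atlas M" and r: "r > 0" and sub: "cball a r \<subseteq> chart_dom c"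
    and h: "smooth_on (chart_dom c) h"
  defines "g \<equiv> chart_rep c (gmat M c)"
  shows "(LINT x:cball a r|lborel. metric_chart.vol g x *
      (h x * lap g (bump a r) x + (\<Sum>i\<in>UNIV. grad g (bump a r) i x * partial i h x))) = 0"
    (is "(LINT x:_|lborel. ?F x) = 0")
proof -
  interpret metric_chart "chart_dom c" g
    unfolding g_def by (rule metric_chart[OF c])
  note sb = smooth_on_subset[OF smooth_on_bump subset_UNIV]
  define X where "X i y = vol y * h y * grad g (bump a r) i y" for i y
  \<comment> \<open>Outside the chart domain \<open>vol\<close> and \<open>h\<close> have arbitrary
    values; the vanishing derivatives of \<open>bump\<close> make \<open>X\<close> zero there all
    the same.\<close>
  have X0: "X i y = 0" if "y \<notin> cball a r" for i y
  proof -
    have "partial l (bump a r) y = 0" for l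
      unfolding partial_def
      by (rule frechet_derivative_eq_0_outside[OF closed_cball that]) (rule bump_eq_0[OF _ r])
    then show ?thesis by (simp add: X_def grad_def)
  qed
  have smX: "smooth_on UNIV (X i)" for i
  proof (rule smooth_on_open_cover)
    fix x :: "real^'m"
    have "smooth_on (- cball a r) (X i)"
      by (subst smooth_on_cong[of _ _ "\<lambda>_. 0"]) (auto simp: X0 smooth_on_const)
    moreover have "smooth_on (chart_dom c) (X i)"
      unfolding X_def[abs_def] by (intro smooth_on_mult open_U smooth_vol h smooth_grad sb)
    moreover have "open (- cball a r)" by auto
    ultimately show "\<exists>T. open T \<and> x \<in> T \<and> smooth_on T (X i)"
      using open_U sub by (cases "x \<in> cball a r") blast+
  qed
  have diff: "X i differentiable (at x)" for i x
    using smooth_on_has_derivative[OF smX] by (auto simp: differentiable_def)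
  have int: "integrable lborel (partial i (X i))" "(LINT x|lborel. partial i (X i) x) = 0" for i
    using integral_compact_support_derivative[OF diff smooth_on_imp_continuous_on[OF smooth_on_frechet[OF smX]]
        compact_cball X0]
    by (auto simp: partial_def[abs_def])
  have outside: "partial i (X i) x = 0" if "x \<notin> cball a r" for i x
    unfolding partial_def by (rule frechet_derivative_eq_0_outside[OF closed_cball that X0])
  have "(LINT x:cball a r|lborel. ?F x) = (LINT x|lborel. (\<Sum>i\<in>UNIV. partial i (X i) x))"
    unfolding set_lebesgue_integral_def
  proof (rule Bochner_Integration.integral_cong[OF refl])
    fix x
    show "indicator (cball a r) x *\<^sub>R ?F x = (\<Sum>i\<in>UNIV. partial i (X i) x)"
    proof (cases "x \<in> cball a r")
      case True
      then have "x \<in> chart_dom c" using sub by blast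
      from weighted_divergence[OF sb h this, of a r] True show ?thesis
        by (simp add: X_def[abs_def])
    qed (simp add: outside)
  qed
  also have "\<dots> = 0"
    by (simp add: Bochner_Integration.integral_sum int)
  finally show ?thesis .
qed

text \<open>Rewrites the density of the first variation for \<open>v = \<eta> *\<^sub>R T\<close>.
  Half of the factor 2m comes from the curvature of the sphere, through
  \<open>lap g \<psi> x \<bullet> \<psi> x = - m\<close>, and half from
  \<open>T x \<bullet> lap g T x = m * h x\<close>; the remaining bracket is the divergence of
  \<open>h\<close> grad \<open>\<eta>\<close>.\<close>

lemma variation_integrand:
  assumes c: "c \<in> atlas M" and x: "x \<in> chart_dom c"
    and eta: "smooth_on (chart_dom c) \<eta>"
    and eigen: "\<And>p. p \<in> points M \<Longrightarrow> vec_laplacian M (vec_laplacian M \<phi>) p = lam p *\<^sub>R \<phi> p"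
  defines "g \<equiv> chart_rep c (gmat M c)" and "\<psi> \<equiv> chart_rep c \<phi>" and "T \<equiv> chart_rep c tau"
  defines "v \<equiv> \<lambda>y. \<eta> y *\<^sub>R T y" and "h \<equiv> \<lambda>y. T y \<bullet> T y"
  shows "lap g \<psi> x \<bullet> lap g v x - (lap g \<psi> x \<bullet> \<psi> x) * (lap g \<psi> x \<bullet> v x + lap g v x \<bullet> \<psi> x) =
    2 * real CARD('m) * (\<eta> x * h x) +
    (h x * lap g \<eta> x + (\<Sum>i\<in>UNIV. grad g \<eta> i x * partial i h x))"
proof -
  interpret immersion_chart "chart_dom c" g \<psi>
    unfolding g_def \<psi>_def by (rule immersion_chart[OF c])
  note pM = chart_inv_points[OF c x]
  let ?m = "real CARD('m)"
  have smT: "smooth_on (chart_dom c) T"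
    unfolding T_def by (rule smooth_mapD[OF smooth_tau c])
  have sF: "smooth_on (chart_dom c) (chart_rep c (vec_laplacian M \<phi>))"
    by (rule smooth_mapD[OF smooth_map_vec_laplacian[OF smooth_phi] c])
  have P: "lap g \<psi> x = T x - ?m *\<^sub>R \<psi> x"
    unfolding g_def \<psi>_def T_def tau_def chart_rep_vec_laplacian[OF smooth_phi c x, symmetric] by simp
  have Tpsi: "T x \<bullet> \<psi> x = 0" "\<psi> x \<bullet> \<psi> x = 1"
    unfolding T_def \<psi>_def by (rule tau_normal[OF pM], rule phi_unit[OF pM])
  have "lap g T x = lap g (\<lambda>y. chart_rep c (vec_laplacian M \<phi>) y + ?m *\<^sub>R \<psi> y) x"
    by (simp add: T_def tau_def \<psi>_def)
  also have "\<dots> = lap g (chart_rep c (vec_laplacian M \<phi>)) x + ?m *\<^sub>R lap g \<psi> x"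
    by (subst lap_add[OF sF _ x])
      (auto intro!: smooth_on_scaleR open_U smooth_on_const smooth_psi
        simp: lap_bounded_linear[OF bounded_linear_scaleR_right smooth_psi x])
  also have "lap g (chart_rep c (vec_laplacian M \<phi>)) x = lam (chart_inv c x) *\<^sub>R \<psi> x"
    unfolding g_def chart_rep_vec_laplacian[OF smooth_map_vec_laplacian[OF smooth_phi] c x, symmetric]
      eigen[OF pM] \<psi>_def ..
  finally have lapT: "T x \<bullet> lap g T x = ?m * h x"
    by (simp add: P inner_add_right inner_diff_right Tpsi h_def)
  have ph: "partial j h x = 2 * (T x \<bullet> partial j T x)" for j
    unfolding h_def partial_inner[OF smT smT x] by (simp add: inner_commute)
  have "T x \<bullet> lap g v x = \<eta> x * (T x \<bullet> lap g T x) + lap g \<eta> x * h x +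
      (\<Sum>i\<in>UNIV. \<Sum>j\<in>UNIV. G x $ i $ j * partial i \<eta> x * partial j h x)"
    unfolding v_def lap_bilinear[OF bounded_bilinear_scaleR eta smT x] ph
    by (simp add: inner_add_right inner_sum_right sum_distrib_left h_def mult_ac)
  also have "(\<Sum>i\<in>UNIV. \<Sum>j\<in>UNIV. G x $ i $ j * partial i \<eta> x * partial j h x) =
      (\<Sum>j\<in>UNIV. grad g \<eta> j x * partial j h x)"
    by (subst sum.swap) (simp add: grad_def sum_distrib_right G_sym[OF x])
  finally have TQ: "T x \<bullet> lap g v x = ?m * (\<eta> x * h x) + (h x * lap g \<eta> x +
      (\<Sum>j\<in>UNIV. grad g \<eta> j x * partial j h x))"
    by (simp add: lapT mult_ac)
  \<comment> \<open>Substituting \<open>lap g \<psi> x = T x - m *\<^sub>R \<psi> x\<close>, the two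
    products of \<open>\<psi> x\<close> with \<open>lap g v x\<close> cancel.\<close>
  have "lap g \<psi> x \<bullet> lap g v x - (lap g \<psi> x \<bullet> \<psi> x) * (lap g \<psi> x \<bullet> v x + lap g v x \<bullet> \<psi> x) =
      T x \<bullet> lap g v x + ?m * (T x \<bullet> v x)"
    using Tpsi inner_commute[of "T x" "\<psi> x"]
    by (simp add: P inner_diff_left v_def inner_commute[of "lap g _ x" "\<psi> x"] algebra_simps)
  then show ?thesis
    unfolding TQ by (simp add: v_def h_def)
qed

lemma biharmonic_tau_eq_0:
  assumes eigen: "\<And>p. p \<in> points M \<Longrightarrow> vec_laplacian M (vec_laplacian M \<phi>) p = lam p *\<^sub>R \<phi> p"
    and bih: "biharmonic_in_sphere M \<phi>" and p: "p \<in> points M"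
  shows "tau p = 0"
proof (rule ccontr)
  assume ne: "tau p \<noteq> 0"
  obtain c where c: "c \<in> atlas M" "p \<in> fst c" using chart_at[OF p] by blast
  define a where "a = snd c p"
  have a: "a \<in> chart_dom c" "chart_inv c a = p"
    using c by (auto simp: a_def chart_inv_chart)
  obtain r where r: "r > 0" "cball a r \<subseteq> chart_dom c"
    using open_chart_dom[OF c(1)] a(1) open_contains_cball by blast
  define V where "V q = manifold_bump c a r q *\<^sub>R tau q" for q
  have smV: "smooth_map M V"
    unfolding smooth_map_def' V_def
  proof
    fix d assume d: "d \<in> atlas M"
    show "smooth_on (chart_dom d) (chart_rep d (\<lambda>q. manifold_bump c a r q *\<^sub>R tau q))"
      by (rule smooth_on_scaleR[OF open_chart_dom[OF d] smooth_mapD[OF smooth_manifold_bump[OF c(1) r] d]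
            smooth_mapD[OF smooth_tau d]])
  qed
  have normalV: "V q \<bullet> \<phi> q = 0" if "q \<in> points M" for q
    using tau_normal[OF that] by (simp add: V_def)
  interpret variation_chart M \<phi> V c
    by unfold_locales (fact smV normalV c(1))+
  let ?B = "cball a r"
  let ?m = "real CARD('m)"
  let ?\<eta> = "bump a r"
  define h where "h y = chart_rep c tau y \<bullet> chart_rep c tau y" for y
  let ?D = "\<lambda>x. h x * lap g ?\<eta> x + (\<Sum>i\<in>UNIV. grad g ?\<eta> i x * partial i h x)"
  have smT: "smooth_on (chart_dom c) (chart_rep c tau)"
    by (rule smooth_mapD[OF smooth_tau c(1)])
  have smh: "smooth_on (chart_dom c) h"
    unfolding h_def[abs_def] by (intro smooth_on_inner open_chart_dom[OF c(1)] smT)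
  have sb: "smooth_on (chart_dom c) ?\<eta>"
    by (rule smooth_on_subset[OF smooth_on_bump subset_UNIV])
  have v_eq: "v y = ?\<eta> y *\<^sub>R chart_rep c tau y" if "y \<in> chart_dom c" for y
    using that by (simp add: V_def manifold_bump_def chart_inv_in chart_chart_inv)
  obtain \<mu> where mu: "riemannian_measure M \<mu>"
    and crit: "\<And>\<epsilon> K \<Phi>. sphere_variation M \<phi> \<epsilon> K \<Phi> \<Longrightarrow>
      ((\<lambda>t. bienergy M \<mu> K (\<Phi> t)) has_real_derivative 0) (at 0)"
    using bih by (auto simp: biharmonic_in_sphere_def)
  have "sphere_variation M \<phi> 1 (chart_inv c ` ?B) (normal_variation V)"
    by (rule sphere_variation_normal[OF smV normalV compactin_chart_inv[OF c(1) compact_cball r(2)]])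
      (auto simp: V_def manifold_bump_eq_0[OF c(1) r(1)])
  from DERIV_unique[OF crit[OF this] bienergy_derivative[OF mu compact_cball r(2)]]
  have "0 = (LINT x:?B|lborel. chart.vol x *
      (lap g \<psi> x \<bullet> lap g v x - (lap g \<psi> x \<bullet> \<psi> x) * (lap g \<psi> x \<bullet> v x + lap g v x \<bullet> \<psi> x)))" .
  also have "\<dots> = (LINT x:?B|lborel. 2 * ?m * (chart.vol x * (?\<eta> x * h x)) + chart.vol x * ?D x)"
  proof (rule set_lebesgue_integral_cong)
    show "\<forall>x. x \<in> ?B \<longrightarrow> chart.vol x *
        (lap g \<psi> x \<bullet> lap g v x - (lap g \<psi> x \<bullet> \<psi> x) * (lap g \<psi> x \<bullet> v x + lap g v x \<bullet> \<psi> x)) =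
        2 * ?m * (chart.vol x * (?\<eta> x * h x)) + chart.vol x * ?D x"
    proof (intro allI impI)
      fix x assume "x \<in> ?B"
      then have x: "x \<in> chart_dom c" using r by blast
      \<comment> \<open>The coordinate form of \<open>V\<close> equals \<open>bump a r\<close> times
        \<tau> only over the chart domain; as this set is open, the Laplacians at \<open>x\<close>
        agree.\<close>
      have lv: "lap g v x = lap g (\<lambda>y. ?\<eta> y *\<^sub>R chart_rep c tau y) x"
        by (rule lap_cong_open[OF open_chart_dom[OF c(1)] x]) (rule v_eq)
      have eq: "lap g \<psi> x \<bullet> lap g v x - (lap g \<psi> x \<bullet> \<psi> x) * (lap g \<psi> x \<bullet> v x + lap g v x \<bullet> \<psi> x) =
          2 * ?m * (?\<eta> x * h x) + ?D x"
        using variation_integrand[OF c(1) x sb eigen] unfolding lv v_eq[OF x] h_def[abs_def] by simp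
      show "chart.vol x *
        (lap g \<psi> x \<bullet> lap g v x - (lap g \<psi> x \<bullet> \<psi> x) * (lap g \<psi> x \<bullet> v x + lap g v x \<bullet> \<psi> x)) =
        2 * ?m * (chart.vol x * (?\<eta> x * h x)) + chart.vol x * ?D x"
        unfolding eq by (simp add: distrib_left mult_ac)
    qed
  qed simp
  also have "\<dots> = (LINT x:?B|lborel. 2 * ?m * (chart.vol x * (?\<eta> x * h x))) + (LINT x:?B|lborel. chart.vol x * ?D x)"
  proof (intro set_integral_add set_integrable_compact[OF compact_cball])
    have "smooth_on (chart_dom c) (\<lambda>x. 2 * ?m * (chart.vol x * (?\<eta> x * h x)))"
      by (intro smooth_on_mult smooth_on_const chart.open_U chart.smooth_vol sb smh)
    then show "continuous_on ?B (\<lambda>x. 2 * ?m * (chart.vol x * (?\<eta> x * h x)))"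
      by (rule continuous_on_subset[OF smooth_on_imp_continuous_on r(2)])
    have "smooth_on (chart_dom c) (\<lambda>x. chart.vol x * ?D x)"
      by (intro smooth_on_mult smooth_on_add smooth_on_sum chart.open_U chart.smooth_vol smh
          chart.smooth_lap chart.smooth_grad sb smooth_on_partial)
    then show "continuous_on ?B (\<lambda>x. chart.vol x * ?D x)"
      by (rule continuous_on_subset[OF smooth_on_imp_continuous_on r(2)])
  qed
  also have "(LINT x:?B|lborel. chart.vol x * ?D x) = 0"
    by (rule bump_flux_integral[OF c(1) r smh])
  finally have zero: "(LINT x:?B|lborel. 2 * ?m * (chart.vol x * (?\<eta> x * h x))) = 0" by simp
  have "(LINT x:?B|lborel. 2 * ?m * (chart.vol x * (?\<eta> x * h x))) > 0"
  proof (rule set_integral_continuous_pos[OF compact_cball])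
    have "smooth_on (chart_dom c) (\<lambda>x. 2 * ?m * (chart.vol x * (?\<eta> x * h x)))"
      by (intro smooth_on_mult smooth_on_const chart.open_U chart.smooth_vol sb smh)
    then show "continuous_on ?B (\<lambda>x. 2 * ?m * (chart.vol x * (?\<eta> x * h x)))"
      by (rule continuous_on_subset[OF smooth_on_imp_continuous_on r(2)])
    show "0 \<le> 2 * ?m * (chart.vol x * (?\<eta> x * h x))" if "x \<in> ?B" for x
      using chart.vol_pos[of x] that r(2)
      by (intro mult_nonneg_nonneg bump_nonneg) (auto simp: h_def less_imp_le)
    show "a \<in> interior ?B" using r by simp
    have "h a > 0" using ne a(2) by (simp add: h_def)
    then show "0 < 2 * ?m * (chart.vol a * (?\<eta> a * h a))"
      using chart.vol_pos[OF a(1)] bump_pos[OF r(1), of a] by simp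
  qed
  then show False using zero by simp
qed

end

theorem theorem2p3:
  fixes M :: "('a, 'm::finite) manifold_data"
    and \<phi> :: "'a \<Rightarrow> real ^ 'n"
    and lam :: "'a \<Rightarrow> real"
  assumes "riemannian_manifold M"
    and "isometric_immersion M \<phi>"
    and "\<phi> ` points M \<subseteq> sphere 0 1"
    and "\<forall>p\<in>points M. vec_laplacian M (vec_laplacian M \<phi>) p = lam p *\<^sub>R \<phi> p"
    and "biharmonic_in_sphere M \<phi>"
  shows "(\<forall>p\<in>points M. lam p = (real CARD('m))\<^sup>2) \<and> minimal_in_sphere M \<phi>"
proof -
  interpret spherical_immersion M \<phi>
    by unfold_locales (fact assms(1-3))+
  let ?m = "real CARD('m)"
  have tau0: "tau p = 0" if "p \<in> points M" for p
    by (rule biharmonic_tau_eq_0[OF _ assms(5) that, of lam]) (use assms(4) in blast)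
  then have lap_phi: "vec_laplacian M \<phi> p = (- ?m) *\<^sub>R \<phi> p" if "p \<in> points M" for p
    using that by (simp add: tau_def add_eq_0_iff)
  have "lam p = ?m\<^sup>2" if p: "p \<in> points M" for p
  proof -
    obtain c where c: "c \<in> atlas M" "p \<in> fst c" using chart_at[OF p] by blast
    interpret c: metric_chart "chart_dom c" "chart_rep c (gmat M c)"
      by (rule metric_chart[OF c(1)])
    have x: "snd c p \<in> chart_dom c" using c by blast
    have "lam p *\<^sub>R \<phi> p = vec_laplacian M (vec_laplacian M \<phi>) p"
      using assms(4) p by simp
    also have "\<dots> = lap (chart_rep c (gmat M c)) (chart_rep c (vec_laplacian M \<phi>)) (snd c p)"
      by (rule vec_laplacian_chart[OF smooth_map_vec_laplacian[OF smooth_phi] c])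
    \<comment> \<open>\<open>lap_phi\<close> holds on the whole chart domain, not just at
      \<open>p\<close>, so it may be inserted under the outer Laplacian.\<close>
    also have "\<dots> = lap (chart_rep c (gmat M c)) (\<lambda>y. (- ?m) *\<^sub>R chart_rep c \<phi> y) (snd c p)"
      by (rule lap_cong_open[OF c.open_U x]) (rule lap_phi[OF chart_inv_points[OF c(1)]])
    also have "\<dots> = (- ?m) *\<^sub>R vec_laplacian M \<phi> p"
      unfolding c.lap_bounded_linear[OF bounded_linear_scaleR_right smooth_mapD[OF smooth_phi c(1)] x]
        vec_laplacian_chart[OF smooth_phi c] ..
    also have "\<dots> = ?m\<^sup>2 *\<^sub>R \<phi> p"
      by (simp add: lap_phi[OF p] power2_eq_square)
    \<comment> \<open>Pairing with the unit vector \<open>\<phi> p\<close> extracts the scalar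
      coefficients.\<close>
    finally have "(lam p *\<^sub>R \<phi> p) \<bullet> \<phi> p = (?m\<^sup>2 *\<^sub>R \<phi> p) \<bullet> \<phi> p"
      by (rule arg_cong[of _ _ "\<lambda>y. y \<bullet> \<phi> p"])
    then show ?thesis by (simp only: inner_scaleR_left phi_unit[OF p] mult_1_right)
  qed
  moreover have "minimal_in_sphere M \<phi>"
    unfolding minimal_in_sphere_def by (simp add: mean_curvature_eq tension_phi tau0)
  ultimately show ?thesis by blast
qed

end
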